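(* Let $\mathfrak{g}$ be a commutative Lie algebra over a field $\mathbb{F}$ of characteristic $2$, and let $M$ be a left $\mathfrak{g}$-module considered as a symmetric Leibniz $\mathfrak{g}$-bimodule $M_s$. Then there is a spectral sequence converging to $H^\bullet_{\mathrm{rel},S}(\mathfrak{g},M)$ with second term $$E_2^{p,q}=HR^p_{S}(\mathfrak{g})\otimes HL^{q}(\mathfrak{g},M_s).$$
   Context: Let $\mathbb{F}$ be a field of characteristic $2$. A commutative Lie algebra over $\mathbb{F}$ is a vector space $\mathfrak{g}$ with a bilinear bracket satisfying $[x,y]=[y,x]$ and $[x,[y,z]]+[y,[z,x]]+[z,[x,y]]=0$ (it is not required that $[x,x]=0$); it is in particular a left Leibniz algebra. A left $\mathfrak{g}$-module is a vector space $M$ with $[x,y]\cdot m=x\cdot(y\cdot m)+y\cdot(x\cdot m)$; $M_s$ denotes $M$ with right action $m\cdot x=x\cdot m$ (signs are irrelevant). $CS^n(\mathfrak{g},M):=\mathrm{Hom}_{\mathbb{F}}(S^n\mathfrak{g},M)$, with $S^n\mathfrak{g}$ the symmetric power (quotient of $\mathfrak{g}^{\otimes n}$) and differential $$d^nf(x_1,\dots,x_{n+1})=\sum_{i=1}^{n+1}x_i\cdot f(x_1,\dots,\hat{x}_i,\dots,x_{n+1})+\sum_{1\le i<j\le n+1}f([x_i,x_j],x_1,\dots,\hat{x}_i,\dots,\hat{x}_j,\dots,x_{n+1}).$$ Leibniz cohomology $HL^\bullet(\mathfrak{g},M_s)$ is the cohomology of $CL^n(\mathfrak{g},M):=\mathrm{Hom}_{\mathbb{F}}(\mathfrak{g}^{\otimes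 n},M)$ with $$d^nf(x_1,\dots,x_{n+1})=\sum_{i=1}^{n+1}x_i\cdot f(x_1,\dots,\hat{x}_i,\dots,x_{n+1})+\sum_{1\le i<j\le n+1}f(x_1,\dots,\hat{x}_i,\dots,[x_i,x_j],\dots,x_{n+1}),$$ where $[x_i,x_j]$ stands in the place of $x_j$. Let $i_3:CS^\bullet(\mathfrak{g},M)\hookrightarrow CL^\bullet(\mathfrak{g},M)$ be the inclusion. The relative complex is $C^\bullet_{\mathrm{rel},S}(\mathfrak{g},M):=\mathrm{Coker}(i_3)[-2]$, with the shift such that a class in $C^n_{\mathrm{rel},S}$ is represented by a cochain with $n+2$ arguments; its cohomology is $H^\bullet_{\mathrm{rel},S}(\mathfrak{g},M)$. Let $\overline{CS}^0(\mathfrak{g},\mathbb{F}):=0$ and $\overline{CS}^n(\mathfrak{g},\mathbb{F}):=CS^n(\mathfrak{g},\mathbb{F})$ for $n>0$ (trivial coefficients). Let $\mathfrak{g}^*$ be the coadjoint module, $(x\cdot\xi)(y)=\xi([x,y])$, so that $CS^n(\mathfrak{g},\mathfrak{g}^* )=\mathrm{Hom}_{\mathbb{F}}(S^n\mathfrak{g}\otimes\mathfrak{g},\mathbb{F})$. The product maps $m_3:S^n\mathfrak{g}\otimes\mathfrak{g}\to S^{n+1}\mathfrak{g}$, $x_1\vee\dots\vee x_n\otimes x\mapsto x_1\vee\dots\vee x_n\vee x$, induce a monomorphism of complexes $m_3^\bullet$ sending $\overline{CS}^{n+1}(\mathfrak{g},\mathbb{F})$ into $CS^n(\mathfrak{g},\mathfrak{g}^*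 )$. Set $CR^\bullet_S(\mathfrak{g}):=\mathrm{Coker}(m_3^\bullet)[-1]$, with the shift such that $CR^n_S(\mathfrak{g})=CS^{n+1}(\mathfrak{g},\mathfrak{g}^* )/m_3^\bullet(\overline{CS}^{n+2}(\mathfrak{g},\mathbb{F}))$ for $n\ge 0$; its cohomology is $HR^\bullet_S(\mathfrak{g})$.
   Formalization: The formula E_2^{p,q} = HR^p ⊗ HL^q is stated where HR^p or HL^q is finite-dimensional (it can fail otherwise for the algebraic tensor product); for all p,q, E_2^{p,q} is HR^p with coefficients in the vector space HL^q, i.e. the completed tensor product. *)

theory Defs
  imports
    "Jordan_Normal_Form.VS_Connect"
    "HOL-Algebra.AbelCoset"
    "HOL-Library.Function_Algebras"
    "HOL-Library.Multiset"
begin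

section \<open>Vector spaces with an explicit carrier\<close>

text \<open>
  The algebra, its module and the cochains live on types; quotients and everything derived from
  them are \<^type>\<open>module\<close> records over the field record \<^term>\<open>class_ring\<close>. The fields
  \<^term>\<open>mult\<close> and \<^term>\<open>one\<close> of such a record have no meaning for a vector space.
\<close>

definition space_on ::
    "('k \<Rightarrow> 'v \<Rightarrow> 'v) \<Rightarrow> 'v set \<Rightarrow> ('k, 'v::ab_group_add) module" where
  "space_on s A =
     \<lparr>carrier = A, mult = undefined, one = undefined, zero = 0, add = (+), smult = s\<rparr>"

definition pointwise :: "('k \<Rightarrow> 'v \<Rightarrow> 'v) \<Rightarrow> 'k \<Rightarrow> ('x \<Rightarrow> 'v) \<Rightarrow> ('x \<Rightarrow> 'v)" where
  "pointwise s c f = (\<lambda>x. s c (f x))"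

definition quot :: "('k, 'v) module \<Rightarrow> 'v set \<Rightarrow> ('k, 'v set) module" where
  "quot V S =
     \<lparr>carrier = A_RCOSETS V S, mult = undefined, one = undefined, zero = S,
      add = set_add V, smult = (\<lambda>c X. set_add V S ((\<lambda>x. c \<odot>\<^bsub>V\<^esub> x) ` X))\<rparr>"

text \<open>The map induced by \<open>f\<close> from a quotient space to \<open>quot W T\<close>.\<close>

definition quot_map :: "('k, 'w) module \<Rightarrow> 'w set \<Rightarrow> ('v \<Rightarrow> 'w) \<Rightarrow> 'v set \<Rightarrow> 'w set" where
  "quot_map W T f X = set_add W T (f ` X)"

definition iso_vs :: "('k::field, 'v) module \<Rightarrow> ('k, 'w) module \<Rightarrow> bool" where
  "iso_vs V W \<longleftrightarrow>
     (\<exists>f. linear_map class_ring V W f \<and> bij_betw f (carrier V) (carrier W))"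

text \<open>
  The tensor product over the field: the free vector space on the set
  \<^term>\<open>carrier V \<times> carrier W\<close> modulo the bilinearity relations.
\<close>

definition unit_vec :: "'x \<Rightarrow> 'x \<Rightarrow> 'k::field" where
  "unit_vec a = (\<lambda>z. if z = a then 1 else 0)"

definition free_vs :: "'x set \<Rightarrow> ('x \<Rightarrow> 'k::field) set" where
  "free_vs A = {\<phi>. finite {z. \<phi> z \<noteq> 0} \<and> {z. \<phi> z \<noteq> 0} \<subseteq> A}"

definition tensor_rels ::
    "('k::field, 'v) module \<Rightarrow> ('k, 'w) module \<Rightarrow> ('v \<times> 'w \<Rightarrow> 'k) set" where
  "tensor_rels V W =
     {unit_vec (v \<oplus>\<^bsub>V\<^esub> v', w) - unit_vec (v, w) - unit_vec (v', w) | v v' w.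
        v \<in> carrier V \<and> v' \<in> carrier V \<and> w \<in> carrier W} \<union>
     {unit_vec (v, w \<oplus>\<^bsub>W\<^esub> w') - unit_vec (v, w) - unit_vec (v, w') | v w w'.
        v \<in> carrier V \<and> w \<in> carrier W \<and> w' \<in> carrier W} \<union>
     {unit_vec (c \<odot>\<^bsub>V\<^esub> v, w) - pointwise (*) c (unit_vec (v, w)) | c v w.
        v \<in> carrier V \<and> w \<in> carrier W} \<union>
     {unit_vec (v, c \<odot>\<^bsub>W\<^esub> w) - pointwise (*) c (unit_vec (v, w)) | c v w.
        v \<in> carrier V \<and> w \<in> carrier W}"

definition tensor ::
    "('k::field, 'v) module \<Rightarrow> ('k, 'w) module \<Rightarrow> ('k, ('v \<times> 'w \<Rightarrow> 'k) set) module" where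
  "tensor V W =
     quot (space_on (pointwise (*)) (free_vs (carrier V \<times> carrier W)))
       (Modules.module.span (pointwise (*)) (tensor_rels V W))"


section \<open>Cochain complexes and spectral sequences\<close>

text \<open>All gradings are by the integers.\<close>

definition cohomology ::
    "(int \<Rightarrow> ('k, 'v) module) \<Rightarrow> (int \<Rightarrow> 'v \<Rightarrow> 'v) \<Rightarrow> int \<Rightarrow> ('k, 'v set) module" where
  "cohomology C d n =
     quot (C n \<lparr>carrier := {x \<in> carrier (C n). d n x = \<zero>\<^bsub>C (n + 1)\<^esub>}\<rparr>)
       (d (n - 1) ` carrier (C (n - 1)))"

text \<open>
  A cohomological spectral sequence starting at the second page; \<open>d r p q\<close> is the differential
  \<open>E\<^sub>r\<^sup>p\<^sup>,\<^sup>q \<rightarrow> E\<^sub>r\<^sup>p\<^sup>+\<^sup>r\<^sup>,\<^sup>q\<^sup>-\<^sup>r\<^sup>+\<^sup>1\<close>. The values for \<open>r < 2\<close> are irrelevant.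
\<close>

definition spectral_sequence ::
    "(nat \<Rightarrow> int \<Rightarrow> int \<Rightarrow> ('k::field, 'e) module) \<Rightarrow>
     (nat \<Rightarrow> int \<Rightarrow> int \<Rightarrow> 'e \<Rightarrow> 'e) \<Rightarrow> bool" where
  "spectral_sequence E d \<longleftrightarrow>
     (\<forall>r\<ge>2. \<forall>p q.
        linear_map class_ring (E r p q) (E r (p + int r) (q - int r + 1)) (d r p q) \<and>
        (\<forall>x\<in>carrier (E r p q).
           d r (p + int r) (q - int r + 1) (d r p q x) =
             \<zero>\<^bsub>E r (p + 2 * int r) (q - 2 * int r + 2)\<^esub>) \<and>
        iso_vs (E (Suc r) p q)
          (quot (E r p q \<lparr>carrier := {x \<in> carrier (E r p q).
                   d r p q x = \<zero>\<^bsub>E r (p + int r) (q - int r + 1)\<^esub>}\<rparr>)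
             (d r (p - int r) (q + int r - 1) ` carrier (E r (p - int r) (q + int r - 1)))))"

text \<open>
  Convergence to \<open>H\<close>: every \<open>H n\<close> has a finite decreasing filtration \<open>F n\<close>, and at every position
  the differentials out of and into that position vanish from some page on, the resulting stable
  value \<open>E\<^sub>\<infinity>\<^sup>p\<^sup>,\<^sup>q\<close> being the \<open>p\<close>-th graded piece of \<open>H (p + q)\<close>.
\<close>

definition converges_to ::
    "(nat \<Rightarrow> int \<Rightarrow> int \<Rightarrow> ('k::field, 'e) module) \<Rightarrow>
     (nat \<Rightarrow> int \<Rightarrow> int \<Rightarrow> 'e \<Rightarrow> 'e) \<Rightarrow> (int \<Rightarrow> ('k, 'h) module) \<Rightarrow> bool" where
  "converges_to E d H \<longleftrightarrow>
     (\<exists>F :: int \<Rightarrow> int \<Rightarrow> 'h set.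
        (\<forall>n p. VectorSpace.subspace class_ring (F n p) (H n) \<and> F n (p + 1) \<subseteq> F n p) \<and>
        (\<forall>n. (\<exists>s. F n s = carrier (H n)) \<and> (\<exists>t. F n t = {\<zero>\<^bsub>H n\<^esub>})) \<and>
        (\<forall>p q. \<exists>R\<ge>2. \<forall>r\<ge>R.
           (\<forall>x\<in>carrier (E r p q).
              d r p q x = \<zero>\<^bsub>E r (p + int r) (q - int r + 1)\<^esub>) \<and>
           (\<forall>x\<in>carrier (E r (p - int r) (q + int r - 1)).
              d r (p - int r) (q + int r - 1) x = \<zero>\<^bsub>E r p q\<^esub>) \<and>
           iso_vs (E r p q)
             (quot (H (p + q) \<lparr>carrier := F (p + q) p\<rparr>) (F (p + q) (p + 1)))))"


section \<open>Commutative Lie algebras and their modules\<close>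

locale commutative_lie_algebra = vector_space sg
  for sg :: "'k::field \<Rightarrow> 'g::ab_group_add \<Rightarrow> 'g" +
  fixes br :: "'g \<Rightarrow> 'g \<Rightarrow> 'g"
  assumes bracket_linear_left: "Vector_Spaces.linear sg sg (\<lambda>x. br x y)"
    and bracket_linear_right: "Vector_Spaces.linear sg sg (\<lambda>y. br x y)"
    and bracket_commute: "br x y = br y x"
    and jacobi: "br x (br y z) + br y (br z x) + br z (br x y) = 0"

locale lie_module = commutative_lie_algebra sg br + M: vector_space sm
  for sg :: "'k::field \<Rightarrow> 'g::ab_group_add \<Rightarrow> 'g" and br :: "'g \<Rightarrow> 'g \<Rightarrow> 'g"
    and sm :: "'k \<Rightarrow> 'm::ab_group_add \<Rightarrow> 'm" +
  fixes act :: "'g \<Rightarrow> 'm \<Rightarrow> 'm"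
  assumes act_linear_left: "Vector_Spaces.linear sg sm (\<lambda>x. act x m)"
    and act_linear_right: "Vector_Spaces.linear sm sm (\<lambda>m. act x m)"
    and act_bracket: "act (br x y) m = act x (act y m) + act y (act x m)"


section \<open>Cochains\<close>

text \<open>
  An element of \<open>Hom(\<gg>\<^sup>\<otimes>\<^sup>n, N)\<close> is given as the corresponding \<open>n\<close>-linear map, a function
  on lists that is zero on lists of length other than \<open>n\<close>; the elements of \<open>Hom(S\<^sup>n \<gg>, N)\<close> are
  those that are invariant under permutation of the arguments (so \<open>i\<^sub>3\<close> is set inclusion). The
  coefficients \<open>N\<close> form a subspace of a type with scalar multiplication \<open>sn\<close>.
\<close>

definition CL ::
    "('k::field \<Rightarrow> 'g::ab_group_add \<Rightarrow> 'g) \<Rightarrow> ('k \<Rightarrow> 'n::ab_group_add \<Rightarrow> 'n) \<Rightarrow> 'n set \<Rightarrow>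
     int \<Rightarrow> ('g list \<Rightarrow> 'n) set" where
  "CL sg sn N n =
     (if n < 0 then {0}
      else {f. (\<forall>xs. f xs \<in> N) \<and>
               (\<forall>xs. int (length xs) \<noteq> n \<longrightarrow> f xs = 0) \<and>
               (\<forall>xs i. int (length xs) = n \<longrightarrow> i < length xs \<longrightarrow>
                  Vector_Spaces.linear sg sn (\<lambda>x. f (xs[i := x])))})"

definition CS ::
    "('k::field \<Rightarrow> 'g::ab_group_add \<Rightarrow> 'g) \<Rightarrow> ('k \<Rightarrow> 'n::ab_group_add \<Rightarrow> 'n) \<Rightarrow> 'n set \<Rightarrow>
     int \<Rightarrow> ('g list \<Rightarrow> 'n) set" where
  "CS sg sn N n = {f \<in> CL sg sn N n. \<forall>xs ys. mset xs = mset ys \<longrightarrow> f xs = f ys}"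

definition CS_bar ::
    "('k::field \<Rightarrow> 'g::ab_group_add \<Rightarrow> 'g) \<Rightarrow> ('k \<Rightarrow> 'n::ab_group_add \<Rightarrow> 'n) \<Rightarrow> 'n set \<Rightarrow>
     int \<Rightarrow> ('g list \<Rightarrow> 'n) set" where
  "CS_bar sg sn N n = (if n \<le> 0 then {0} else CS sg sn N n)"

definition delete_nth :: "nat \<Rightarrow> 'a list \<Rightarrow> 'a list" where
  "delete_nth i xs = take i xs @ drop (Suc i) xs"

text \<open>
  Here the argument positions are counted from 0. In the second sum of \<open>dCL\<close> the bracket replaces
  the \<open>j\<close>-th argument before the \<open>i\<close>-th one is removed.
\<close>

definition dCL ::
    "('g \<Rightarrow> 'g \<Rightarrow> 'g) \<Rightarrow> ('g \<Rightarrow> 'n \<Rightarrow> 'n) \<Rightarrow> ('g list \<Rightarrow> 'n::ab_group_add) \<Rightarrow> 'g list \<Rightarrow> 'n"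
  where
  "dCL br act f xs =
     (\<Sum>i<length xs. act (xs ! i) (f (delete_nth i xs))) +
     (\<Sum>j<length xs. \<Sum>i<j. f (delete_nth i (xs[j := br (xs ! i) (xs ! j)])))"

definition dCS ::
    "('g \<Rightarrow> 'g \<Rightarrow> 'g) \<Rightarrow> ('g \<Rightarrow> 'n \<Rightarrow> 'n) \<Rightarrow> ('g list \<Rightarrow> 'n::ab_group_add) \<Rightarrow> 'g list \<Rightarrow> 'n"
  where
  "dCS br act f xs =
     (\<Sum>i<length xs. act (xs ! i) (f (delete_nth i xs))) +
     (\<Sum>j<length xs. \<Sum>i<j. f (br (xs ! i) (xs ! j) # delete_nth i (delete_nth j xs)))"

definition HL ::
    "('k::field \<Rightarrow> 'g::ab_group_add \<Rightarrow> 'g) \<Rightarrow> ('g \<Rightarrow> 'g \<Rightarrow> 'g) \<Rightarrow>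
     ('k \<Rightarrow> 'm::ab_group_add \<Rightarrow> 'm) \<Rightarrow> ('g \<Rightarrow> 'm \<Rightarrow> 'm) \<Rightarrow>
     int \<Rightarrow> ('k, ('g list \<Rightarrow> 'm) set) module" where
  "HL sg br sm act =
     cohomology (\<lambda>n. space_on (pointwise sm) (CL sg sm UNIV n)) (\<lambda>n. dCL br act)"

definition C_rel ::
    "('k::field \<Rightarrow> 'g::ab_group_add \<Rightarrow> 'g) \<Rightarrow> ('k \<Rightarrow> 'm::ab_group_add \<Rightarrow> 'm) \<Rightarrow>
     int \<Rightarrow> ('k, ('g list \<Rightarrow> 'm) set) module" where
  "C_rel sg sm n =
     quot (space_on (pointwise sm) (CL sg sm UNIV (n + 2))) (CS sg sm UNIV (n + 2))"

definition H_rel ::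
    "('k::field \<Rightarrow> 'g::ab_group_add \<Rightarrow> 'g) \<Rightarrow> ('g \<Rightarrow> 'g \<Rightarrow> 'g) \<Rightarrow>
     ('k \<Rightarrow> 'm::ab_group_add \<Rightarrow> 'm) \<Rightarrow> ('g \<Rightarrow> 'm \<Rightarrow> 'm) \<Rightarrow>
     int \<Rightarrow> ('k, ('g list \<Rightarrow> 'm) set set) module" where
  "H_rel sg br sm act =
     cohomology (C_rel sg sm)
       (\<lambda>n. quot_map (space_on (pointwise sm) (CL sg sm UNIV (n + 3)))
              (CS sg sm UNIV (n + 3)) (dCL br act))"

text \<open>
  The following is done with a vector space \<open>W\<close> (trivial module, subspace of a type with scalar
  multiplication \<open>sw\<close>) in place of the ground field: \<open>Hom(\<gg>, W)\<close> with the action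
  \<open>(x \<cdot> \<xi>)(y) = \<xi>[x, y]\<close> replaces the coadjoint module, which is the case
  \<open>W = UNIV :: 'k set\<close> and \<open>sw = (*)\<close>. There is a natural injection
  \<open>HR\<^sup>p(\<gg>) \<otimes> W \<rightarrow> HR\<^sup>p(\<gg>; W)\<close>, bijective if and only if one factor is finite-dimensional;
  in general \<open>HR\<^sup>p(\<gg>; W)\<close> is the completed tensor product, \<open>HR\<^sup>p(\<gg>)\<close> being the full dual of
  the corresponding homology space with its linear topology.
\<close>

definition lin_maps ::
    "('k::field \<Rightarrow> 'g::ab_group_add \<Rightarrow> 'g) \<Rightarrow> ('k \<Rightarrow> 'w::ab_group_add \<Rightarrow> 'w) \<Rightarrow> 'w set \<Rightarrow>
     ('g \<Rightarrow> 'w) set" where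
  "lin_maps sg sw W = {\<xi>. Vector_Spaces.linear sg sw \<xi> \<and> range \<xi> \<subseteq> W}"

definition coad :: "('g \<Rightarrow> 'g \<Rightarrow> 'g) \<Rightarrow> 'g \<Rightarrow> ('g \<Rightarrow> 'w) \<Rightarrow> ('g \<Rightarrow> 'w)" where
  "coad br x \<xi> = (\<lambda>y. \<xi> (br x y))"

definition m3 :: "('g list \<Rightarrow> 'w) \<Rightarrow> 'g list \<Rightarrow> 'g \<Rightarrow> 'w" where
  "m3 f = (\<lambda>xs y. f (xs @ [y]))"

definition CR_coeff ::
    "('k::field \<Rightarrow> 'g::ab_group_add \<Rightarrow> 'g) \<Rightarrow> ('k \<Rightarrow> 'w::ab_group_add \<Rightarrow> 'w) \<Rightarrow> 'w set \<Rightarrow>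
     int \<Rightarrow> ('k, ('g list \<Rightarrow> 'g \<Rightarrow> 'w) set) module" where
  "CR_coeff sg sw W n =
     quot (space_on (pointwise (pointwise sw))
             (CS sg (pointwise sw) (lin_maps sg sw W) (n + 1)))
       (m3 ` CS_bar sg sw W (n + 2))"

definition HR_coeff ::
    "('k::field \<Rightarrow> 'g::ab_group_add \<Rightarrow> 'g) \<Rightarrow> ('g \<Rightarrow> 'g \<Rightarrow> 'g) \<Rightarrow>
     ('k \<Rightarrow> 'w::ab_group_add \<Rightarrow> 'w) \<Rightarrow> 'w set \<Rightarrow>
     int \<Rightarrow> ('k, ('g list \<Rightarrow> 'g \<Rightarrow> 'w) set set) module" where
  "HR_coeff sg br sw W =
     cohomology (CR_coeff sg sw W)
       (\<lambda>n. quot_map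
              (space_on (pointwise (pointwise sw))
                 (CS sg (pointwise sw) (lin_maps sg sw W) (n + 2)))
              (m3 ` CS_bar sg sw W (n + 3)) (dCS br (coad br)))"

definition HR ::
    "('k::field \<Rightarrow> 'g::ab_group_add \<Rightarrow> 'g) \<Rightarrow> ('g \<Rightarrow> 'g \<Rightarrow> 'g) \<Rightarrow>
     int \<Rightarrow> ('k, ('g list \<Rightarrow> 'g \<Rightarrow> 'k) set set) module" where
  "HR sg br = HR_coeff sg br (*) UNIV"

end

theory Submission imports Defs
begin

text \<open>
  Filter the Leibniz complex by the cochains that are symmetric in their first \<open>p + 1\<close> arguments; the
  filtration ends in \<open>CS\<close>. A cochain of filtration \<open>p\<close> is symmetric in \<open>p + 1\<close> arguments with values in
  Leibniz cochains of the remaining ones, and the terms of the differential that act on these values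
  are Lie derivatives. By the Cartan formula they vanish on cohomology, so that the second page is
  that of the trivial module \<open>HL\<^sup>q(\<gg>, M)\<close>: the argument following the symmetric ones, taken modulo
  symmetry in it as well, turns \<open>CS(\<gg>, W)\<close> into \<open>CR(\<gg>; W)\<close>. For \<open>W = HL\<^sup>q(\<gg>, M)\<close> the resulting
  \<open>HR\<^sup>p(\<gg>; W)\<close> is \<open>HR\<^sup>p(\<gg>) \<otimes> W\<close> as soon as one of the two factors has finite dimension.
\<close>

section \<open>Quotients and presentations\<close>

text \<open>Two obstacles shape the argument. A cochain that survives to the second page has values
  that are cocycles only up to corrections symmetric in one more argument, so they have no
  cohomology class. The class map is therefore extended linearly from cocycles to all cochains of
  degree \<open>q\<close>; another extension changes the result only by a term symmetric in one more
  argument, which the quotient \<open>CR\<close> ignores. With linear choices of representatives and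
  primitives the second page is compared with \<open>HR_coeff\<close> directly, and the first page
  is never identified. The other obstacle is the tensor product. If only \<open>HR\<close> has
  finite dimension, a cocycle with values in \<open>W\<close> need not be a finite sum of pure
  tensors; it is merely cohomologous to one. The correcting cochain and the vectors of
  \<open>W\<close> come from a solvability criterion for possibly infinite linear systems:
  solvability after every functional implies solvability in \<open>W\<close>. Characteristic 2
  enters through \<open>a + a = 0\<close>, which replaces all cancellations that would otherwise be
  due to signs.\<close>

lemma vector_space_pointwise:
  assumes "vector_space s"
  shows "vector_space (pointwise s)"
proof -
  interpret vector_space s by fact
  show ?thesis
    by unfold_locales (auto simp: pointwise_def fun_eq_iff scale_right_distrib scale_left_distrib)
qed

lemma vector_space_mult: "vector_space ((*) :: 'k::field \<Rightarrow> 'k \<Rightarrow> 'k)"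
  by unfold_locales (auto simp: algebra_simps)

lemma linear_mapI:
  assumes "vectorspace class_ring V" "vectorspace class_ring W"
    and "\<And>x. x \<in> carrier V \<Longrightarrow> f x \<in> carrier W"
    and "\<And>x y. x \<in> carrier V \<Longrightarrow> y \<in> carrier V \<Longrightarrow> f (x \<oplus>\<^bsub>V\<^esub> y) = f x \<oplus>\<^bsub>W\<^esub> f y"
    and "\<And>c x. x \<in> carrier V \<Longrightarrow> f (c \<odot>\<^bsub>V\<^esub> x) = c \<odot>\<^bsub>W\<^esub> f x"
  shows "linear_map class_ring V W f"
proof -
  interpret V: vectorspace class_ring V by fact
  interpret W: vectorspace class_ring W by fact
  show ?thesis
    by unfold_locales (use assms(3-) in \<open>auto simp: LinearCombinations.module_hom_def\<close>)
qed

text \<open>The axioms are identities and the existence of negatives, and both pass along a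
  surjection compatible with the operations. As nothing else is assumed of the record
  \<open>X\<close>, this yields the vector space structure on quotients.\<close>

lemma vectorspace_surj_image:
  fixes V :: "('k::field, 'v) module" and X :: "('k, 'x) module"
  assumes V: "vectorspace class_ring V"
    and surj: "f ` carrier V = carrier X"
    and add: "\<And>x y. x \<in> carrier V \<Longrightarrow> y \<in> carrier V \<Longrightarrow> f (x \<oplus>\<^bsub>V\<^esub> y) = f x \<oplus>\<^bsub>X\<^esub> f y"
    and smult: "\<And>c x. x \<in> carrier V \<Longrightarrow> f (c \<odot>\<^bsub>V\<^esub> x) = c \<odot>\<^bsub>X\<^esub> f x"
    and zero: "f \<zero>\<^bsub>V\<^esub> = \<zero>\<^bsub>X\<^esub>"
  shows "vectorspace class_ring X"
proof -
  interpret V: vectorspace class_ring V by fact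
  note [simp] = add[symmetric] smult[symmetric] zero[symmetric]
  show ?thesis
  proof (rule vs_criteria)
    show "\<zero>\<^bsub>X\<^esub> \<in> carrier X"
      using surj zero by (metis V.M.zero_closed imageI)
    show "\<forall>v w. v \<in> carrier X \<and> w \<in> carrier X \<longrightarrow> v \<oplus>\<^bsub>X\<^esub> w \<in> carrier X"
      unfolding surj[symmetric] by auto
    show "\<forall>v\<in>carrier X. \<exists>neg_v\<in>carrier X. v \<oplus>\<^bsub>X\<^esub> neg_v = \<zero>\<^bsub>X\<^esub>"
    proof
      fix v assume "v \<in> carrier X"
      then obtain u where u: "u \<in> carrier V" "v = f u" using surj by auto
      then have "v \<oplus>\<^bsub>X\<^esub> f (\<ominus>\<^bsub>V\<^esub> u) = \<zero>\<^bsub>X\<^esub>" by (simp add: V.M.r_neg)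
      then show "\<exists>neg_v\<in>carrier X. v \<oplus>\<^bsub>X\<^esub> neg_v = \<zero>\<^bsub>X\<^esub>" using surj u by blast
    qed
    show "\<forall>c v. c \<in> carrier class_ring \<and> v \<in> carrier X \<longrightarrow> c \<odot>\<^bsub>X\<^esub> v \<in> carrier X"
      unfolding surj[symmetric] by auto
    show "\<forall>v w. v \<in> carrier X \<and> w \<in> carrier X \<longrightarrow> v \<oplus>\<^bsub>X\<^esub> w = w \<oplus>\<^bsub>X\<^esub> v"
      unfolding surj[symmetric] by (auto simp: V.M.a_comm)
    show "\<forall>v w x. v \<in> carrier X \<and> w \<in> carrier X \<and> x \<in> carrier X \<longrightarrow>
            v \<oplus>\<^bsub>X\<^esub> w \<oplus>\<^bsub>X\<^esub> x = v \<oplus>\<^bsub>X\<^esub> (w \<oplus>\<^bsub>X\<^esub> x)"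
      unfolding surj[symmetric] by (auto simp: V.M.a_assoc)
    show "\<forall>v\<in>carrier X. v \<oplus>\<^bsub>X\<^esub> \<zero>\<^bsub>X\<^esub> = v"
      unfolding surj[symmetric] by auto
    show "\<forall>a b v. a \<in> carrier class_ring \<and> b \<in> carrier class_ring \<and> v \<in> carrier X \<longrightarrow>
            (a \<otimes>\<^bsub>class_ring\<^esub> b) \<odot>\<^bsub>X\<^esub> v = a \<odot>\<^bsub>X\<^esub> (b \<odot>\<^bsub>X\<^esub> v)"
      unfolding surj[symmetric] using V.smult_assoc1 by auto
    show "\<forall>v\<in>carrier X. \<one>\<^bsub>class_ring\<^esub> \<odot>\<^bsub>X\<^esub> v = v"
      unfolding surj[symmetric] using V.smult_one by auto
    show "\<forall>a b v. a \<in> carrier class_ring \<and> b \<in> carrier class_ring \<and> v \<in> carrier X \<longrightarrow>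
            (a \<oplus>\<^bsub>class_ring\<^esub> b) \<odot>\<^bsub>X\<^esub> v = a \<odot>\<^bsub>X\<^esub> v \<oplus>\<^bsub>X\<^esub> b \<odot>\<^bsub>X\<^esub> v"
      unfolding surj[symmetric] using V.smult_l_distr by auto
    show "\<forall>a v w. a \<in> carrier class_ring \<and> v \<in> carrier X \<and> w \<in> carrier X \<longrightarrow>
            a \<odot>\<^bsub>X\<^esub> (v \<oplus>\<^bsub>X\<^esub> w) = a \<odot>\<^bsub>X\<^esub> v \<oplus>\<^bsub>X\<^esub> a \<odot>\<^bsub>X\<^esub> w"
      unfolding surj[symmetric] using V.smult_r_distr by auto
  qed (rule class_field)
qed

lemma vectorspace_space_on:
  assumes "vector_space s" "Modules.module.subspace s A"
  shows "vectorspace class_ring (space_on s A)"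
proof -
  interpret vector_space s by fact
  show ?thesis
  proof (rule vs_criteria)
    show "\<forall>v\<in>carrier (space_on s A). \<exists>neg_v\<in>carrier (space_on s A).
            v \<oplus>\<^bsub>space_on s A\<^esub> neg_v = \<zero>\<^bsub>space_on s A\<^esub>"
      using subspace_neg[OF assms(2)] by (force simp: space_on_def)
  qed (use assms(2) in \<open>auto simp: space_on_def subspace_def class_field algebra_simps
        scale_left_distrib scale_right_distrib\<close>)
qed

section \<open>Cosets of a subspace\<close>

context
  fixes V :: "('k::field, 'v) module" and S
  assumes S: "VectorSpace.subspace class_ring S V"
begin

interpretation V: vectorspace class_ring V
  using S by (simp add: VectorSpace.subspace_def)

interpretation S: submodule class_ring S V
  using S by (simp add: VectorSpace.subspace_def)

lemma coset_eq: "S +>\<^bsub>V\<^esub> x = {t \<oplus>\<^bsub>V\<^esub> x | t. t \<in> S}"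
  by (auto simp: a_r_coset_def')

lemma subspace_neg_closed: "t \<in> S \<Longrightarrow> \<ominus>\<^bsub>V\<^esub> t \<in> S"
proof -
  assume t: "t \<in> S"
  then have "\<ominus>\<^bsub>class_ring\<^esub> \<one>\<^bsub>class_ring\<^esub> \<odot>\<^bsub>V\<^esub> t = \<ominus>\<^bsub>V\<^esub> t"
    using S.subset by (intro V.smult_minus_1) auto
  moreover have "\<ominus>\<^bsub>class_ring\<^esub> \<one>\<^bsub>class_ring\<^esub> \<odot>\<^bsub>V\<^esub> t \<in> S"
    using t by (intro S.smult_closed) auto
  ultimately show "\<ominus>\<^bsub>V\<^esub> t \<in> S" by metis
qed

lemma coset_eq_self_iff:
  assumes "x \<in> carrier V"
  shows "S +>\<^bsub>V\<^esub> x = S \<longleftrightarrow> x \<in> S"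
proof
  assume "S +>\<^bsub>V\<^esub> x = S"
  moreover have "\<zero>\<^bsub>V\<^esub> \<oplus>\<^bsub>V\<^esub> x \<in> S +>\<^bsub>V\<^esub> x" by (auto simp: coset_eq intro: exI[of _ "\<zero>\<^bsub>V\<^esub>"])
  ultimately show "x \<in> S" using assms by simp
next
  assume x: "x \<in> S"
  have "t \<in> S +>\<^bsub>V\<^esub> x" if t: "t \<in> S" for t
  proof -
    have "t = (t \<oplus>\<^bsub>V\<^esub> \<ominus>\<^bsub>V\<^esub> x) \<oplus>\<^bsub>V\<^esub> x"
      using t x S.subset by (simp add: V.M.a_assoc V.M.l_neg subset_iff)
    then show ?thesis using t x subspace_neg_closed by (auto simp: coset_eq)
  qed
  then show "S +>\<^bsub>V\<^esub> x = S" using x by (auto simp: coset_eq)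
qed

lemma coset_add:
  assumes "x \<in> carrier V" "y \<in> carrier V"
  shows "S +>\<^bsub>V\<^esub> (x \<oplus>\<^bsub>V\<^esub> y) = set_add V (S +>\<^bsub>V\<^esub> x) (S +>\<^bsub>V\<^esub> y)"
proof -
  have c: "t \<in> carrier V" if "t \<in> S" for t using that S.subset by auto
  have eq: "(t \<oplus>\<^bsub>V\<^esub> x) \<oplus>\<^bsub>V\<^esub> (t' \<oplus>\<^bsub>V\<^esub> y) = (t \<oplus>\<^bsub>V\<^esub> t') \<oplus>\<^bsub>V\<^esub> (x \<oplus>\<^bsub>V\<^esub> y)" if "t \<in> S" "t' \<in> S" for t t'
    using that c assms by (simp add: V.M.a_ac)
  show ?thesis
  proof (rule subset_antisym; rule subsetI)
    fix z assume "z \<in> S +>\<^bsub>V\<^esub> (x \<oplus>\<^bsub>V\<^esub> y)"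
    then obtain t where t: "t \<in> S" "z = t \<oplus>\<^bsub>V\<^esub> (x \<oplus>\<^bsub>V\<^esub> y)" by (auto simp: coset_eq)
    then have "z = (t \<oplus>\<^bsub>V\<^esub> x) \<oplus>\<^bsub>V\<^esub> (\<zero>\<^bsub>V\<^esub> \<oplus>\<^bsub>V\<^esub> y)" using eq[of t "\<zero>\<^bsub>V\<^esub>"] c by simp
    then show "z \<in> set_add V (S +>\<^bsub>V\<^esub> x) (S +>\<^bsub>V\<^esub> y)"
      unfolding set_add_def' coset_eq using t S.zero_closed by blast
  next
    fix z assume "z \<in> set_add V (S +>\<^bsub>V\<^esub> x) (S +>\<^bsub>V\<^esub> y)"
    then obtain t t' where "t \<in> S" "t' \<in> S" "z = (t \<oplus>\<^bsub>V\<^esub> x) \<oplus>\<^bsub>V\<^esub> (t' \<oplus>\<^bsub>V\<^esub> y)"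
      unfolding set_add_def' coset_eq by blast
    then show "z \<in> S +>\<^bsub>V\<^esub> (x \<oplus>\<^bsub>V\<^esub> y)"
      unfolding coset_eq using eq S.m_closed by blast
  qed
qed

text \<open>Scalar multiplication and induced maps on quotients add \<open>S\<close> to the image of
  a whole coset. Any nonempty part of a single coset recovers that coset in this way; this includes
  multiplication by 0, where the image of the coset is one point.\<close>

lemma set_add_coset:
  assumes "X \<subseteq> S +>\<^bsub>V\<^esub> x" "X \<noteq> {}" "x \<in> carrier V"
  shows "set_add V S X = S +>\<^bsub>V\<^esub> x"
proof -
  have c: "t \<in> carrier V" if "t \<in> S" for t using that S.subset by auto
  obtain t0 where t0: "t0 \<in> S" "t0 \<oplus>\<^bsub>V\<^esub> x \<in> X" using assms by (auto simp: coset_eq)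
  have "t \<oplus>\<^bsub>V\<^esub> x \<in> set_add V S X" if "t \<in> S" for t
  proof -
    have "t \<oplus>\<^bsub>V\<^esub> x = (t \<oplus>\<^bsub>V\<^esub> \<ominus>\<^bsub>V\<^esub> t0) \<oplus>\<^bsub>V\<^esub> (t0 \<oplus>\<^bsub>V\<^esub> x)"
      using that c t0 assms by (simp add: V.M.a_assoc V.M.r_neg1)
    then show ?thesis
      unfolding set_add_def' using that t0 subspace_neg_closed[OF t0(1)] S.m_closed by blast
  qed
  moreover have "z \<in> S +>\<^bsub>V\<^esub> x" if "z \<in> set_add V S X" for z
  proof -
    obtain t t' where t: "t \<in> S" "t' \<in> S" "z = t \<oplus>\<^bsub>V\<^esub> (t' \<oplus>\<^bsub>V\<^esub> x)"
      using \<open>z \<in> set_add V S X\<close> assms(1) unfolding set_add_def' coset_eq by blast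
    then have "z = (t \<oplus>\<^bsub>V\<^esub> t') \<oplus>\<^bsub>V\<^esub> x" using c assms by (simp add: V.M.a_assoc)
    then show ?thesis unfolding coset_eq using t S.m_closed by blast
  qed
  ultimately show ?thesis unfolding coset_eq by blast
qed

lemma coset_smult:
  assumes "x \<in> carrier V"
  shows "S +>\<^bsub>V\<^esub> (c \<odot>\<^bsub>V\<^esub> x) = set_add V S ((\<lambda>y. c \<odot>\<^bsub>V\<^esub> y) ` (S +>\<^bsub>V\<^esub> x))"
proof (rule set_add_coset[symmetric])
  have cc: "t \<in> carrier V" if "t \<in> S" for t using that S.subset by auto
  show "(\<lambda>y. c \<odot>\<^bsub>V\<^esub> y) ` (S +>\<^bsub>V\<^esub> x) \<subseteq> S +>\<^bsub>V\<^esub> (c \<odot>\<^bsub>V\<^esub> x)"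
    using V.smult_r_distr[of c] assms cc S.smult_closed by (auto simp: coset_eq)
  show "(\<lambda>y. c \<odot>\<^bsub>V\<^esub> y) ` (S +>\<^bsub>V\<^esub> x) \<noteq> {}" using S.zero_closed unfolding coset_eq by blast
qed (use assms V.smult_closed in auto)

lemma carrier_quot: "carrier (quot V S) = (\<lambda>x. S +>\<^bsub>V\<^esub> x) ` carrier V"
  by (auto simp: quot_def A_RCOSETS_def')

lemma vectorspace_quot: "vectorspace class_ring (quot V S)"
proof (rule vectorspace_surj_image[OF V.vectorspace_axioms])
  show "(\<lambda>x. S +>\<^bsub>V\<^esub> x) ` carrier V = carrier (quot V S)" by (simp add: carrier_quot)
qed (simp_all add: quot_def coset_add coset_smult coset_eq_self_iff S.zero_closed)

end

text \<open>\<open>f\<close> induces an isomorphism of \<open>Z / (Z \<inter> B)\<close> with \<open>X\<close>; nothing is assumed of \<open>B\<close> outside \<open>Z\<close>.\<close>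

definition presents ::
    "('k::field \<Rightarrow> 'v::ab_group_add \<Rightarrow> 'v) \<Rightarrow> 'v set \<Rightarrow> 'v set \<Rightarrow> ('k, 'x) module \<Rightarrow> ('v \<Rightarrow> 'x) \<Rightarrow> bool"
  where
  "presents s Z B X f \<longleftrightarrow>
     vector_space s \<and> Modules.module.subspace s Z \<and> vectorspace class_ring X \<and>
     f ` Z = carrier X \<and>
     (\<forall>u\<in>Z. \<forall>v\<in>Z. f (u + v) = f u \<oplus>\<^bsub>X\<^esub> f v) \<and>
     (\<forall>c. \<forall>u\<in>Z. f (s c u) = c \<odot>\<^bsub>X\<^esub> f u) \<and>
     (\<forall>u\<in>Z. f u = \<zero>\<^bsub>X\<^esub> \<longleftrightarrow> u \<in> B)"

lemma
  assumes "presents s Z B X f"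
  shows presents_vector_space: "vector_space s"
    and presents_subspace: "Modules.module.subspace s Z"
    and presents_vectorspace: "vectorspace class_ring X"
    and presents_image: "f ` Z = carrier X"
    and presents_add: "\<And>u v. u \<in> Z \<Longrightarrow> v \<in> Z \<Longrightarrow> f (u + v) = f u \<oplus>\<^bsub>X\<^esub> f v"
    and presents_scale: "\<And>c u. u \<in> Z \<Longrightarrow> f (s c u) = c \<odot>\<^bsub>X\<^esub> f u"
    and presents_zero_iff: "\<And>u. u \<in> Z \<Longrightarrow> f u = \<zero>\<^bsub>X\<^esub> \<longleftrightarrow> u \<in> B"
    and presents_in: "\<And>u. u \<in> Z \<Longrightarrow> f u \<in> carrier X"
  using assms by (auto simp: presents_def)

lemma presents_diff:
  assumes "presents s Z B X f" "u \<in> Z" "v \<in> Z"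
  shows "f (u - v) = f u \<ominus>\<^bsub>X\<^esub> f v"
proof -
  note P = assms(1)
  interpret vector_space s using P by (rule presents_vector_space)
  interpret X: vectorspace class_ring X using P by (rule presents_vectorspace)
  have d: "u - v \<in> Z" by (rule subspace_diff[OF presents_subspace[OF P] assms(2,3)])
  have "f u = f (u - v) \<oplus>\<^bsub>X\<^esub> f v" using presents_add[OF P d assms(3)] by simp
  then show ?thesis using presents_in[OF P] d assms
    by (simp add: a_minus_def X.M.a_assoc X.M.r_neg)
qed

lemma presents_eq_iff:
  assumes "presents s Z B X f" "u \<in> Z" "v \<in> Z"
  shows "f u = f v \<longleftrightarrow> u - v \<in> B"
proof -
  note P = assms(1)
  interpret vector_space s using P by (rule presents_vector_space)
  interpret X: vectorspace class_ring X using P by (rule presents_vectorspace)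
  have d: "u - v \<in> Z" by (rule subspace_diff[OF presents_subspace[OF P] assms(2,3)])
  show ?thesis using presents_zero_iff[OF P d] presents_diff[OF assms] presents_in[OF P] assms
    by simp
qed

text \<open>\<open>B\<close> may be any set, but its part inside \<open>Z\<close> is the kernel of
  \<open>f\<close>.\<close>

lemma presents_kernel_subspace:
  assumes P: "presents s Z B X f"
  shows "Modules.module.subspace s {z \<in> Z. z \<in> B}"
proof -
  interpret vector_space s using P by (rule presents_vector_space)
  interpret X: vectorspace class_ring X using P by (rule presents_vectorspace)
  have eq: "{z \<in> Z. z \<in> B} = {z \<in> Z. f z = \<zero>\<^bsub>X\<^esub>}" using presents_zero_iff[OF P] by auto
  have sub: "subspace Z" using P by (rule presents_subspace)
  have "f 0 = \<zero>\<^bsub>X\<^esub>"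
    using presents_diff[OF P subspace_0[OF sub] subspace_0[OF sub]] presents_in[OF P subspace_0[OF sub]]
    by (simp add: a_minus_def X.M.r_neg)
  then show ?thesis unfolding eq
    using subspace_0[OF sub] subspace_add[OF sub] subspace_scale[OF sub]
      presents_add[OF P] presents_scale[OF P] X.M.zero_closed X.rmult_0
    by (intro subspaceI) simp_all
qed

lemma presents_subspace_image:
  assumes P: "presents s Z B X f" and Z': "Modules.module.subspace s Z'" "Z' \<subseteq> Z"
  shows "VectorSpace.subspace class_ring (f ` Z') X"
proof -
  interpret vector_space s using P by (rule presents_vector_space)
  interpret X: vectorspace class_ring X using P by (rule presents_vectorspace)
  have "0 \<in> Z'" using Z' subspace_0 by auto
  moreover have "f (0 - 0) = \<zero>\<^bsub>X\<^esub>"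
    using presents_diff[OF P, of 0 0] presents_in[OF P, of 0] \<open>0 \<in> Z'\<close> Z'(2)
    by (simp add: a_minus_def X.M.r_neg subset_iff)
  ultimately have z: "\<zero>\<^bsub>X\<^esub> \<in> f ` Z'" by (metis diff_zero imageI)
  have "submodule class_ring (f ` Z') X"
  proof
    show "f ` Z' \<subseteq> carrier X" using presents_in[OF P] Z' by auto
    show "v \<oplus>\<^bsub>X\<^esub> w \<in> f ` Z'" if vw: "v \<in> f ` Z'" "w \<in> f ` Z'" for v w
    proof -
      obtain a b where ab: "a \<in> Z'" "b \<in> Z'" "v = f a" "w = f b" using vw by auto
      then have "v \<oplus>\<^bsub>X\<^esub> w = f (a + b)" using presents_add[OF P, of a b] subsetD[OF Z'(2)] by simp
      then show ?thesis using ab subspace_add[OF Z'(1)] by blast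
    qed
    show "c \<odot>\<^bsub>X\<^esub> v \<in> f ` Z'" if v: "v \<in> f ` Z'" for c v
    proof -
      obtain a where a: "a \<in> Z'" "v = f a" using v by auto
      then have "c \<odot>\<^bsub>X\<^esub> v = f (s c a)" using presents_scale[OF P, of a c] subsetD[OF Z'(2)] by simp
      then show ?thesis using a subspace_scale[OF Z'(1)] by blast
    qed
  qed (rule z)
  then show ?thesis using X.vectorspace_axioms by (simp add: VectorSpace.subspace_def)
qed

lemma subspace_restrict:
  assumes "VectorSpace.subspace class_ring S X" "VectorSpace.subspace class_ring K X" "S \<subseteq> K"
  shows "VectorSpace.subspace class_ring S (X\<lparr>carrier := K\<rparr>)"
proof -
  interpret S: submodule class_ring S X using assms(1) by (simp add: VectorSpace.subspace_def)
  interpret X: vectorspace class_ring X using assms(1) by (simp add: VectorSpace.subspace_def)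
  have "vectorspace class_ring (X\<lparr>carrier := K\<rparr>)" by (rule X.subspace_is_vs[OF assms(2)])
  moreover from this interpret K: vectorspace class_ring "X\<lparr>carrier := K\<rparr>" .
  have "submodule class_ring S (X\<lparr>carrier := K\<rparr>)"
    using assms(3) S.zero_closed S.smult_closed S.m_closed by unfold_locales auto
  ultimately show ?thesis by (simp add: VectorSpace.subspace_def)
qed

text \<open>In the language of presentations this is the third isomorphism theorem: a subquotient of
  a presented space is presented by the same vectors. Kernels modulo images and graded pieces are
  thus handled without unfolding nested cosets.\<close>

lemma presents_subquotient:
  assumes P: "presents s Z B X f"
    and Z': "Modules.module.subspace s Z'" "Z' \<subseteq> Z"
    and S: "VectorSpace.subspace class_ring S X" "S \<subseteq> f ` Z'"
  shows "presents s Z' {z \<in> Z'. f z \<in> S} (quot (X\<lparr>carrier := f ` Z'\<rparr>) S) (\<lambda>z. S +>\<^bsub>X\<^esub> f z)"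
proof -
  interpret vector_space s using P by (rule presents_vector_space)
  interpret X: vectorspace class_ring X using P by (rule presents_vectorspace)
  let ?Y = "X\<lparr>carrier := f ` Z'\<rparr>"
  have K: "VectorSpace.subspace class_ring (f ` Z') X"
    by (rule presents_subspace_image[OF P Z'])
  have S': "VectorSpace.subspace class_ring S ?Y"
    by (rule subspace_restrict[OF S(1) K S(2)])
  have c: "S +>\<^bsub>?Y\<^esub> y = S +>\<^bsub>X\<^esub> y" for y by (simp add: a_r_coset_def')
  show ?thesis
    unfolding presents_def
  proof (intro conjI ballI allI)
    show "(\<lambda>z. S +>\<^bsub>X\<^esub> f z) ` Z' = carrier (quot ?Y S)"
      unfolding carrier_quot[OF S'] c by auto
    show "S +>\<^bsub>X\<^esub> f (u + v) = (S +>\<^bsub>X\<^esub> f u) \<oplus>\<^bsub>quot ?Y S\<^esub> (S +>\<^bsub>X\<^esub> f v)" if "u \<in> Z'" "v \<in> Z'" for u v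
      using coset_add[OF S', of "f u" "f v"] presents_add[OF P, of u v] that subsetD[OF Z'(2)]
      by (simp add: c quot_def)
    show "S +>\<^bsub>X\<^esub> f (s k u) = k \<odot>\<^bsub>quot ?Y S\<^esub> (S +>\<^bsub>X\<^esub> f u)" if "u \<in> Z'" for u k
      using coset_smult[OF S', of "f u" k] presents_scale[OF P, of u k] that subsetD[OF Z'(2)]
      by (simp add: c quot_def)
    show "(S +>\<^bsub>X\<^esub> f u = \<zero>\<^bsub>quot ?Y S\<^esub>) = (u \<in> {z \<in> Z'. f z \<in> S})" if "u \<in> Z'" for u
      using coset_eq_self_iff[OF S', of "f u"] that by (simp add: c quot_def)
  qed (use vectorspace_quot[OF S'] Z' vector_space_axioms in auto)
qed

lemma presents_space_on:
  assumes "vector_space s" "Modules.module.subspace s Z"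
  shows "presents s Z {0} (space_on s Z) (\<lambda>z. z)"
  using assms vectorspace_space_on[OF assms] by (auto simp: presents_def space_on_def)

lemma presents_quot:
  assumes "vector_space s" "Modules.module.subspace s Z" "Modules.module.subspace s B" "B \<subseteq> Z"
  shows "presents s Z B (quot (space_on s Z) B) (\<lambda>z. B +>\<^bsub>space_on s Z\<^esub> z)"
proof -
  note P = presents_space_on[OF assms(1,2)]
  have "VectorSpace.subspace class_ring B (space_on s Z)"
    using presents_subspace_image[OF P assms(3,4)] by simp
  from presents_subquotient[OF P assms(2) order.refl this] assms(4)
  have "presents s Z {z \<in> Z. z \<in> B} (quot (space_on s Z\<lparr>carrier := Z\<rparr>) B) (\<lambda>z. B +>\<^bsub>space_on s Z\<^esub> z)"
    by simp
  then show ?thesis by (simp add: presents_def space_on_def conj_commute cong: conj_cong)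
qed

lemma presents_cong:
  assumes "presents s Z B X f" "\<And>z. z \<in> Z \<Longrightarrow> z \<in> B \<longleftrightarrow> z \<in> B'" "\<And>z. z \<in> Z \<Longrightarrow> f z = f' z"
  shows "presents s Z B' X f'"
proof -
  interpret vector_space s using assms(1) by (rule presents_vector_space)
  have "subspace Z" using assms(1) by (rule presents_subspace)
  then show ?thesis using assms by (auto simp: presents_def subspace_def cong: image_cong_simp)
qed

text \<open>Representatives are replaced by their preimages under a linear surjection. This serves
  to read the elements of \<open>CR\<close> as ordinary cochains with one more argument.\<close>

lemma presents_pullback:
  assumes P: "presents s Z B X f" and s': "vector_space s'"
    and Z': "Modules.module.subspace s' Z'" and im: "h ` Z' = Z"
    and add: "\<And>u v. u \<in> Z' \<Longrightarrow> v \<in> Z' \<Longrightarrow> h (u + v) = h u + h v"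
    and scale: "\<And>c u. u \<in> Z' \<Longrightarrow> h (s' c u) = s c (h u)"
    and B: "\<And>u. u \<in> Z' \<Longrightarrow> h u \<in> B \<longleftrightarrow> u \<in> B'"
  shows "presents s' Z' B' X (\<lambda>z. f (h z))"
proof -
  have h: "h u \<in> Z" if "u \<in> Z'" for u using that im by auto
  show ?thesis
    unfolding presents_def
  proof (intro conjI ballI allI)
    show "(\<lambda>z. f (h z)) ` Z' = carrier X" using presents_image[OF P] im by auto
  qed (use s' Z' h B presents_vectorspace[OF P] presents_add[OF P] presents_scale[OF P]
        presents_zero_iff[OF P] add scale in auto)
qed

text \<open>An isomorphism is checked on representatives: \<open>h\<close> has to reflect the two
  kernels and to meet every class of \<open>Y\<close>. It is asked to be linear on \<open>Z\<close>
  only, and it may miss elements of \<open>Z'\<close> as long as it reaches them modulo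
  \<open>B'\<close>.\<close>

lemma iso_vs_presents:
  assumes P: "presents s Z B X f" and P': "presents s' Z' B' Y g"
    and h: "\<And>z. z \<in> Z \<Longrightarrow> h z \<in> Z'"
    and add: "\<And>u v. u \<in> Z \<Longrightarrow> v \<in> Z \<Longrightarrow> h (u + v) = h u + h v"
    and scale: "\<And>c u. u \<in> Z \<Longrightarrow> h (s c u) = s' c (h u)"
    and inj: "\<And>z. z \<in> Z \<Longrightarrow> h z \<in> B' \<longleftrightarrow> z \<in> B"
    and surj: "\<And>z'. z' \<in> Z' \<Longrightarrow> \<exists>z\<in>Z. z' - h z \<in> B'"
  shows "iso_vs X Y"
proof -
  interpret S: vector_space s using P by (rule presents_vector_space)
  interpret X: vectorspace class_ring X using P by (rule presents_vectorspace)
  interpret Y: vectorspace class_ring Y using P' by (rule presents_vectorspace)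
  have sub: "S.subspace Z" using P by (rule presents_subspace)
  \<comment> \<open>A choice of representatives that need not be linear; by \<open>inj\<close> the
    class of \<open>h (r x)\<close> does not depend on it.\<close>
  define r where "r x = (SOME z. z \<in> Z \<and> f z = x)" for x
  have r: "r x \<in> Z \<and> f (r x) = x" if "x \<in> carrier X" for x
  proof -
    have "x \<in> f ` Z" using that by (simp add: presents_image[OF P])
    then have "\<exists>z. z \<in> Z \<and> f z = x" by (elim imageE) blast
    then show ?thesis unfolding r_def by (rule someI_ex)
  qed
  define \<phi> where "\<phi> x = g (h (r x))" for x
  have hd: "h (u - v) = h u - h v" if "u \<in> Z" "v \<in> Z" for u v
    using add[OF S.subspace_diff[OF sub that] that(2)] by (simp add: eq_diff_eq)
  have \<phi>: "\<phi> (f z) = g (h z)" if z: "z \<in> Z" for z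
  proof -
    have "r (f z) \<in> Z" "f (r (f z)) = f z" using r[OF presents_in[OF P z]] by simp_all
    then have "r (f z) - z \<in> B" using presents_eq_iff[OF P _ z] by blast
    then have "h (r (f z)) - h z \<in> B'"
      using inj[OF S.subspace_diff[OF sub \<open>r (f z) \<in> Z\<close> z]] hd[OF \<open>r (f z) \<in> Z\<close> z] by simp
    then show ?thesis
      unfolding \<phi>_def using presents_eq_iff[OF P' h[OF \<open>r (f z) \<in> Z\<close>] h[OF z]] by blast
  qed
  have X: "\<exists>z\<in>Z. x = f z" if "x \<in> carrier X" for x using r[OF that] by metis
  have \<phi>add: "\<phi> (x \<oplus>\<^bsub>X\<^esub> y) = \<phi> x \<oplus>\<^bsub>Y\<^esub> \<phi> y" if xy: "x \<in> carrier X" "y \<in> carrier X" for x y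
  proof -
    obtain u v where uv: "u \<in> Z" "v \<in> Z" "x = f u" "y = f v" using X xy by blast
    then have "x \<oplus>\<^bsub>X\<^esub> y = f (u + v)" using presents_add[OF P] by simp
    then show ?thesis
      using \<phi>[OF S.subspace_add[OF sub uv(1,2)]] uv add presents_add[OF P' h[OF uv(1)] h[OF uv(2)]] \<phi>
      by simp
  qed
  have \<phi>in: "\<phi> x \<in> carrier Y" if "x \<in> carrier X" for x
    using presents_in[OF P' h] r[OF that] by (simp add: \<phi>_def)
  have "linear_map class_ring X Y \<phi>"
  proof (rule linear_mapI)
    show "\<phi> (c \<odot>\<^bsub>X\<^esub> x) = c \<odot>\<^bsub>Y\<^esub> \<phi> x" if x: "x \<in> carrier X" for c x
    proof -
      obtain u where u: "u \<in> Z" "x = f u" using X x by blast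
      then have "c \<odot>\<^bsub>X\<^esub> x = f (s c u)" using presents_scale[OF P] by simp
      then show ?thesis
        using \<phi>[OF S.subspace_scale[OF sub u(1)]] u scale presents_scale[OF P' h[OF u(1)]] \<phi> by simp
    qed
  qed (use \<phi>add \<phi>in X.vectorspace_axioms Y.vectorspace_axioms in simp_all)
  moreover have "bij_betw \<phi> (carrier X) (carrier Y)"
    unfolding bij_betw_def
  proof
    show "inj_on \<phi> (carrier X)"
    proof (rule inj_onI)
      fix x y assume xy: "x \<in> carrier X" "y \<in> carrier X" "\<phi> x = \<phi> y"
      obtain u v where uv: "u \<in> Z" "v \<in> Z" "x = f u" "y = f v" using X xy by blast
      then have "h u - h v \<in> B'"
        using xy(3) \<phi>[OF uv(1)] \<phi>[OF uv(2)] presents_eq_iff[OF P' h[OF uv(1)] h[OF uv(2)]] by simp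
      then have "u - v \<in> B"
        using inj[OF S.subspace_diff[OF sub uv(1,2)]] hd[OF uv(1,2)] by simp
      then show "x = y" using uv presents_eq_iff[OF P uv(1,2)] by simp
    qed
    have "\<exists>x\<in>carrier X. y = \<phi> x" if y: "y \<in> carrier Y" for y
    proof -
      obtain z' where z': "z' \<in> Z'" "y = g z'"
        using y unfolding presents_image[OF P', symmetric] by (elim imageE)
      obtain z where z: "z \<in> Z" "z' - h z \<in> B'" using surj z' by blast
      then have "y = \<phi> (f z)"
        using presents_eq_iff[OF P' z'(1) h[OF z(1)]] z' \<phi>[OF z(1)] by simp
      then show ?thesis using presents_in[OF P z(1)] by blast
    qed
    then show "\<phi> ` carrier X = carrier Y" using \<phi>in by blast
  qed
  ultimately show ?thesis unfolding iso_vs_def by blast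
qed

lemma iso_vs_sym:
  assumes "iso_vs V W" shows "iso_vs W V"
proof -
  obtain f where f: "linear_map class_ring V W f" "bij_betw f (carrier V) (carrier W)"
    using assms unfolding iso_vs_def by blast
  interpret f: linear_map class_ring V W f by fact
  define g where "g = the_inv_into (carrier V) f"
  have inj: "inj_on f (carrier V)" and im: "f ` carrier V = carrier W"
    using f(2) by (auto simp: bij_betw_def)
  have g: "g (f x) = x" if "x \<in> carrier V" for x
    unfolding g_def using inj that by (rule the_inv_into_f_f)
  have g': "g y \<in> carrier V" "f (g y) = y" if "y \<in> carrier W" for y
  proof -
    obtain x where "x \<in> carrier V" "y = f x"
      using \<open>y \<in> carrier W\<close> unfolding im[symmetric] by (elim imageE)
    then show "g y \<in> carrier V" "f (g y) = y" using g by simp_all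
  qed
  have "linear_map class_ring W V g"
  proof (rule linear_mapI)
    show "g (x \<oplus>\<^bsub>W\<^esub> y) = g x \<oplus>\<^bsub>V\<^esub> g y" if xy: "x \<in> carrier W" "y \<in> carrier W" for x y
    proof -
      have "f (g x \<oplus>\<^bsub>V\<^esub> g y) = x \<oplus>\<^bsub>W\<^esub> y"
        using f.f_add[OF g'(1)[OF xy(1)] g'(1)[OF xy(2)]] g'(2) xy by metis
      then show ?thesis
        using g[OF f.V.module.M.a_closed[OF g'(1)[OF xy(1)] g'(1)[OF xy(2)]]] by metis
    qed
    show "g (c \<odot>\<^bsub>W\<^esub> x) = c \<odot>\<^bsub>V\<^esub> g x" if x: "x \<in> carrier W" for c x
    proof -
      have c: "c \<in> carrier class_ring" by simp
      have "f (c \<odot>\<^bsub>V\<^esub> g x) = c \<odot>\<^bsub>W\<^esub> x"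
        using f.f_smult[OF c g'(1)[OF x]] g'(2)[OF x] by metis
      then show ?thesis using g[OF f.V.module.smult_closed[OF c g'(1)[OF x]]] by metis
    qed
  qed (rule f.V.vectorspace_axioms f.W.vectorspace_axioms g'(1) | assumption)+
  moreover have "bij_betw g (carrier W) (carrier V)"
    unfolding g_def using f(2) by (rule bij_betw_the_inv_into)
  ultimately show ?thesis unfolding iso_vs_def by blast
qed

lemma iso_vs_trans:
  assumes "iso_vs U V" "iso_vs V W" shows "iso_vs U W"
proof -
  obtain f where f: "linear_map class_ring U V f" "bij_betw f (carrier U) (carrier V)"
    using assms unfolding iso_vs_def by blast
  obtain g where g: "linear_map class_ring V W g" "bij_betw g (carrier V) (carrier W)"
    using assms unfolding iso_vs_def by blast
  interpret f: linear_map class_ring U V f by fact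
  interpret g: linear_map class_ring V W g by fact
  have "linear_map class_ring U W (g \<circ> f)"
  proof (rule linear_mapI)
    show "(g \<circ> f) (c \<odot>\<^bsub>U\<^esub> x) = c \<odot>\<^bsub>W\<^esub> (g \<circ> f) x" if "x \<in> carrier U" for c x
      using that f.f_smult[of c x] g.f_smult[of c "f x"] by simp
  qed (use f.V.vectorspace_axioms g.W.vectorspace_axioms in simp_all)
  then show ?thesis unfolding iso_vs_def using bij_betw_trans[OF f(2) g(2)] by blast
qed

lemma quot_map_coset:
  fixes W :: "('k::field, 'w) module"
  assumes T: "VectorSpace.subspace class_ring T W" and f: "f u \<in> carrier W"
    and X: "u \<in> X" "\<And>x. x \<in> X \<Longrightarrow> f x \<in> T +>\<^bsub>W\<^esub> f u"
  shows "quot_map W T f X = T +>\<^bsub>W\<^esub> f u"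
proof -
  have "f ` X \<subseteq> T +>\<^bsub>W\<^esub> f u" "f ` X \<noteq> {}" using X by blast+
  then show ?thesis unfolding quot_map_def using f by (intro set_add_coset[OF T])
qed

section \<open>The spectral sequence of a filtered complex\<close>

text \<open>
  The filtration \<open>F p n\<close> descends from \<open>C n\<close> to a subcomplex \<open>K n\<close>, so that it induces a bounded
  filtration of \<open>C / K\<close>. As every \<open>F p n\<close> contains \<open>K n\<close>, the pages of the spectral sequence of
  \<open>C / K\<close> are subquotients of \<open>C\<close>.
\<close>

locale filtered_complex = vector_space s for s :: "'k::field \<Rightarrow> 'v::ab_group_add \<Rightarrow> 'v" +
  fixes D :: "'v \<Rightarrow> 'v" and F :: "int \<Rightarrow> int \<Rightarrow> 'v set" and C K :: "int \<Rightarrow> 'v set"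
  assumes D_linear: "Vector_Spaces.linear s s D"
    and F_subspace: "subspace (F p n)"
    and D_F: "x \<in> F p n \<Longrightarrow> D x \<in> F p (n + 1)"
    and DD: "x \<in> F p n \<Longrightarrow> D (D x) = 0"
    and F_Suc: "F (p + 1) n \<subseteq> F p n"
    and F_low: "p \<le> 0 \<Longrightarrow> F p n = C n"
    and F_high: "n < p \<Longrightarrow> F p n = K n"
begin

sublocale D: Vector_Spaces.linear s s D by (rule D_linear)

lemma F_antimono:
  assumes "p \<le> q" shows "F q n \<subseteq> F p n"
  using assms
proof (induction rule: int_ge_induct)
  case (step i)
  then show ?case using F_Suc[of i n] by blast
qed simp

lemma F_antimonoD: "x \<in> F q n \<Longrightarrow> p \<le> q \<Longrightarrow> x \<in> F p n"
  using F_antimono by blast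

lemma F_K: "K n \<subseteq> F p n"
  using F_antimono[of p "max p (n + 1)" n] F_high[of n "max p (n + 1)"] by simp

lemma F_C: "F p n \<subseteq> C n"
  using F_antimono[of "min p 0" p n] F_low[of "min p 0" n] by simp

definition cycles :: "int \<Rightarrow> int \<Rightarrow> int \<Rightarrow> 'v set" where
  "cycles r p n = {a \<in> F p n. D a \<in> F (p + r) (n + 1)}"

text \<open>The first summand makes the page a subquotient of the graded piece. The second one
  consists of the boundaries of filtration \<open>p\<close> that come from filtration
  \<open>p - r + 1\<close>, the source of the differential of the preceding page into this position;
  the images of all earlier differentials are among them.\<close>

definition boundaries :: "int \<Rightarrow> int \<Rightarrow> int \<Rightarrow> 'v set" where
  "boundaries r p n =
     {u + D v | u v. u \<in> cycles (r - 1) (p + 1) n \<and> v \<in> cycles (r - 1) (p - r + 1) (n - 1)}"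

definition page :: "nat \<Rightarrow> int \<Rightarrow> int \<Rightarrow> ('k, 'v set) module" where
  "page r p q =
     quot (space_on s (cycles (int r) p (p + q))) (boundaries (int r) p (p + q))"

definition page_d :: "nat \<Rightarrow> int \<Rightarrow> int \<Rightarrow> 'v set \<Rightarrow> 'v set" where
  "page_d r p q =
     quot_map (space_on s (cycles (int r) (p + int r) (p + q + 1)))
       (boundaries (int r) (p + int r) (p + q + 1)) D"

lemma subspace_cycles: "subspace (cycles r p n)"
  using F_subspace[of p n] F_subspace[of "p + r" "n + 1"]
  by (auto simp: subspace_def cycles_def D.add D.scale D.zero)

lemma subspace_D_image: "subspace A \<Longrightarrow> subspace (D ` A)"
  by (rule D.subspace_image)

lemma subspace_boundaries: "subspace (boundaries r p n)"
proof -
  have "boundaries r p n =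
      {x + y | x y. x \<in> cycles (r - 1) (p + 1) n \<and> y \<in> D ` cycles (r - 1) (p - r + 1) (n - 1)}"
    by (auto simp: boundaries_def)
  then show ?thesis using subspace_sums[OF subspace_cycles subspace_D_image[OF subspace_cycles]]
    by simp
qed

lemma boundaries_cycles:
  assumes "1 \<le> r" shows "boundaries r p n \<subseteq> cycles r p n"
proof
  fix x assume "x \<in> boundaries r p n"
  then obtain u v where uv: "x = u + D v" "u \<in> cycles (r - 1) (p + 1) n"
    "v \<in> cycles (r - 1) (p - r + 1) (n - 1)" by (auto simp: boundaries_def)
  have "u \<in> cycles r p n" using uv(2) F_antimonoD[of u "p + 1" n p] by (simp add: cycles_def)
  moreover have "D v \<in> cycles r p n"
    using uv(3) DD[of v "p - r + 1" "n - 1"] subspace_0[OF F_subspace] by (simp add: cycles_def)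
  ultimately show "x \<in> cycles r p n"
    unfolding uv(1) by (rule subspace_add[OF subspace_cycles])
qed

lemma boundariesI:
  "u \<in> cycles (r - 1) (p + 1) n \<Longrightarrow> v \<in> cycles (r - 1) (p - r + 1) (n - 1) \<Longrightarrow> x = u + D v \<Longrightarrow>
     x \<in> boundaries r p n"
  unfolding boundaries_def by blast

text \<open>\<open>D\<close> kills the summand \<open>D v\<close> and turns \<open>u\<close> into a
  boundary of the second kind, with first summand 0.\<close>

lemma D_boundaries:
  assumes "x \<in> boundaries r p n" "1 \<le> r"
  shows "D x \<in> boundaries r (p + r) (n + 1)"
proof -
  obtain u v where uv: "x = u + D v" "u \<in> cycles (r - 1) (p + 1) n"
    "v \<in> cycles (r - 1) (p - r + 1) (n - 1)" using assms by (auto simp: boundaries_def)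
  have "D x = 0 + D u" using uv DD[of v "p - r + 1" "n - 1"] by (simp add: D.add cycles_def)
  then show ?thesis
    using uv(2) subspace_0[OF subspace_cycles, of "r - 1" "p + r + 1" "n + 1"]
    by (intro boundariesI[of 0 _ _ _ u]) simp_all
qed

lemma D_cycles: "z \<in> cycles r p n \<Longrightarrow> D z \<in> cycles r (p + r) (n + 1)"
  using DD[of z p n] subspace_0[OF F_subspace] by (simp add: cycles_def)

abbreviation page_coset :: "nat \<Rightarrow> int \<Rightarrow> int \<Rightarrow> 'v \<Rightarrow> 'v set" where
  "page_coset r p n z \<equiv> boundaries (int r) p n +>\<^bsub>space_on s (cycles (int r) p n)\<^esub> z"

lemma presents_page:
  assumes "1 \<le> r"
  shows "presents s (cycles (int r) p (p + q)) (boundaries (int r) p (p + q)) (page r p q)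
           (page_coset r p (p + q))"
  unfolding page_def using assms
  by (intro presents_quot vector_space_axioms subspace_cycles subspace_boundaries boundaries_cycles)
    simp

lemma page_d_coset:
  assumes r: "1 \<le> r" and z: "z \<in> cycles (int r) p (p + q)"
  shows "page_d r p q (page_coset r p (p + q) z) = page_coset r (p + int r) (p + q + 1) (D z)"
  unfolding page_d_def
proof (rule quot_map_coset)
  let ?W = "space_on s (cycles (int r) (p + int r) (p + q + 1))"
  have "presents s (cycles (int r) (p + int r) (p + q + 1)) {0} ?W (\<lambda>z. z)"
    by (rule presents_space_on[OF vector_space_axioms subspace_cycles])
  from presents_subspace_image[OF this subspace_boundaries boundaries_cycles] r
  show "VectorSpace.subspace class_ring (boundaries (int r) (p + int r) (p + q + 1)) ?W"
    by simp
  show "D z \<in> carrier ?W" using D_cycles[OF z] by (simp add: space_on_def algebra_simps)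
  show "z \<in> page_coset r p (p + q) z"
    using subspace_0[OF subspace_boundaries, of "int r" p "p + q"]
    by (force simp: a_r_coset_def' space_on_def)
  show "D x \<in> page_coset r (p + int r) (p + q + 1) (D z)" if x: "x \<in> page_coset r p (p + q) z" for x
  proof -
    obtain b where b: "b \<in> boundaries (int r) p (p + q)" "x = b + z"
      using x by (auto simp: a_r_coset_def' space_on_def)
    then have "D b \<in> boundaries (int r) (p + int r) (p + q + 1)"
      using D_boundaries r by force
    then show ?thesis using b by (force simp: a_r_coset_def' space_on_def D.add)
  qed
qed

lemma carrier_pageE:
  assumes "x \<in> carrier (page r p q)" "1 \<le> r"
  obtains z where "z \<in> cycles (int r) p (p + q)" "x = page_coset r p (p + q) z"
  using presents_image[OF presents_page[OF assms(2), of p q]] assms(1) by blast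

lemma page_coset_in: "z \<in> cycles (int r) p (p + q) \<Longrightarrow> 1 \<le> r \<Longrightarrow> page_coset r p (p + q) z \<in> carrier (page r p q)"
  using presents_in[OF presents_page[of r p q]] by blast

lemma page_coset_zero_iff:
  assumes "z \<in> cycles (int r) p (p + q)" "1 \<le> r"
  shows "page_coset r p (p + q) z = \<zero>\<^bsub>page r p q\<^esub> \<longleftrightarrow> z \<in> boundaries (int r) p (p + q)"
  by (rule presents_zero_iff[OF presents_page[OF assms(2)] assms(1)])

lemma page_d_zero_iff:
  assumes "z \<in> cycles (int r) p (p + q)" "1 \<le> r"
  shows "page_d r p q (page_coset r p (p + q) z) = \<zero>\<^bsub>page r (p + int r) (q - int r + 1)\<^esub> \<longleftrightarrow>
           D z \<in> boundaries (int r) (p + int r) (p + q + 1)"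
proof -
  have eq: "p + int r + (q - int r + 1) = p + q + 1" by simp
  show ?thesis
    using page_coset_zero_iff[of "D z" r "p + int r" "q - int r + 1"] D_cycles[OF assms(1)] assms(2)
    unfolding page_d_coset[OF assms(2,1)] eq by simp
qed

lemma linear_map_page_d:
  assumes r: "1 \<le> r"
  shows "linear_map class_ring (page r p q) (page r (p + int r) (q - int r + 1)) (page_d r p q)"
proof -
  let ?E = "page r p q" and ?E' = "page r (p + int r) (q - int r + 1)"
  have eq: "p + int r + (q - int r + 1) = p + q + 1" by simp
  note P = presents_page[OF r, of p q]
  note P' = presents_page[OF r, of "p + int r" "q - int r + 1", unfolded eq]
  have Dz: "D z \<in> cycles (int r) (p + int r) (p + q + 1)" if "z \<in> cycles (int r) p (p + q)" for z
    using D_cycles[OF that] by simp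
  show ?thesis
  proof (rule linear_mapI)
    show "vectorspace class_ring ?E" "vectorspace class_ring ?E'"
      using P P' by (auto intro: presents_vectorspace)
    show "page_d r p q x \<in> carrier ?E'" if x: "x \<in> carrier ?E" for x
    proof -
      obtain z where z: "z \<in> cycles (int r) p (p + q)" "x = page_coset r p (p + q) z"
        using carrier_pageE[OF x r] .
      show ?thesis unfolding z(2) page_d_coset[OF r z(1)] by (rule presents_in[OF P' Dz[OF z(1)]])
    qed
    show "page_d r p q (x \<oplus>\<^bsub>?E\<^esub> y) = page_d r p q x \<oplus>\<^bsub>?E'\<^esub> page_d r p q y"
      if xy: "x \<in> carrier ?E" "y \<in> carrier ?E" for x y
    proof -
      obtain z where z: "z \<in> cycles (int r) p (p + q)" "x = page_coset r p (p + q) z"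
        using carrier_pageE[OF xy(1) r] .
      obtain w where w: "w \<in> cycles (int r) p (p + q)" "y = page_coset r p (p + q) w"
        using carrier_pageE[OF xy(2) r] .
      show ?thesis
        unfolding z(2) w(2) presents_add[OF P z(1) w(1), symmetric] page_d_coset[OF r z(1)]
          page_d_coset[OF r w(1)] page_d_coset[OF r subspace_add[OF subspace_cycles z(1) w(1)]] D.add
        by (rule presents_add[OF P' Dz[OF z(1)] Dz[OF w(1)]])
    qed
    show "page_d r p q (c \<odot>\<^bsub>?E\<^esub> x) = c \<odot>\<^bsub>?E'\<^esub> page_d r p q x" if x: "x \<in> carrier ?E" for c x
    proof -
      obtain z where z: "z \<in> cycles (int r) p (p + q)" "x = page_coset r p (p + q) z"
        using carrier_pageE[OF x r] .
      show ?thesis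
        unfolding z(2) presents_scale[OF P z(1), symmetric] page_d_coset[OF r z(1)]
          page_d_coset[OF r subspace_scale[OF subspace_cycles z(1)]] D.scale
        by (rule presents_scale[OF P' Dz[OF z(1)]])
    qed
  qed
qed

lemma page_d_squared:
  assumes x: "x \<in> carrier (page r p q)" and r: "1 \<le> r"
  shows "page_d r (p + int r) (q - int r + 1) (page_d r p q x) =
           \<zero>\<^bsub>page r (p + 2 * int r) (q - 2 * int r + 2)\<^esub>"
proof -
  obtain z where z: "z \<in> cycles (int r) p (p + q)" "x = page_coset r p (p + q) z"
    using carrier_pageE[OF x r] .
  have eq: "p + int r + (q - int r + 1) = p + q + 1"
    "p + int r + int r = p + 2 * int r" "q - int r + 1 - int r + 1 = q - 2 * int r + 2" by simp_all
  have Dz: "D z \<in> cycles (int r) (p + int r) (p + int r + (q - int r + 1))"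
    using D_cycles[OF z(1)] by (simp add: eq)
  have "D (D z) = 0" using z(1) DD by (auto simp: cycles_def)
  then have "D (D z) \<in> boundaries (int r) (p + int r + int r) (p + int r + (q - int r + 1) + 1)"
    using subspace_0[OF subspace_boundaries] by simp
  then have "page_d r (p + int r) (q - int r + 1)
        (page_coset r (p + int r) (p + int r + (q - int r + 1)) (D z)) =
      \<zero>\<^bsub>page r (p + int r + int r) (q - int r + 1 - int r + 1)\<^esub>"
    using page_d_zero_iff[OF Dz r] by blast
  then show ?thesis unfolding z(2) page_d_coset[OF r z(1)] eq .
qed

text \<open>Both sides are subquotients of \<open>C\<close>, and the identity on representatives
  induces the isomorphism. A class in the kernel of the page differential has a representative
  \<open>z'\<close> with \<open>D z' = u + D v\<close>, where \<open>u\<close> has filtration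
  \<open>p + r + 1\<close> and \<open>v\<close> has filtration \<open>p + 1\<close>. Passing to
  \<open>z' - v\<close> does not change the class and gives a cycle for the next page.\<close>

lemma iso_next_page:
  assumes r: "1 \<le> r"
  shows "iso_vs (page (Suc r) p q)
          (quot (page r p q \<lparr>carrier := {x \<in> carrier (page r p q).
                   page_d r p q x = \<zero>\<^bsub>page r (p + int r) (q - int r + 1)\<^esub>}\<rparr>)
             (page_d r (p - int r) (q + int r - 1) ` carrier (page r (p - int r) (q + int r - 1))))"
    (is "iso_vs _ (quot (_ \<lparr>carrier := ?Ker\<rparr>) ?Im)")
proof -
  let ?n = "p + q" and ?r = "int r"
  note P = presents_page[OF r, of p q]
  let ?f = "page_coset r p ?n"
  define Z' where "Z' = {z \<in> cycles ?r p ?n. D z \<in> boundaries ?r (p + ?r) (?n + 1)}"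
  define Y where "Y = D ` cycles ?r (p - ?r) (?n - 1)"
  have Z'sub: "subspace Z'"
    using subspace_cycles[of ?r p ?n] subspace_boundaries[of ?r "p + ?r" "?n + 1"]
    unfolding Z'_def subspace_def by (simp add: D.add D.scale D.zero)
  have Z'Z: "Z' \<subseteq> cycles ?r p ?n" by (auto simp: Z'_def)
  have Ysub: "subspace Y" unfolding Y_def by (rule subspace_D_image[OF subspace_cycles])
  have YZ': "Y \<subseteq> Z'"
  proof
    fix y assume "y \<in> Y"
    then obtain w where w: "w \<in> cycles ?r (p - ?r) (?n - 1)" "y = D w" by (auto simp: Y_def)
    have "D y = 0" using w DD by (auto simp: cycles_def)
    then show "y \<in> Z'" unfolding Z'_def
      using D_cycles[OF w(1)] subspace_0[OF subspace_boundaries] w by simp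
  qed
  have Ker: "?Ker = ?f ` Z'"
  proof (rule subset_antisym; rule subsetI)
    fix x assume x: "x \<in> ?Ker"
    then obtain z where z: "z \<in> cycles ?r p ?n" "x = ?f z" using carrier_pageE r by blast
    then show "x \<in> ?f ` Z'" using x page_d_zero_iff[OF z(1) r] by (auto simp: Z'_def)
  next
    fix x assume "x \<in> ?f ` Z'"
    then obtain z where z: "z \<in> Z'" "x = ?f z" by blast
    then have zc: "z \<in> cycles ?r p ?n" using Z'Z by blast
    show "x \<in> ?Ker" using page_d_zero_iff[OF zc r] page_coset_in[OF zc r] z by (simp add: Z'_def)
  qed
  have eq: "p - ?r + (q + ?r - 1) = ?n - 1" "p - ?r + ?r = p" "?n - 1 + 1 = ?n" by simp_all
  have Im: "?Im = ?f ` Y"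
  proof -
    have "carrier (page r (p - ?r) (q + ?r - 1)) =
        page_coset r (p - ?r) (?n - 1) ` cycles ?r (p - ?r) (?n - 1)"
      using presents_image[OF presents_page[OF r, of "p - ?r" "q + ?r - 1"]] unfolding eq by simp
    moreover have "page_d r (p - ?r) (q + ?r - 1) (page_coset r (p - ?r) (?n - 1) z) = ?f (D z)"
      if "z \<in> cycles ?r (p - ?r) (?n - 1)" for z
      using page_d_coset[OF r, of z "p - ?r" "q + ?r - 1"] that unfolding eq by simp
    ultimately show ?thesis by (simp add: Y_def image_image)
  qed
  have S: "VectorSpace.subspace class_ring (?f ` Y) (page r p q)"
    by (rule presents_subspace_image[OF P Ysub]) (use YZ' Z'Z in blast)
  have "presents s Z' {z \<in> Z'. ?f z \<in> ?f ` Y} (quot (page r p q\<lparr>carrier := ?f ` Z'\<rparr>) (?f ` Y))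
      (\<lambda>z. ?f ` Y +>\<^bsub>page r p q\<^esub> ?f z)"
    by (rule presents_subquotient[OF P Z'sub Z'Z S image_mono[OF YZ']])
  moreover have "?f z \<in> ?f ` Y \<longleftrightarrow> (\<exists>y\<in>Y. z - y \<in> boundaries ?r p ?n)" if "z \<in> Z'" for z
    using presents_eq_iff[OF P, of z] that Z'Z YZ' by (auto simp: image_iff subset_iff)
  then have "z \<in> {z \<in> Z'. ?f z \<in> ?f ` Y} \<longleftrightarrow> z \<in> {z. \<exists>y\<in>Y. z - y \<in> boundaries ?r p ?n}"
    if "z \<in> Z'" for z using that by blast
  ultimately have P': "presents s Z' {z. \<exists>y\<in>Y. z - y \<in> boundaries ?r p ?n}
      (quot (page r p q\<lparr>carrier := ?f ` Z'\<rparr>) (?f ` Y)) (\<lambda>z. ?f ` Y +>\<^bsub>page r p q\<^esub> ?f z)"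
    by (rule presents_cong) (assumption | rule refl)+
  have P1: "presents s (cycles (?r + 1) p ?n) (boundaries (?r + 1) p ?n) (page (Suc r) p q)
      (page_coset (Suc r) p ?n)"
    using presents_page[of "Suc r" p q] by (simp add: add.commute)
  show ?thesis
    unfolding Ker Im
  proof (rule iso_vs_presents[OF P1 P', where h = "\<lambda>z. z"])
    show "z \<in> Z'" if z: "z \<in> cycles (?r + 1) p ?n" for z
    proof -
      have "D z \<in> cycles (?r - 1) (p + ?r + 1) (?n + 1)"
        using D_cycles[OF z] DD[of z p ?n] z subspace_0[OF F_subspace] by (simp add: cycles_def add.assoc)
      then have "D z + D 0 \<in> boundaries ?r (p + ?r) (?n + 1)"
        unfolding boundaries_def using subspace_0[OF subspace_cycles] by blast
      moreover have "z \<in> cycles ?r p ?n"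
        using z F_antimonoD[of "D z" "p + (?r + 1)" "?n + 1" "p + ?r"] by (simp add: cycles_def)
      ultimately show ?thesis by (simp add: Z'_def D.zero)
    qed
    show "z \<in> {z. \<exists>y\<in>Y. z - y \<in> boundaries ?r p ?n} \<longleftrightarrow> z \<in> boundaries (?r + 1) p ?n"
      if z: "z \<in> cycles (?r + 1) p ?n" for z
    proof
      assume "z \<in> {z. \<exists>y\<in>Y. z - y \<in> boundaries ?r p ?n}"
      then obtain t v u where t: "t \<in> cycles ?r (p - ?r) (?n - 1)"
        and v: "v \<in> cycles (?r - 1) (p + 1) ?n"
        and u: "u \<in> cycles (?r - 1) (p - ?r + 1) (?n - 1)" and e: "z - D t = v + D u"
        by (auto simp: Y_def boundaries_def)
      have zeq: "z = v + D (u + t)" using e by (simp add: D.add algebra_simps)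
      have ut: "u + t \<in> cycles ?r (p - ?r) (?n - 1)"
      proof (rule subspace_add[OF subspace_cycles _ t])
        show "u \<in> cycles ?r (p - ?r) (?n - 1)"
          using u F_antimonoD[of u "p - ?r + 1" "?n - 1" "p - ?r"] by (simp add: cycles_def)
      qed
      \<comment> \<open>As \<open>D\<close> squares to zero, \<open>v\<close> inherits from
        \<open>z\<close> the higher filtration of its differential.\<close>
      have "D z = D v" using zeq DD[of "u + t" "p - ?r" "?n - 1"] ut by (simp add: D.add cycles_def)
      then have "v \<in> cycles ?r (p + 1) ?n" using v z by (simp add: cycles_def algebra_simps)
      then show "z \<in> boundaries (?r + 1) p ?n"
        using zeq ut by (intro boundariesI[of v _ _ _ "u + t"]) simp_all
    next
      assume "z \<in> boundaries (?r + 1) p ?n"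
      then obtain v w where v: "v \<in> cycles ?r (p + 1) ?n" and w: "w \<in> cycles ?r (p - ?r) (?n - 1)"
        and e: "z = v + D w" by (auto simp: boundaries_def)
      have "v \<in> cycles (?r - 1) (p + 1) ?n"
        using v F_antimonoD[of "D v" "p + 1 + ?r" "?n + 1" "p + ?r"] by (simp add: cycles_def)
      then have "v + D 0 \<in> boundaries ?r p ?n"
        unfolding boundaries_def using subspace_0[OF subspace_cycles] by blast
      then have "z - D w \<in> boundaries ?r p ?n" using e by (simp add: D.zero)
      then show "z \<in> {z. \<exists>y\<in>Y. z - y \<in> boundaries ?r p ?n}" using w by (auto simp: Y_def)
    qed
    show "\<exists>z\<in>cycles (?r + 1) p ?n. z' - z \<in> {z. \<exists>y\<in>Y. z - y \<in> boundaries ?r p ?n}"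
      if z': "z' \<in> Z'" for z'
    proof -
      obtain u v where u: "u \<in> cycles (?r - 1) (p + ?r + 1) (?n + 1)"
        and v: "v \<in> cycles (?r - 1) (p + 1) ?n" and e: "D z' = u + D v"
        using z' by (auto simp: Z'_def boundaries_def)
      have "v \<in> F p ?n" using v F_antimonoD[of v "p + 1" ?n p] by (simp add: cycles_def)
      then have "z' - v \<in> F p ?n"
        using z' subspace_diff[OF F_subspace] by (auto simp: Z'_def cycles_def)
      moreover have "D (z' - v) = u" using e by (simp add: D.diff)
      ultimately have "z' - v \<in> cycles (?r + 1) p ?n" using u by (simp add: cycles_def algebra_simps)
      moreover have "v + D 0 \<in> boundaries ?r p ?n"
        unfolding boundaries_def using v subspace_0[OF subspace_cycles] by blast
      then have "z' - (z' - v) - 0 \<in> boundaries ?r p ?n" by (simp add: D.zero)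
      moreover have "0 \<in> Y" by (rule subspace_0[OF Ysub])
      ultimately show ?thesis by blast
    qed
  qed simp_all
qed

theorem spectral_sequence_page: "spectral_sequence page page_d"
  unfolding spectral_sequence_def
  using linear_map_page_d page_d_squared iso_next_page by simp

text \<open>For large \<open>r\<close> the condition defining cycles becomes
  \<open>D z \<in> K (n + 1)\<close>, and the filtration step from which boundaries come is all of
  \<open>C\<close>. The page is then the graded piece of the filtration that \<open>F\<close>
  induces on the cohomology of \<open>C / K\<close>.\<close>

theorem page_converges_to:
  assumes H: "\<And>n. presents s {z \<in> C n. D z \<in> K (n + 1)}
      {k + D c | k c. k \<in> K n \<and> c \<in> C (n - 1)} (H n) (f n)"
  shows "converges_to page page_d H"
proof -
  let ?Z = "\<lambda>n. {z \<in> C n. D z \<in> K (n + 1)}"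
  let ?B = "\<lambda>n. {k + D c | k c. k \<in> K n \<and> c \<in> C (n - 1)}"
  define G where "G p n = {z \<in> F p n. D z \<in> K (n + 1)}" for p n
  have Ksub: "subspace (K n)" for n using F_subspace[of "n + 1" n] F_high[of n "n + 1"] by simp
  have Gsub: "subspace (G p n)" for p n
    using F_subspace[of p n] Ksub[of "n + 1"] unfolding G_def subspace_def
    by (simp add: D.add D.scale D.zero)
  have GZ: "G p n \<subseteq> ?Z n" for p n using F_C by (auto simp: G_def)
  have DK: "D z \<in> K (n + 1)" if "z \<in> K n" for z n
    using D_F[of z "n + 2" n] F_high[of n "n + 2"] F_high[of "n + 1" "n + 2"] that by simp
  have KG: "K n \<subseteq> G p n" for p n using F_K DK by (auto simp: G_def)
  define Fil where "Fil n p = f n ` G p n" for n p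
  have fsub: "VectorSpace.subspace class_ring (Fil n p) (H n)" for n p
    unfolding Fil_def by (rule presents_subspace_image[OF H Gsub GZ])
  have Fmono: "Fil n (p + 1) \<subseteq> Fil n p" for n p
    unfolding Fil_def using F_Suc by (intro image_mono) (auto simp: G_def)
  have Flow: "Fil n 0 = carrier (H n)" for n
    unfolding Fil_def using presents_image[OF H, of n] F_low[of 0 n] by (simp add: G_def)
  have Fhigh: "Fil n (n + 1) = {\<zero>\<^bsub>H n\<^esub>}" for n
  proof -
    have "f n z = \<zero>\<^bsub>H n\<^esub>" if z: "z \<in> G (n + 1) n" for z
    proof -
      have "z \<in> K n" using z F_high[of n "n + 1"] by (simp add: G_def)
      moreover have "0 \<in> C (n - 1)" using F_subspace[of 0 "n - 1"] F_low[of 0 "n - 1"] subspace_0 by simp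
      ultimately have "z + D 0 \<in> ?B n" by blast
      then have "z \<in> ?B n" by (simp add: D.zero)
      then show ?thesis using presents_zero_iff[OF H] GZ z by blast
    qed
    moreover have "f n 0 \<in> f n ` G (n + 1) n" by (rule imageI, rule subspace_0[OF Gsub])
    ultimately show ?thesis
      unfolding Fil_def using subspace_0[OF Gsub, of "n + 1" n] by (intro subset_antisym) auto
  qed
  have stable: "\<exists>R\<ge>2. \<forall>r\<ge>R.
           (\<forall>x\<in>carrier (page r p q).
              page_d r p q x = \<zero>\<^bsub>page r (p + int r) (q - int r + 1)\<^esub>) \<and>
           (\<forall>x\<in>carrier (page r (p - int r) (q + int r - 1)).
              page_d r (p - int r) (q + int r - 1) x = \<zero>\<^bsub>page r p q\<^esub>) \<and>
           iso_vs (page r p q)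
             (quot (H (p + q) \<lparr>carrier := Fil (p + q) p\<rparr>) (Fil (p + q) (p + 1)))" for p q
  proof (intro exI[of _ "2 + nat \<bar>p\<bar> + nat \<bar>q\<bar>"] conjI allI impI)
    \<comment> \<open>In degree \<open>n\<close> the filtration is constant for
      \<open>p \<le> 0\<close> and for \<open>p > n\<close>. The bound puts \<open>p + r\<close>
      above the degree \<open>p + q + 1\<close> of the target and \<open>p - r + 1\<close> at or
      below 0.\<close>
    fix r assume "2 + nat \<bar>p\<bar> + nat \<bar>q\<bar> \<le> r"
    then have r: "1 \<le> r" "p + q + 1 < p + int r" "p - int r + 1 \<le> 0" "p + q < p + int r"
      "p + q + 1 < p + int r + 1" by linarith+
    let ?n = "p + q" and ?r = "int r"
    have Fhi: "F (p + ?r) (?n + 1) = K (?n + 1)" by (rule F_high[OF r(2)])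
    have cyc: "cycles ?r p ?n = G p ?n" by (simp add: cycles_def G_def Fhi)
    have Flo: "F (p - ?r + 1) (?n - 1) = C (?n - 1)" "F (p - ?r) (?n - 1) = C (?n - 1)"
      using r(3) by (intro F_low; simp)+
    have cyc': "cycles (?r - 1) (p + 1) ?n = G (p + 1) ?n"
      by (simp add: cycles_def G_def Fhi)
    have bd: "boundaries ?r p ?n = {u + D v | u v. u \<in> G (p + 1) ?n \<and> v \<in> C (?n - 1) \<and> D v \<in> F p ?n}"
      unfolding boundaries_def cyc' by (simp add: cycles_def Flo)
    show "\<forall>x\<in>carrier (page r p q). page_d r p q x = \<zero>\<^bsub>page r (p + int r) (q - int r + 1)\<^esub>"
    proof
      fix x assume "x \<in> carrier (page r p q)"
      then obtain z where z: "z \<in> cycles ?r p ?n" "x = page_coset r p ?n z" using carrier_pageE r by blast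
      have "D z \<in> K (?n + 1)" using z(1) by (simp add: cyc G_def)
      then have "D z \<in> cycles (?r - 1) (p + ?r + 1) (?n + 1)"
        using DK[of "D z" "?n + 1"] F_K by (auto simp: cycles_def)
      then have "D z + D 0 \<in> boundaries ?r (p + ?r) (?n + 1)"
        unfolding boundaries_def using subspace_0[OF subspace_cycles] by blast
      then show "page_d r p q x = \<zero>\<^bsub>page r (p + int r) (q - int r + 1)\<^esub>"
        unfolding z(2) page_d_zero_iff[OF z(1) r(1)] by (simp add: D.zero)
    qed
    show "\<forall>x\<in>carrier (page r (p - int r) (q + int r - 1)).
        page_d r (p - int r) (q + int r - 1) x = \<zero>\<^bsub>page r p q\<^esub>"
    proof
      fix x assume "x \<in> carrier (page r (p - int r) (q + int r - 1))"
      then obtain z where z: "z \<in> cycles ?r (p - ?r) (p - ?r + (q + ?r - 1))"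
        "x = page_coset r (p - ?r) (p - ?r + (q + ?r - 1)) z" using carrier_pageE r by blast
      have eq: "p - ?r + (q + ?r - 1) = ?n - 1" "p - ?r + ?r = p" "?n - 1 + 1 = ?n"
        "q + ?r - 1 - ?r + 1 = q" by simp_all
      have "z \<in> C (?n - 1)" "D z \<in> F p ?n"
        using z(1) unfolding cycles_def eq by (simp_all add: Flo)
      moreover have "0 \<in> G (p + 1) ?n" by (rule subspace_0[OF Gsub])
      ultimately have "0 + D z \<in> boundaries ?r p ?n" unfolding bd by blast
      then have "D z \<in> boundaries ?r (p - ?r + ?r) (p - ?r + (q + ?r - 1) + 1)" by simp
      then show "page_d r (p - ?r) (q + ?r - 1) x = \<zero>\<^bsub>page r p q\<^esub>"
        using page_d_zero_iff[OF z(1) r(1)] unfolding z(2) eq by simp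
    qed
    let ?f = "f ?n"
    have P': "presents s (G p ?n) {z \<in> G p ?n. ?f z \<in> ?f ` G (p + 1) ?n}
        (quot (H ?n\<lparr>carrier := ?f ` G p ?n\<rparr>) (?f ` G (p + 1) ?n))
        (\<lambda>z. ?f ` G (p + 1) ?n +>\<^bsub>H ?n\<^esub> ?f z)"
      using Fmono[of ?n p] fsub[of ?n "p + 1"] unfolding Fil_def
      by (intro presents_subquotient[OF H Gsub GZ])
    note P = presents_page[OF r(1), of p q, unfolded cyc]
    show "iso_vs (page r p q) (quot (H ?n\<lparr>carrier := Fil ?n p\<rparr>) (Fil ?n (p + 1)))"
      unfolding Fil_def
    proof (rule iso_vs_presents[OF P P', where h = "\<lambda>z. z"])
      show "z \<in> {z \<in> G p ?n. ?f z \<in> ?f ` G (p + 1) ?n} \<longleftrightarrow> z \<in> boundaries ?r p ?n"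
        if z: "z \<in> G p ?n" for z
      proof
        assume "z \<in> {z \<in> G p ?n. ?f z \<in> ?f ` G (p + 1) ?n}"
        then obtain a where a: "a \<in> G (p + 1) ?n" "?f z = ?f a" by blast
        have "z - a \<in> ?B ?n"
          using presents_eq_iff[OF H subsetD[OF GZ z] subsetD[OF GZ a(1)]] a(2) by (rule iffD1)
        then obtain k c where kc: "k \<in> K ?n" "c \<in> C (?n - 1)" "z - a = k + D c" by blast
        have "k \<in> G (p + 1) ?n" using KG kc by blast
        then have ka: "a + k \<in> G (p + 1) ?n" using a subspace_add[OF Gsub] by blast
        then have "a + k \<in> G p ?n" using F_Suc by (auto simp: G_def)
        then have "z - (a + k) \<in> G p ?n" using z subspace_diff[OF Gsub] by blast
        moreover have e: "z - (a + k) = D c" using kc by (simp add: algebra_simps)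
        ultimately have "D c \<in> F p ?n" by (simp add: G_def)
        moreover have "z = (a + k) + D c" using e by (simp add: algebra_simps)
        ultimately show "z \<in> boundaries ?r p ?n" unfolding bd using ka kc by blast
      next
        assume "z \<in> boundaries ?r p ?n"
        then obtain u v where uv: "u \<in> G (p + 1) ?n" "v \<in> C (?n - 1)" "z = u + D v"
          unfolding bd by blast
        have "0 + D v \<in> ?B ?n" using uv(2) subspace_0[OF Ksub] by blast
        then have "z - u \<in> ?B ?n" using uv(3) by simp
        then have "?f z = ?f u"
          using presents_eq_iff[OF H subsetD[OF GZ z] subsetD[OF GZ uv(1)]] by (rule iffD2[rotated])
        then show "z \<in> {z \<in> G p ?n. ?f z \<in> ?f ` G (p + 1) ?n}" using uv(1) z by blast
      qed
      show "\<exists>z\<in>G p ?n. z' - z \<in> {z \<in> G p ?n. ?f z \<in> ?f ` G (p + 1) ?n}" if z': "z' \<in> G p ?n" for z'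
        using z' subspace_0[OF Gsub] by (intro bexI[of _ z']) auto
    qed simp_all
  qed simp
  show ?thesis
    unfolding converges_to_def
  proof (intro exI[of _ Fil] conjI allI)
    show "\<exists>s. Fil n s = carrier (H n)" for n by (rule exI, rule Flow)
    show "\<exists>t. Fil n t = {\<zero>\<^bsub>H n\<^esub>}" for n by (rule exI, rule Fhigh)
  qed (rule fsub Fmono stable)+
qed

end

section \<open>Cochains\<close>

text \<open>
  The Lie derivative on cochains with \<open>\<theta>\<^sub>x\<close> in the Cartan formula
  \<open>\<theta>\<^sub>x = d \<iota>\<^sub>x + \<iota>\<^sub>x d\<close>, where \<open>\<iota>\<^sub>x\<close> inserts \<open>x\<close> as the first argument.
\<close>

definition lie_op ::
    "('g \<Rightarrow> 'g \<Rightarrow> 'g) \<Rightarrow> ('g \<Rightarrow> 'n \<Rightarrow> 'n) \<Rightarrow> 'g \<Rightarrow> ('g list \<Rightarrow> 'n::ab_group_add) \<Rightarrow> 'g list \<Rightarrow> 'n"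
  where "lie_op br act x f xs = act x (f xs) + (\<Sum>j<length xs. f (xs[j := br x (xs ! j)]))"

lemma delete_nth_0 [simp]: "delete_nth 0 (x # xs) = xs"
  and delete_nth_Suc [simp]: "delete_nth (Suc i) (x # xs) = x # delete_nth i xs"
  by (simp_all add: delete_nth_def)

lemma length_delete_nth: "i < length xs \<Longrightarrow> Suc (length (delete_nth i xs)) = length xs"
  by (simp add: delete_nth_def)

lemma dCL_Nil [simp]: "dCL br act f [] = 0"
  by (simp add: dCL_def)

lemma lie_op_Nil: "lie_op br act x f [] = act x (f [])"
  by (simp add: lie_op_def)

lemma lie_op_Cons:
  "lie_op br act x f (y # ys) = f (br x y # ys) + lie_op br act x (\<lambda>zs. f (y # zs)) ys"
  by (simp del: sum.lessThan_Suc add: lie_op_def sum.lessThan_Suc_shift algebra_simps)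

lemma dCL_Cons:
  "dCL br act f (x # xs) = lie_op br act x f xs + dCL br act (\<lambda>ys. f (x # ys)) xs"
  by (simp del: sum.lessThan_Suc
      add: dCL_def lie_op_def sum.lessThan_Suc_shift sum.distrib algebra_simps)

lemma lie_op_cong:
  "(\<And>ys. length ys = length xs \<Longrightarrow> f ys = g ys) \<Longrightarrow> lie_op br act x f xs = lie_op br act x g xs"
  by (simp add: lie_op_def)

lemma dCL_cong:
  assumes "\<And>ys. Suc (length ys) = length xs \<Longrightarrow> f ys = g ys"
  shows "dCL br act f xs = dCL br act g xs"
  using assms unfolding dCL_def
  by (intro arg_cong2[of _ _ _ _ "(+)"] sum.cong) (auto simp: length_delete_nth)

lemma lie_op_append:
  "lie_op br act x f (us @ zs) = lie_op br (lie_op br act) x (\<lambda>us zs. f (us @ zs)) us zs"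
proof (induction us arbitrary: f)
  case Nil
  then show ?case by (simp add: lie_op_Nil)
next
  case (Cons u us)
  then show ?case by (simp add: lie_op_Cons)
qed

text \<open>
  With the first arguments kept apart, a cochain becomes a cochain with values in cochains, and the
  differential becomes that of a total complex.
\<close>

lemma dCL_append:
  "dCL br act f (us @ zs) =
     dCL br (lie_op br act) (\<lambda>us zs. f (us @ zs)) us zs + dCL br act (\<lambda>zs. f (us @ zs)) zs"
proof (induction us arbitrary: f)
  case (Cons u us)
  show ?case using Cons.IH[of "\<lambda>ys. f (u # ys)"]
    by (simp add: dCL_Cons lie_op_append algebra_simps)
qed simp

lemma dCL_split_action:
  "dCL br act f xs =
     dCL br (\<lambda>_ _. 0) f xs + (\<Sum>i<length xs. act (xs ! i) (f (delete_nth i xs)))"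
  by (simp add: dCL_def algebra_simps)

subsection \<open>Symmetry in the first arguments\<close>

text \<open>Symmetry in the first \<open>k\<close> of \<open>n\<close> arguments is expressed by
  adjacent transpositions, which suit recursion on lists. Only lists of length \<open>n\<close>
  count, so that the notion also applies to functions whose values elsewhere are arbitrary. For
  \<open>k \<le> 1\<close> it is no condition, and \<open>k\<close> may exceed
  \<open>n\<close>.\<close>

definition sym_upto :: "nat \<Rightarrow> nat \<Rightarrow> ('g list \<Rightarrow> 'n) \<Rightarrow> bool" where
  "sym_upto k n f \<longleftrightarrow>
     (\<forall>vs x y ws. length vs + 2 \<le> k \<longrightarrow> length vs + 2 + length ws = n \<longrightarrow>
        f (vs @ x # y # ws) = f (vs @ y # x # ws))"

lemma sym_upto_mono: "sym_upto k n f \<Longrightarrow> j \<le> k \<Longrightarrow> sym_upto j n f"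
  unfolding sym_upto_def using order.trans by blast

lemma sym_upto_le_1: "k \<le> 1 \<Longrightarrow> sym_upto k n f"
  by (simp add: sym_upto_def)

lemma sym_upto_n_le_1: "n \<le> 1 \<Longrightarrow> sym_upto k n f"
  by (simp add: sym_upto_def)

lemma sym_upto_min: "sym_upto k n f \<longleftrightarrow> sym_upto (min k n) n f"
  by (auto simp: sym_upto_def)

text \<open>An adjacent swap either involves the first argument or takes place after fixing it.
  Together with \<open>lie_op_Cons\<close> and \<open>dCL_Cons\<close> this recursion carries the
  inductions below.\<close>

lemma sym_upto_Suc:
  fixes f :: "'g list \<Rightarrow> 'n"
  shows "sym_upto (Suc k) (Suc n) f \<longleftrightarrow>
     (\<forall>x y ws. 1 \<le> k \<longrightarrow> Suc (length ws) = n \<longrightarrow> f (x # y # ws) = f (y # x # ws)) \<and>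
     (\<forall>x. sym_upto k n (\<lambda>ys. f (x # ys)))" (is "?l \<longleftrightarrow> ?r1 \<and> ?r2")
proof (intro iffI conjI)
  assume l: ?l
  show ?r1
  proof (intro allI impI)
    fix x y and ws :: "'g list" assume "1 \<le> k" "Suc (length ws) = n"
    then show "f (x # y # ws) = f (y # x # ws)"
      using l[unfolded sym_upto_def, rule_format, of "[]" ws] by simp
  qed
  show ?r2
    unfolding sym_upto_def
  proof (intro allI impI)
    fix z x y and vs ws :: "'g list" assume "length vs + 2 \<le> k" "length vs + 2 + length ws = n"
    then show "f (z # vs @ x # y # ws) = f (z # vs @ y # x # ws)"
      using l[unfolded sym_upto_def, rule_format, of "z # vs" ws] by simp
  qed
next
  assume r: "?r1 \<and> ?r2"
  show ?l
    unfolding sym_upto_def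
  proof (intro allI impI)
    fix x y and vs ws :: "'g list" assume *: "length vs + 2 \<le> Suc k" "length vs + 2 + length ws = Suc n"
    show "f (vs @ x # y # ws) = f (vs @ y # x # ws)"
    proof (cases vs)
      case Nil
      then show ?thesis using r * by simp
    next
      case (Cons z us)
      then show ?thesis using r * by (simp add: sym_upto_def)
    qed
  qed
qed

lemma sym_upto_add: "sym_upto k n f \<Longrightarrow> sym_upto k n g \<Longrightarrow> sym_upto k n (\<lambda>xs. f xs + g xs)"
  by (simp add: sym_upto_def)

lemma sym_upto_diff: "sym_upto k n f \<Longrightarrow> sym_upto k n g \<Longrightarrow> sym_upto k n (\<lambda>xs. f xs - g xs)"
  by (simp add: sym_upto_def)

lemma sym_upto_comp: "sym_upto k n f \<Longrightarrow> sym_upto k n (\<lambda>xs. h (f xs))"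
  by (simp add: sym_upto_def)

lemma sym_upto_cong:
  "sym_upto k n f \<Longrightarrow> (\<And>xs. length xs = n \<Longrightarrow> f xs = g xs) \<Longrightarrow> sym_upto k n g"
  by (simp add: sym_upto_def)

text \<open>A swap of two arguments exchanges the two terms in which the bracket hits one of them
  and preserves all the others.\<close>

lemma sym_upto_lie_op: "sym_upto k n f \<Longrightarrow> sym_upto k n (lie_op br act z f)"
proof (induction k arbitrary: n f)
  case (Suc k)
  show ?case
  proof (cases n)
    case (Suc n')
    have f: "\<forall>x y ws. 1 \<le> k \<longrightarrow> Suc (length ws) = n' \<longrightarrow> f (x # y # ws) = f (y # x # ws)"
      "\<And>x. sym_upto k n' (\<lambda>ys. f (x # ys))"
      using Suc.prems unfolding Suc sym_upto_Suc by blast+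
    have "lie_op br act z f (x # y # ws) = lie_op br act z f (y # x # ws)"
      if "1 \<le> k" "Suc (length ws) = n'" for x y ws
    proof -
      have "lie_op br act z (\<lambda>zs. f (x # y # zs)) ws = lie_op br act z (\<lambda>zs. f (y # x # zs)) ws"
        using f(1) that by (intro lie_op_cong) simp
      moreover have "f (br z x # y # ws) = f (y # br z x # ws)" "f (x # br z y # ws) = f (br z y # x # ws)"
        using f(1) that by blast+
      ultimately show ?thesis by (simp add: lie_op_Cons algebra_simps)
    qed
    moreover have "sym_upto k n' (\<lambda>ys. lie_op br act z f (x # ys))" for x
      unfolding lie_op_Cons by (intro sym_upto_add f(2) Suc.IH)
    ultimately show ?thesis unfolding Suc sym_upto_Suc by blast
  qed (simp add: sym_upto_n_le_1)
qed (simp add: sym_upto_le_1)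

text \<open>Two cases share one induction: symmetry in \<open>k\<close> arguments is preserved, and
  symmetry in all arguments extends to the additional one. Expanding
  \<open>dCL br act f (x # y # ws)\<close> by the recursions gives the bracket
  \<open>br x y\<close>, the two Lie derivatives by \<open>x\<close> and \<open>y\<close>, and the
  differential with both arguments fixed. Exchanging \<open>x\<close> and \<open>y\<close> preserves
  the first by commutativity and interchanges the next two, so that only the last one uses symmetry
  of \<open>f\<close>.\<close>

lemma sym_upto_dCL_aux:
  assumes comm: "\<And>x y. br x y = br y x"
  shows "sym_upto k n f \<Longrightarrow> j \<le> k \<or> n \<le> k \<Longrightarrow> sym_upto j (Suc n) (dCL br act f)"
proof (induction n arbitrary: j k f)
  case (Suc n)
  show ?case
  proof (cases "j \<le> 1")
    case False
    then obtain i where j: "j = Suc i" "1 \<le> i" by (cases j) auto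
    have "\<exists>k'. k = Suc k'" using Suc.prems(2) j by (cases k) auto
    then obtain k' where k: "k = Suc k'" by blast
    have f: "\<forall>x y ws. 1 \<le> k' \<longrightarrow> Suc (length ws) = n \<longrightarrow> f (x # y # ws) = f (y # x # ws)"
      "\<And>x. sym_upto k' n (\<lambda>ys. f (x # ys))"
      using Suc.prems(1) unfolding k sym_upto_Suc by blast+
    have "dCL br act f (x # y # ws) = dCL br act f (y # x # ws)" if ws: "Suc (length ws) = Suc n" for x y ws
    proof -
      have "dCL br act (\<lambda>zs. f (x # y # zs)) ws = dCL br act (\<lambda>zs. f (y # x # zs)) ws"
      proof (rule dCL_cong)
        fix l :: "'a list" assume "Suc (length l) = length ws"
        moreover from this have "1 \<le> k'" using Suc.prems(2) j k ws by auto
        ultimately show "f (x # y # l) = f (y # x # l)" using f(1) ws by simp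
      qed
      then show ?thesis by (simp add: dCL_Cons lie_op_Cons comm[of x y] algebra_simps)
    qed
    moreover have "sym_upto i (Suc n) (\<lambda>ys. dCL br act f (x # ys))" for x
      unfolding dCL_Cons
    proof (rule sym_upto_add)
      have "sym_upto (min i (Suc n)) (Suc n) (lie_op br act x f)"
        using Suc.prems j k by (intro sym_upto_lie_op sym_upto_mono[OF Suc.prems(1)]) auto
      then show "sym_upto i (Suc n) (lie_op br act x f)" using sym_upto_min by blast
      show "sym_upto i (Suc n) (dCL br act (\<lambda>ys. f (x # ys)))"
        using Suc.prems(2) j k by (intro Suc.IH[OF f(2)]) auto
    qed
    ultimately show ?thesis unfolding j(1) sym_upto_Suc by blast
  qed (simp add: sym_upto_le_1)
qed (simp add: sym_upto_n_le_1)

lemma sym_upto_dCL: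
  "(\<And>x y. br x y = br y x) \<Longrightarrow> sym_upto k n f \<Longrightarrow> sym_upto k (Suc n) (dCL br act f)"
  by (rule sym_upto_dCL_aux) auto

lemma sym_upto_dCL_full:
  "(\<And>x y. br x y = br y x) \<Longrightarrow> sym_upto n n f \<Longrightarrow> sym_upto (Suc n) (Suc n) (dCL br act f)"
  by (rule sym_upto_dCL_aux) auto

text \<open>The differentials with and without action have the same bracket terms, so the sum is
  their difference, and each of them is symmetric. Any commutative bracket serves for this; the one
  taken here is constant.\<close>

lemma sym_upto_sum_delete:
  fixes act :: "'g \<Rightarrow> 'n \<Rightarrow> 'n::ab_group_add"
  assumes "sym_upto n n f"
  shows "sym_upto (Suc n) (Suc n) (\<lambda>xs. \<Sum>i<length xs. act (xs ! i) (f (delete_nth i xs)))"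
proof -
  let ?br = "\<lambda>_ _ :: 'g. undefined"
  have "sym_upto (Suc n) (Suc n) (\<lambda>xs. dCL ?br act f xs - dCL ?br (\<lambda>_ _. 0) f xs)"
    by (intro sym_upto_diff sym_upto_dCL_full assms refl)
  then show ?thesis by (subst (asm) dCL_split_action) simp
qed

lemma sym_upto_move_front:
  "sym_upto n n f \<Longrightarrow> length (us @ x # vs) = n \<Longrightarrow> f (us @ x # vs) = f (x # us @ vs)"
proof (induction us arbitrary: f n)
  case (Cons u us)
  then obtain m where n: "n = Suc m" by (cases n) auto
  then have S: "sym_upto (Suc m) (Suc m) f" using Cons.prems(1) by simp
  have "f (u # us @ x # vs) = f (u # x # us @ vs)"
    using Cons.IH[of m "\<lambda>ys. f (u # ys)"] S Cons.prems(2) n unfolding sym_upto_Suc by simp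
  also have "\<dots> = f (x # u # us @ vs)"
    using S[unfolded sym_upto_def, rule_format, of "[]" "us @ vs" u x] Cons.prems(2) n by simp
  finally show ?case by simp
qed simp

text \<open>Adjacent transpositions generate all permutations: the first entry of \<open>xs\<close>
  is located in \<open>ys\<close> and moved to the front, and the tails are compared by
  induction.\<close>

lemma sym_upto_mset:
  "sym_upto n n f \<Longrightarrow> length xs = n \<Longrightarrow> mset xs = mset ys \<Longrightarrow> f xs = f ys"
proof (induction xs arbitrary: f n ys)
  case (Cons x xs)
  obtain us vs where ys: "ys = us @ x # vs"
    using split_list[of x ys] Cons.prems(3) by (metis list.set_intros(1) set_mset_mset)
  obtain m where n: "n = Suc m" "length xs = m" using Cons.prems(2) by (cases n) auto
  have l: "length ys = n" using Cons.prems mset_eq_length by metis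
  have "f (x # xs) = f (x # us @ vs)"
    using Cons.IH[of m "\<lambda>ys. f (x # ys)" "us @ vs"] Cons.prems n ys by (simp add: sym_upto_Suc)
  then show ?case using sym_upto_move_front[OF Cons.prems(1), of us x vs] l ys by simp
qed simp

lemma CS_eq: "CS sg sn N n = {f \<in> CL sg sn N n. sym_upto (nat n) (nat n) f}"
proof -
  have "(\<forall>xs ys. mset xs = mset ys \<longrightarrow> f xs = f ys) \<longleftrightarrow> sym_upto (nat n) (nat n) f"
    if f: "f \<in> CL sg sn N n" for f
  proof
    assume "\<forall>xs ys. mset xs = mset ys \<longrightarrow> f xs = f ys"
    then show "sym_upto (nat n) (nat n) f" by (simp add: sym_upto_def)
  next
    assume S: "sym_upto (nat n) (nat n) f"
    have "f xs = f ys" if m: "mset xs = mset ys" for xs ys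
    proof (cases "int (length xs) = n")
      case True
      then show ?thesis using sym_upto_mset[OF S _ m] by auto
    next
      case False
      then show ?thesis using f mset_eq_length[OF m] by (auto simp: CL_def split: if_splits)
    qed
    then show "\<forall>xs ys. mset xs = mset ys \<longrightarrow> f xs = f ys" by blast
  qed
  then show ?thesis by (auto simp: CS_def)
qed

subsection \<open>Multilinear cochains\<close>

locale coefficients = G: vector_space sg + N: vector_space sn
  for sg :: "'k::field \<Rightarrow> 'g::ab_group_add \<Rightarrow> 'g" and sn :: "'k \<Rightarrow> 'n::ab_group_add \<Rightarrow> 'n" +
  fixes N :: "'n set"
  assumes N_subspace: "N.subspace N"
begin

lemma N_closed: "0 \<in> N" "a \<in> N \<Longrightarrow> b \<in> N \<Longrightarrow> a + b \<in> N" "a \<in> N \<Longrightarrow> sn c a \<in> N"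
  using N_subspace by (auto simp: N.subspace_def)

lemma linear_iff: "Vector_Spaces.linear sg sn f \<longleftrightarrow>
    (\<forall>x y. f (x + y) = f x + f y) \<and> (\<forall>c x. f (sg c x) = sn c (f x))"
  using Vector_Spaces.linear_iff G.vector_space_axioms N.vector_space_axioms by blast

lemma CL_neg: "n < 0 \<Longrightarrow> CL sg sn N n = {0}"
  by (simp add: CL_def)

lemma CL_0: "f \<in> CL sg sn N 0 \<longleftrightarrow> f [] \<in> N \<and> (\<forall>xs. xs \<noteq> [] \<longrightarrow> f xs = 0)"
  unfolding CL_def using N_closed(1) by (auto, metis)

lemma CL_length: "f \<in> CL sg sn N n \<Longrightarrow> int (length xs) \<noteq> n \<Longrightarrow> f xs = 0"
  by (auto simp: CL_def split: if_splits)

lemma CL_range: "f \<in> CL sg sn N n \<Longrightarrow> f xs \<in> N"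
  using N_closed(1) by (auto simp: CL_def split: if_splits)

text \<open>Multilinearity by currying, so that cochains can be treated by induction on the degree.
  Linearity in the first argument may be stated for tails of any length, since for a wrong length
  the map is zero.\<close>

lemma CL_Suc:
  "f \<in> CL sg sn N (int (Suc n)) \<longleftrightarrow>
     f [] = 0 \<and> (\<forall>x. (\<lambda>ys. f (x # ys)) \<in> CL sg sn N (int n)) \<and>
     (\<forall>ys. Vector_Spaces.linear sg sn (\<lambda>x. f (x # ys)))" (is "?l \<longleftrightarrow> ?r")
proof
  assume l: ?l
  have lin: "Vector_Spaces.linear sg sn (\<lambda>x. f (xs[i := x]))" if "length xs = Suc n" "i < Suc n" for xs i
    using l that by (simp add: CL_def del: of_nat_Suc)
  have z: "f xs = 0" if "length xs \<noteq> Suc n" for xs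
    using l that by (simp add: CL_def del: of_nat_Suc)
  have r: "f xs \<in> N" for xs using CL_range[OF l] .
  show ?r
  proof (intro conjI allI)
    show "f [] = 0" by (rule z) simp
    show "(\<lambda>ys. f (x # ys)) \<in> CL sg sn N (int n)" for x
      unfolding CL_def using r z lin[of "x # _" "Suc _"] by simp
    show "Vector_Spaces.linear sg sn (\<lambda>x. f (x # ys))" for ys
    proof (cases "length ys = n")
      case True
      then show ?thesis using lin[of "0 # ys" 0] by simp
    next
      case False
      then have "f (x # ys) = 0" for x by (intro z) simp
      then show ?thesis by (simp add: linear_iff)
    qed
  qed
next
  assume r: ?r
  have c: "(\<lambda>ys. f (x # ys)) \<in> CL sg sn N (int n)" for x using r by blast
  have "f xs \<in> N" for xs
    using r CL_range[OF c] N_closed(1) by (cases xs) auto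
  moreover have "f xs = 0" if "length xs \<noteq> Suc n" for xs
    using r CL_length[OF c] that by (cases xs) auto
  moreover have "Vector_Spaces.linear sg sn (\<lambda>x. f (xs[i := x]))"
    if l: "length xs = Suc n" and i: "i < Suc n" for xs i
  proof -
    obtain y ys where xs: "xs = y # ys" "length ys = n" using l by (cases xs) auto
    show ?thesis
    proof (cases i)
      case 0
      then show ?thesis using r xs by simp
    next
      case (Suc j)
      have "Vector_Spaces.linear sg sn (\<lambda>x. (\<lambda>ys. f (y # ys)) (ys[j := x]))"
        using c[of y] xs i Suc unfolding CL_def by simp
      then show ?thesis using xs Suc by simp
    qed
  qed
  ultimately show ?l by (simp add: CL_def del: of_nat_Suc)
qed

lemma CL_zero: "(\<lambda>_. 0) \<in> CL sg sn N n"
  using N_closed(1) by (simp add: CL_def linear_iff zero_fun_def)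

lemma subspace_CL: "Modules.module.subspace (pointwise sn) (CL sg sn N n)"
proof -
  interpret P: vector_space "pointwise sn" by (rule vector_space_pointwise[OF N.vector_space_axioms])
  show ?thesis
  proof (cases "n < 0")
    case True
    then show ?thesis by (simp add: CL_neg)
  next
    case False
    show ?thesis
      using False N_closed unfolding P.subspace_def CL_def
      by (simp add: linear_iff pointwise_def N.scale_right_distrib algebra_simps)
  qed
qed

lemma CL_add: "f \<in> CL sg sn N n \<Longrightarrow> g \<in> CL sg sn N n \<Longrightarrow> (\<lambda>x. f x + g x) \<in> CL sg sn N n"
  using Modules.module.subspace_add[OF _ subspace_CL, of f n g]
  by (simp add: module_iff_vector_space vector_space_pointwise N.vector_space_axioms plus_fun_def)

lemma CL_diff: "f \<in> CL sg sn N n \<Longrightarrow> g \<in> CL sg sn N n \<Longrightarrow> (\<lambda>x. f x - g x) \<in> CL sg sn N n"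
  using Modules.module.subspace_diff[OF _ subspace_CL, of f n g]
  by (simp add: module_iff_vector_space vector_space_pointwise N.vector_space_axioms fun_diff_def)

lemma CL_Cons: "f \<in> CL sg sn N (int n) \<Longrightarrow> (\<lambda>ys. f (x # ys)) \<in> CL sg sn N (int (n - 1))"
proof (cases n)
  case 0
  assume "f \<in> CL sg sn N (int n)"
  then have "(\<lambda>ys. f (x # ys)) = (\<lambda>_. 0)" using 0 by (auto intro!: CL_length[of f 0])
  then show ?thesis using CL_zero by simp
qed (simp add: CL_Suc del: of_nat_Suc)

lemma CL_linear_head: "f \<in> CL sg sn N (int n) \<Longrightarrow> Vector_Spaces.linear sg sn (\<lambda>x. f (x # ys))"
proof (cases n)
  case 0
  assume "f \<in> CL sg sn N (int n)"
  then have "f (x # ys) = 0" for x using 0 CL_length[of f 0] by simp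
  then show ?thesis by (simp add: linear_iff)
qed (simp add: CL_Suc del: of_nat_Suc)

lemma subspace_sym: "Modules.module.subspace (pointwise sn) {f \<in> CL sg sn N n. sym_upto k m f}"
proof -
  interpret P: vector_space "pointwise sn" by (rule vector_space_pointwise[OF N.vector_space_axioms])
  show ?thesis
    using subspace_CL[of n] unfolding P.subspace_def by (simp add: sym_upto_def pointwise_def)
qed

lemma subspace_CS: "Modules.module.subspace (pointwise sn) (CS sg sn N n)"
  unfolding CS_eq by (rule subspace_sym)

end

text \<open>Linearity in the acting element is restricted to \<open>N\<close> because
  \<open>N\<close> will also be a space of cochains under Lie derivatives:
  \<open>lie_op br act x f\<close> is linear in \<open>x\<close> when \<open>f\<close> is
  multilinear, but not for arbitrary functions \<open>f\<close> on lists.\<close>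

locale coefficient_action = coefficients sg sn N + G: commutative_lie_algebra sg br
  for sg :: "'k::field \<Rightarrow> 'g::ab_group_add \<Rightarrow> 'g" and br
    and sn :: "'k \<Rightarrow> 'n::ab_group_add \<Rightarrow> 'n" and N :: "'n set" +
  fixes act :: "'g \<Rightarrow> 'n \<Rightarrow> 'n"
  assumes act_closed: "a \<in> N \<Longrightarrow> act x a \<in> N"
    and act_linear: "Vector_Spaces.linear sn sn (act x)"
    and act_linear_arg: "a \<in> N \<Longrightarrow> Vector_Spaces.linear sg sn (\<lambda>x. act x a)"
begin

lemma act_simps: "act x (a + b) = act x a + act x b" "act x (sn c a) = sn c (act x a)"
  "act x 0 = 0" "act x (a - b) = act x a - act x b"
proof -
  interpret A: Vector_Spaces.linear sn sn "act x" by (rule act_linear)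
  show "act x (a + b) = act x a + act x b" "act x (sn c a) = sn c (act x a)"
    "act x 0 = 0" "act x (a - b) = act x a - act x b"
    by (rule A.add A.scale A.zero A.diff)+
qed

lemma lie_op_add: "lie_op br act x (\<lambda>ys. f ys + g ys) xs = lie_op br act x f xs + lie_op br act x g xs"
  by (simp add: lie_op_def act_simps sum.distrib)

lemma lie_op_scale: "lie_op br act x (\<lambda>ys. sn c (f ys)) xs = sn c (lie_op br act x f xs)"
  by (simp add: lie_op_def act_simps N.scale_right_distrib N.scale_sum_right)

lemma dCL_add: "dCL br act (\<lambda>ys. f ys + g ys) xs = dCL br act f xs + dCL br act g xs"
  by (simp add: dCL_def act_simps sum.distrib)

lemma dCL_scale: "dCL br act (\<lambda>ys. sn c (f ys)) xs = sn c (dCL br act f xs)"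
  by (simp add: dCL_def act_simps N.scale_right_distrib N.scale_sum_right)

lemma dCL_linear: "Vector_Spaces.linear (pointwise sn) (pointwise sn) (dCL br act)"
  unfolding Vector_Spaces.linear_iff
  by (auto simp: vector_space_pointwise N.vector_space_axioms plus_fun_def pointwise_def
      dCL_add dCL_scale)

lemma lie_op_linear: "Vector_Spaces.linear (pointwise sn) (pointwise sn) (lie_op br act x)"
  unfolding Vector_Spaces.linear_iff
  by (auto simp: vector_space_pointwise N.vector_space_axioms plus_fun_def pointwise_def
      lie_op_add lie_op_scale)

lemma br_linear: "br (x + y) z = br x z + br y z" "br (sg c x) z = sg c (br x z)"
  "br z (x + y) = br z x + br z y" "br z (sg c x) = sg c (br z x)"
  using G.bracket_linear_left[of z] G.bracket_linear_right[of z]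
  by (simp_all add: Vector_Spaces.linear_iff)

text \<open>Linearity in the acting element is included because the recursion
  \<open>dCL_Cons\<close> turns it into linearity of the differential in its first argument.\<close>

lemma lie_op_CL:
  "f \<in> CL sg sn N (int n) \<Longrightarrow>
     lie_op br act x f \<in> CL sg sn N (int n) \<and>
     Vector_Spaces.linear sg sn (\<lambda>x. lie_op br act x f ys)"
proof (induction n arbitrary: f x ys)
  case 0
  then have f: "f [] \<in> N" "\<And>xs. xs \<noteq> [] \<Longrightarrow> f xs = 0" by (simp_all add: CL_0)
  have "lie_op br act x f xs = 0" if "xs \<noteq> []" for xs x
    using that f(2) by (simp add: lie_op_def act_simps)
  then show ?case
    using act_closed[OF f(1)] act_linear_arg[OF f(1)]
    by (cases "ys = []") (simp_all add: CL_0 lie_op_Nil linear_iff)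
next
  case (Suc n)
  have c: "(\<lambda>ys. f (x # ys)) \<in> CL sg sn N (int n)" for x
    using Suc.prems by (simp add: CL_Suc del: of_nat_Suc)
  have h: "Vector_Spaces.linear sg sn (\<lambda>x. f (x # ys))" for ys
    by (rule CL_linear_head[OF Suc.prems])
  have h1: "f ((x + y) # ys) = f (x # ys) + f (y # ys)" "f (sg c x # ys) = sn c (f (x # ys))" for x y c ys
    using h[of ys] by (simp_all add: linear_iff)
  have h2: "lie_op br act (x + y) (\<lambda>zs. f (z # zs)) ys =
      lie_op br act x (\<lambda>zs. f (z # zs)) ys + lie_op br act y (\<lambda>zs. f (z # zs)) ys"
    "lie_op br act (sg c x) (\<lambda>zs. f (z # zs)) ys = sn c (lie_op br act x (\<lambda>zs. f (z # zs)) ys)"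
    for x y z c ys
    using Suc.IH[OF c[of z]] by (simp_all add: linear_iff)
  have "lie_op br act x f \<in> CL sg sn N (int (Suc n))"
    unfolding CL_Suc lie_op_Cons
  proof (intro conjI allI)
    show "lie_op br act x f [] = 0"
      using Suc.prems by (simp add: CL_Suc lie_op_Nil act_simps del: of_nat_Suc)
    show "(\<lambda>ys. f (br x y # ys) + lie_op br act x (\<lambda>zs. f (y # zs)) ys) \<in> CL sg sn N (int n)" for y
      using Suc.IH[OF c] by (intro CL_add c) auto
    show "Vector_Spaces.linear sg sn (\<lambda>y. f (br x y # ys) + lie_op br act x (\<lambda>zs. f (y # zs)) ys)" for ys
      unfolding linear_iff
      by (simp add: br_linear h1 lie_op_add lie_op_scale N.scale_right_distrib algebra_simps)
  qed
  moreover have "Vector_Spaces.linear sg sn (\<lambda>x. lie_op br act x f ys)"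
  proof (cases ys)
    case Nil
    have "f [] = 0" using Suc.prems by (simp add: CL_Suc del: of_nat_Suc)
    then show ?thesis unfolding Nil linear_iff by (simp add: lie_op_Nil act_simps)
  next
    case (Cons z zs)
    show ?thesis unfolding Cons lie_op_Cons linear_iff
      by (simp add: br_linear h1 h2 N.scale_right_distrib algebra_simps)
  qed
  ultimately show ?case by blast
qed

lemma dCL_CL_nat: "f \<in> CL sg sn N (int n) \<Longrightarrow> dCL br act f \<in> CL sg sn N (int (Suc n))"
proof (induction n arbitrary: f)
  case 0
  have "dCL br act (\<lambda>ys. f (x # ys)) ys = 0" for x ys
  proof -
    have "(\<lambda>ys. f (x # ys)) = (\<lambda>_. 0)" using 0 by (auto simp: CL_0)
    then show ?thesis by (simp add: dCL_def act_simps)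
  qed
  then show ?case
    unfolding CL_Suc dCL_Cons using lie_op_CL[OF 0] by simp
next
  case (Suc n)
  have c: "(\<lambda>ys. f (x # ys)) \<in> CL sg sn N (int n)" for x
    using Suc.prems by (simp add: CL_Suc del: of_nat_Suc)
  have h1: "f ((x + y) # ys) = f (x # ys) + f (y # ys)" "f (sg c x # ys) = sn c (f (x # ys))" for x y c ys
    using CL_linear_head[OF Suc.prems, of ys] by (simp_all add: linear_iff)
  have l: "lie_op br act (x + y) f ys = lie_op br act x f ys + lie_op br act y f ys"
    "lie_op br act (sg c x) f ys = sn c (lie_op br act x f ys)" for x y c ys
    using lie_op_CL[OF Suc.prems] by (simp_all add: linear_iff)
  have d1: "dCL br act (\<lambda>ys. f ((x + y) # ys)) zs =
      dCL br act (\<lambda>ys. f (x # ys)) zs + dCL br act (\<lambda>ys. f (y # ys)) zs" for x y zs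
    unfolding h1(1) by (rule dCL_add)
  have d2: "dCL br act (\<lambda>ys. f (sg c x # ys)) zs = sn c (dCL br act (\<lambda>ys. f (x # ys)) zs)" for c x zs
    unfolding h1(2) by (rule dCL_scale)
  have lin: "Vector_Spaces.linear sg sn
      (\<lambda>x. lie_op br act x f ys + dCL br act (\<lambda>ys. f (x # ys)) ys)" for ys
    unfolding linear_iff l d1 d2 by (simp add: N.scale_right_distrib algebra_simps)
  show ?case
    unfolding CL_Suc[of _ "Suc n"] dCL_Cons
    using lin lie_op_CL[OF Suc.prems] CL_add[OF _ Suc.IH[OF c]] by simp
qed

lemma dCL_CL: "f \<in> CL sg sn N n \<Longrightarrow> dCL br act f \<in> CL sg sn N (n + 1)"
proof (cases "n < 0")
  case True
  assume "f \<in> CL sg sn N n"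
  then have "dCL br act f = (\<lambda>_. 0)" using True by (auto simp: CL_neg dCL_def act_simps)
  then show ?thesis using CL_zero by simp
next
  case False
  assume "f \<in> CL sg sn N n"
  then show ?thesis using dCL_CL_nat[of f "nat n"] False by (simp add: add.commute)
qed

lemma lie_op_CL': "f \<in> CL sg sn N n \<Longrightarrow> lie_op br act x f \<in> CL sg sn N n"
proof (cases "n < 0")
  case True
  assume "f \<in> CL sg sn N n"
  then have "lie_op br act x f = (\<lambda>_. 0)" using True by (auto simp: CL_neg lie_op_def act_simps)
  then show ?thesis using CL_zero by simp
next
  case False
  assume "f \<in> CL sg sn N n"
  then show ?thesis using lie_op_CL[of f "nat n"] False by simp
qed

end

section \<open>Change of coefficients and separation of the leading arguments\<close>

lemma CL_comp:
  assumes g: "g \<in> CL sg s1 N1 n" and h: "Vector_Spaces.linear s1 s2 h"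
    and hN: "\<And>a. a \<in> N1 \<Longrightarrow> h a \<in> N2"
  shows "(\<lambda>xs. h (g xs)) \<in> CL sg s2 N2 n"
proof -
  interpret h: Vector_Spaces.linear s1 s2 h by fact
  have l: "Vector_Spaces.linear sg s2 (\<lambda>x. h (k x))" if "Vector_Spaces.linear sg s1 k" for k
    using Vector_Spaces.linear_compose[OF that h] by (simp add: comp_def)
  show ?thesis
    using g l hN by (auto simp: CL_def h.zero)
qed

text \<open>For the zero action the differential is a sum of values of \<open>f\<close>, hence
  commutes with every additive map of the coefficients. In this way class maps, sections and
  functionals pass through \<open>D0\<close>.\<close>

lemma dCL_trivial_comp:
  assumes "\<And>a b. h (a + b) = h a + h b" "h 0 = (0 :: 'w::ab_group_add)"
  shows "h (dCL br (\<lambda>_ _. 0) f xs) = dCL br (\<lambda>_ _. 0) (\<lambda>ys. h (f ys)) xs"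
proof -
  have s: "h (sum k A) = (\<Sum>x\<in>A. h (k x))" for k and A :: "nat set"
    by (induction A rule: infinite_finite_induct) (auto simp: assms)
  show ?thesis by (simp add: dCL_def s)
qed

lemma coefficient_action_trivial:
  assumes "commutative_lie_algebra sg br" "vector_space sw" "Modules.module.subspace sw W"
  shows "coefficient_action sg br sw W (\<lambda>_ _. 0)"
proof -
  interpret commutative_lie_algebra sg br by fact
  interpret W: vector_space sw by fact
  show ?thesis
    by unfold_locales
      (use assms(3) W.subspace_0[OF assms(3)] in
        \<open>auto simp: Vector_Spaces.linear_iff W.vector_space_axioms vector_space_axioms algebra_simps\<close>)
qed

text \<open>In these two definitions \<open>k\<close> is the number of arguments that are kept apart.\<close>

definition split_args :: "nat \<Rightarrow> ('g list \<Rightarrow> 'n::ab_group_add) \<Rightarrow> 'g list \<Rightarrow> 'g list \<Rightarrow> 'n" where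
  "split_args k f us = (if length us = k then (\<lambda>zs. f (us @ zs)) else 0)"

definition join_args :: "nat \<Rightarrow> ('g list \<Rightarrow> 'g list \<Rightarrow> 'n::ab_group_add) \<Rightarrow> 'g list \<Rightarrow> 'n" where
  "join_args k g l = (if k \<le> length l then g (take k l) (drop k l) else 0)"

lemma join_args_append: "length us = k \<Longrightarrow> join_args k g (us @ zs) = g us zs"
  by (simp add: join_args_def)

lemma sym_upto_join_args:
  assumes "sym_upto j k g" "j \<le> k"
  shows "sym_upto j n (join_args k g)"
  unfolding sym_upto_def
proof (intro allI impI)
  fix x y :: 'a and vs ws :: "'a list"
  assume l: "length vs + 2 \<le> j" "length vs + 2 + length ws = n"
  show "join_args k g (vs @ x # y # ws) = join_args k g (vs @ y # x # ws)"
  proof (cases "k \<le> n")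
    case True
    obtain i where i: "k = length vs + 2 + i" using l(1) assms(2) le_iff_add by (metis order.trans)
    have t: "take k (vs @ a # b # ws) = vs @ a # b # take i ws"
      "drop k (vs @ a # b # ws) = drop i ws" for a b
      by (simp_all add: i)
    have "g (vs @ x # y # take i ws) = g (vs @ y # x # take i ws)"
      using assms(1)[unfolded sym_upto_def, rule_format, of vs "take i ws" x y] l i True by simp
    then show ?thesis
      using l True by (simp add: join_args_def t del: take_append drop_append)
  next
    case False
    then show ?thesis using l by (simp add: join_args_def)
  qed
qed

lemma (in coefficients) coefficients_CL: "coefficients sg (pointwise sn) (CL sg sn N q)"
proof -
  interpret P: vector_space "pointwise sn" by (rule vector_space_pointwise[OF N.vector_space_axioms])
  show ?thesis by unfold_locales (rule subspace_CL)
qed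

lemma (in coefficients) split_args_CL:
  "f \<in> CL sg sn N (int k + q) \<Longrightarrow> split_args k f \<in> CL sg (pointwise sn) (CL sg sn N q) (int k)"
proof (cases "q < 0")
  case True
  interpret C: coefficients sg "pointwise sn" "CL sg sn N q" by (rule coefficients_CL)
  assume "f \<in> CL sg sn N (int k + q)"
  then have "f (us @ zs) = 0" if "length us = k" for us zs
    using that True by (intro CL_length[of f "int k + q"]) auto
  then have "split_args k f = (\<lambda>_. 0)" by (auto simp: split_args_def fun_eq_iff)
  then show ?thesis using C.CL_zero by simp
next
  case False
  obtain m where q: "q = int m" using False by (metis nonneg_int_cases not_less)
  interpret C: coefficients sg "pointwise sn" "CL sg sn N q" by (rule coefficients_CL)
  assume "f \<in> CL sg sn N (int k + q)"
  then show ?thesis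
  proof (induction k arbitrary: f)
    case 0
    then show ?case by (simp add: C.CL_0 split_args_def)
  next
    case (Suc k)
    have e: "int (Suc k) + q = int (Suc (k + m))" by (simp add: q)
    have c: "(\<lambda>ys. f (x # ys)) \<in> CL sg sn N (int k + q)" for x
      using Suc.prems unfolding e CL_Suc by (simp add: q)
    have h: "Vector_Spaces.linear sg sn (\<lambda>x. f (x # ys))" for ys
      using Suc.prems unfolding e by (rule CL_linear_head)
    have "f ((x + y) # ys) = f (x # ys) + f (y # ys)" "f (sg c x # ys) = sn c (f (x # ys))" for x y c ys
      using h[of ys] by (simp_all add: linear_iff)
    then have "Vector_Spaces.linear sg (pointwise sn) (\<lambda>x. split_args (Suc k) f (x # us))" for us
      unfolding C.linear_iff by (simp add: split_args_def pointwise_def fun_eq_iff)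
    moreover have "(\<lambda>us. split_args (Suc k) f (x # us)) = split_args k (\<lambda>ys. f (x # ys))" for x
      by (auto simp: split_args_def)
    moreover have "split_args (Suc k) f [] = 0" by (simp add: split_args_def)
    ultimately show ?case unfolding C.CL_Suc using Suc.IH[OF c] by simp
  qed
qed

lemma (in coefficients) join_args_CL:
  "g \<in> CL sg (pointwise sn) (CL sg sn N q) (int k) \<Longrightarrow> join_args k g \<in> CL sg sn N (int k + q)"
proof (cases "q < 0")
  case True
  interpret C: coefficients sg "pointwise sn" "CL sg sn N q" by (rule coefficients_CL)
  assume "g \<in> CL sg (pointwise sn) (CL sg sn N q) (int k)"
  then have "g us = 0" for us using C.CL_range[of g "int k" us] True by (simp add: CL_neg)
  then have "join_args k g = (\<lambda>_. 0)" by (auto simp: join_args_def fun_eq_iff)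
  then show ?thesis using CL_zero by simp
next
  case False
  obtain m where q: "q = int m" using False by (metis nonneg_int_cases not_less)
  interpret C: coefficients sg "pointwise sn" "CL sg sn N q" by (rule coefficients_CL)
  assume "g \<in> CL sg (pointwise sn) (CL sg sn N q) (int k)"
  then show ?thesis
  proof (induction k arbitrary: g)
    case 0
    then have "g [] \<in> CL sg sn N q" by (simp add: C.CL_0)
    then show ?case by (simp add: join_args_def)
  next
    case (Suc k)
    have e: "int (Suc k) + q = int (Suc (k + m))" by (simp add: q)
    have c: "(\<lambda>ys. g (x # ys)) \<in> CL sg (pointwise sn) (CL sg sn N q) (int k)" for x
      using Suc.prems by (simp add: C.CL_Suc del: of_nat_Suc)
    have h: "Vector_Spaces.linear sg (pointwise sn) (\<lambda>x. g (x # ys))" for ys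
      by (rule C.CL_linear_head[OF Suc.prems])
    have "g ((x + y) # ys) = g (x # ys) + g (y # ys)"
      "g (sg c x # ys) = pointwise sn c (g (x # ys))" for x y c ys
      using h[of ys] by (simp_all add: C.linear_iff)
    then have "Vector_Spaces.linear sg sn (\<lambda>x. join_args (Suc k) g (x # l))" for l
      unfolding linear_iff by (simp add: join_args_def pointwise_def)
    moreover have "(\<lambda>l. join_args (Suc k) g (x # l)) = join_args k (\<lambda>ys. g (x # ys))" for x
      by (auto simp: join_args_def)
    moreover have "join_args (Suc k) g [] = 0" by (simp add: join_args_def)
    ultimately show ?case unfolding e CL_Suc using Suc.IH[OF c] by (simp add: q)
  qed
qed

lemma (in coefficients) CL_Cons_int:
  "f \<in> CL sg sn N n \<Longrightarrow> (\<lambda>ys. f (x # ys)) \<in> CL sg sn N (n - 1)"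
proof (cases "n \<le> 0")
  case True
  assume "f \<in> CL sg sn N n"
  then have "(\<lambda>ys. f (x # ys)) = (\<lambda>_. 0)" using True by (auto intro!: CL_length[of f n])
  then show ?thesis using CL_zero by simp
next
  case False
  assume "f \<in> CL sg sn N n"
  then show ?thesis using CL_Cons[of f "nat n" x] False by (simp add: nat_diff_distrib)
qed

lemma (in coefficients) CL_append:
  "f \<in> CL sg sn N (int (length us) + q) \<Longrightarrow> (\<lambda>zs. f (us @ zs)) \<in> CL sg sn N q"
proof (induction us arbitrary: f)
  case (Cons u us)
  then have "f \<in> CL sg sn N (1 + int (length us) + q)" by (simp add: algebra_simps)
  from CL_Cons_int[OF this, of u] show ?case using Cons.IH[of "\<lambda>ys. f (u # ys)"]
    by (simp add: algebra_simps)
qed simp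

text \<open>Swaps among the first \<open>j \<le> n\<close> arguments never reach past position
  \<open>n\<close>. Hence symmetry can be tested before or after keeping \<open>n\<close> arguments
  apart; the tail behind the swap is cut at that position.\<close>

lemma (in coefficients) sym_upto_append_iff:
  assumes f: "f \<in> CL sg sn N (int n + r)" and r: "0 \<le> r" and j: "j \<le> n"
  shows "sym_upto j n (\<lambda>us zs. f (us @ zs)) \<longleftrightarrow> sym_upto j (nat (int n + r)) f"
proof
  assume l: "sym_upto j n (\<lambda>us zs. f (us @ zs))"
  show "sym_upto j (nat (int n + r)) f"
    unfolding sym_upto_def
  proof (intro allI impI)
    fix x y and vs ws :: "'g list"
    assume *: "length vs + 2 \<le> j" "length vs + 2 + length ws = nat (int n + r)"
    define i where "i = n - (length vs + 2)"
    have "length (take i ws) = i" using * r j by (simp add: i_def)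
    then have "(\<lambda>zs. f ((vs @ x # y # take i ws) @ zs)) = (\<lambda>zs. f ((vs @ y # x # take i ws) @ zs))"
      using * j by (intro l[unfolded sym_upto_def, rule_format]) (simp_all add: i_def)
    from fun_cong[OF this, of "drop i ws"]
    show "f (vs @ x # y # ws) = f (vs @ y # x # ws)" by simp
  qed
next
  assume l: "sym_upto j (nat (int n + r)) f"
  show "sym_upto j n (\<lambda>us zs. f (us @ zs))"
    unfolding sym_upto_def
  proof (intro allI impI ext)
    fix x y and vs ws zs :: "'g list"
    assume *: "length vs + 2 \<le> j" "length vs + 2 + length ws = n"
    show "f ((vs @ x # y # ws) @ zs) = f ((vs @ y # x # ws) @ zs)"
    proof (cases "int (length zs) = r")
      case True
      have "f (vs @ x # y # (ws @ zs)) = f (vs @ y # x # (ws @ zs))"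
        using * True by (intro l[unfolded sym_upto_def, rule_format]) auto
      then show ?thesis by simp
    next
      case False
      then show ?thesis using * CL_length[OF f] by simp
    qed
  qed
qed

definition sym_cochains ::
    "('k::field \<Rightarrow> 'g::ab_group_add \<Rightarrow> 'g) \<Rightarrow> ('k \<Rightarrow> 'n::ab_group_add \<Rightarrow> 'n) \<Rightarrow> 'n set \<Rightarrow>
     nat \<Rightarrow> int \<Rightarrow> ('g list \<Rightarrow> 'n) set" where
  "sym_cochains sg sn N j n = {f \<in> CL sg sn N n. sym_upto j (nat n) f}"

lemma CS_eq_sym_cochains: "CS sg sn N n = sym_cochains sg sn N (nat n) n"
  by (simp add: CS_eq sym_cochains_def)

text \<open>
  Identifying \<open>Hom(S\<^sup>k\<gg> \<otimes> \<gg>, W)\<close> with the cochains on \<open>k + 1\<close> arguments that are symmetric in the first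
  \<open>k\<close> ones, these two spaces have quotient \<open>HR\<^sup>k\<^sup>-\<^sup>1(\<gg>; W)\<close>.
\<close>

abbreviation rel_cocycles ::
    "('k::field \<Rightarrow> 'g::ab_group_add \<Rightarrow> 'g) \<Rightarrow> ('g \<Rightarrow> 'g \<Rightarrow> 'g) \<Rightarrow> ('k \<Rightarrow> 'w::ab_group_add \<Rightarrow> 'w) \<Rightarrow>
     'w set \<Rightarrow> nat \<Rightarrow> ('g list \<Rightarrow> 'w) set" where
  "rel_cocycles sg br sw W k \<equiv>
     {g \<in> sym_cochains sg sw W k (int (Suc k)).
        dCL br (\<lambda>_ _. 0) g \<in> sym_cochains sg sw W (Suc (Suc k)) (int (Suc (Suc k)))}"

abbreviation rel_coboundaries ::
    "('k::field \<Rightarrow> 'g::ab_group_add \<Rightarrow> 'g) \<Rightarrow> ('g \<Rightarrow> 'g \<Rightarrow> 'g) \<Rightarrow> ('k \<Rightarrow> 'w::ab_group_add \<Rightarrow> 'w) \<Rightarrow>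
     'w set \<Rightarrow> nat \<Rightarrow> ('g list \<Rightarrow> 'w) set" where
  "rel_coboundaries sg br sw W k \<equiv>
     {b + dCL br (\<lambda>_ _. 0) g | b g.
        b \<in> sym_cochains sg sw W (Suc k) (int (Suc k)) \<and> g \<in> sym_cochains sg sw W (k - 1) (int k)}"

section \<open>The filtered Leibniz complex\<close>

locale lie_module_char_2 = lie_module sg br sm act
  for sg :: "'k::field \<Rightarrow> 'g::ab_group_add \<Rightarrow> 'g" and br
    and sm :: "'k \<Rightarrow> 'm::ab_group_add \<Rightarrow> 'm" and act +
  assumes char_2: "CHAR('k) = 2"
begin

lemma two_eq_0: "(2::'k) = 0"
  using of_nat_CHAR[where 'a = 'k] unfolding char_2 by simp

lemma g_char_2: "x + x = (0::'g)"
  using scale_left_distrib[of 1 1 x] by (simp add: two_eq_0)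

lemma m_char_2: "a + a = (0::'m)"
  using M.scale_left_distrib[of 1 1 a] by (simp add: two_eq_0)

lemma m_char_2': "a + (a + b) = (b::'m)"
  by (simp add: m_char_2 flip: add.assoc)

sublocale A: coefficient_action sg br sm UNIV act
  by (intro coefficient_action.intro coefficients.intro coefficients_axioms.intro
      coefficient_action_axioms.intro vector_space_axioms M.vector_space_axioms M.subspace_UNIV
      commutative_lie_algebra_axioms act_linear_left act_linear_right UNIV_I)

abbreviation CLM :: "int \<Rightarrow> ('g list \<Rightarrow> 'm) set" where "CLM \<equiv> CL sg sm UNIV"
abbreviation D :: "('g list \<Rightarrow> 'm) \<Rightarrow> 'g list \<Rightarrow> 'm" where "D \<equiv> dCL br act"
abbreviation L :: "'g \<Rightarrow> ('g list \<Rightarrow> 'm) \<Rightarrow> 'g list \<Rightarrow> 'm" where "L \<equiv> lie_op br act"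

sublocale P: vector_space "pointwise sm"
  by (rule vector_space_pointwise[OF M.vector_space_axioms])

sublocale D: Vector_Spaces.linear "pointwise sm" "pointwise sm" "dCL br act"
  by (rule A.dCL_linear)

section \<open>Lie derivatives and the square of the differential in characteristic 2\<close>

lemma jacobi': "br (br x y) z = br x (br y z) + br y (br x z)"
proof -
  have "br (br x y) z + (br x (br y z) + br y (br x z)) = 0"
    using jacobi[of x y z] by (simp add: bracket_commute[of z] algebra_simps)
  then have "br (br x y) z = - (br x (br y z) + br y (br x z))"
    by (simp only: eq_neg_iff_add_eq_0)
  also have "\<dots> = br x (br y z) + br y (br x z)"
    by (rule minus_unique) (rule g_char_2)
  finally show ?thesis .
qed

text \<open>The mixed terms, in which the two derivatives hit the first argument and the rest
  separately, occur twice and cancel. What remains is the Jacobi identity in the first argument and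
  the induction hypothesis for the rest.\<close>

lemma lie_op_bracket:
  "f \<in> CLM (int n) \<Longrightarrow> L x (L y f) zs + L y (L x f) zs = L (br x y) f zs"
proof (induction zs arbitrary: f n)
  case Nil
  then show ?case by (simp add: lie_op_Nil act_bracket)
next
  case (Cons z zs)
  have h: "f (br (br x y) z # zs) = f (br x (br y z) # zs) + f (br y (br x z) # zs)"
    using A.CL_linear_head[OF Cons.prems, of zs] by (simp add: A.linear_iff jacobi')
  have IH: "L (br x y) (\<lambda>zs. f (z # zs)) zs =
      L x (L y (\<lambda>zs. f (z # zs))) zs + L y (L x (\<lambda>zs. f (z # zs))) zs"
    using Cons.IH[OF A.CL_Cons[OF Cons.prems]] by simp
  show ?case
    by (simp add: lie_op_Cons h IH A.lie_op_add add_ac m_char_2')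
qed

text \<open>The differential is invariant under the algebra. When the first argument
  \<open>z\<close> is split off, the only new contribution is the Lie derivative by
  \<open>br x z\<close>, and \<open>lie_op_bracket\<close> resolves it.\<close>

lemma lie_op_dCL:
  "f \<in> CLM (int n) \<Longrightarrow> L x (D f) zs = D (L x f) zs"
proof (induction zs arbitrary: f n)
  case Nil
  then show ?case by (simp add: lie_op_Nil A.act_simps)
next
  case (Cons z zs)
  have IH: "L x (D (\<lambda>zs. f (z # zs))) zs = D (L x (\<lambda>zs. f (z # zs))) zs"
    using Cons.IH[OF A.CL_Cons[OF Cons.prems]] .
  have b: "L (br x z) f zs = L x (L z f) zs + L z (L x f) zs"
    using lie_op_bracket[OF Cons.prems] by simp
  have "L x (\<lambda>zs. D f (z # zs)) zs = L x (L z f) zs + L x (D (\<lambda>zs. f (z # zs))) zs"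
    unfolding dCL_Cons by (rule A.lie_op_add)
  moreover have "D (\<lambda>zs. L x f (z # zs)) zs =
      D (\<lambda>zs. f (br x z # zs)) zs + D (L x (\<lambda>zs. f (z # zs))) zs"
    unfolding lie_op_Cons by (rule A.dCL_add)
  ultimately show ?case
    by (simp add: lie_op_Cons[of _ _ x "D f"] dCL_Cons[of _ _ "L x f"] dCL_Cons[of _ _ f] b IH
        add_ac m_char_2')
qed

text \<open>Splitting off the first argument \<open>z\<close> leaves
  \<open>L z (D f) + D (L z f)\<close> and the square of \<open>D\<close> on a cochain of smaller
  degree. The first two terms are equal by invariance, and \<open>a + a = 0\<close> removes
  them.\<close>

lemma dCL_dCL_apply: "f \<in> CLM (int n) \<Longrightarrow> D (D f) zs = 0"
proof (induction zs arbitrary: f n)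
  case (Cons z zs)
  have "D (\<lambda>zs. D f (z # zs)) zs = D (L z f) zs + D (D (\<lambda>zs. f (z # zs))) zs"
    unfolding dCL_Cons by (rule A.dCL_add)
  then show ?case
    using Cons.IH[OF A.CL_Cons[OF Cons.prems]] lie_op_dCL[OF Cons.prems, of z zs]
    by (simp add: dCL_Cons m_char_2)
qed simp

lemma dCL_dCL: "f \<in> CLM n \<Longrightarrow> D (D f) = 0"
proof (cases "n < 0")
  case False
  assume "f \<in> CLM n"
  then show ?thesis using dCL_dCL_apply[of f "nat n"] False by (auto simp: fun_eq_iff)
qed (auto simp: A.CL_neg D.zero)

lemma cartan: "L x c = (\<lambda>zs. D c (x # zs)) - D (\<lambda>zs. c (x # zs))"
  by (rule ext) (simp add: dCL_Cons)

text \<open>The degree of the relative complex is two less than the number of arguments.\<close>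

definition Fil :: "int \<Rightarrow> int \<Rightarrow> ('g list \<Rightarrow> 'm) set" where
  "Fil p n = sym_cochains sg sm UNIV (nat (p + 1)) (n + 2)"

lemmas Fil_def' = Fil_def[unfolded sym_cochains_def]

text \<open>For \<open>p \<le> 0\<close> symmetry in at most one argument is asked for, which is no
  condition. From \<open>p = n + 1\<close> on, all \<open>n + 2\<close> arguments are covered, and
  the filtration has reached \<open>CS\<close>.\<close>

sublocale filtered_complex "pointwise sm" "dCL br act" Fil "\<lambda>n. CLM (n + 2)" "\<lambda>n. CS sg sm UNIV (n + 2)"
proof
  show "P.subspace (Fil p n)" for p n unfolding Fil_def' by (rule A.subspace_sym)
  show "D x \<in> Fil p (n + 1)" if x: "x \<in> Fil p n" for x p n
  proof (cases "n + 2 < 0")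
    case True
    then have "D x = 0" using x by (auto simp: Fil_def' A.CL_neg D.zero)
    then show ?thesis using P.subspace_0[OF A.subspace_sym] by (simp add: Fil_def')
  next
    case False
    have "D x \<in> CLM (n + 2 + 1)" using x A.dCL_CL[of x "n + 2"] by (simp add: Fil_def')
    moreover have "sym_upto (nat (p + 1)) (Suc (nat (n + 2))) (D x)"
      using x by (intro sym_upto_dCL bracket_commute) (simp add: Fil_def')
    moreover have "Suc (nat (n + 2)) = nat (n + 1 + 2)" using False by simp
    ultimately show ?thesis by (simp add: Fil_def' algebra_simps)
  qed
  show "D (D x) = 0" if "x \<in> Fil p n" for x p n using that dCL_dCL by (auto simp: Fil_def')
  show "Fil (p + 1) n \<subseteq> Fil p n" for p n
    unfolding Fil_def' by (auto elim: sym_upto_mono)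
  show "Fil p n = CLM (n + 2)" if "p \<le> 0" for p n
    using that by (auto simp: Fil_def' intro: sym_upto_le_1)
  show "Fil p n = CS sg sm UNIV (n + 2)" if "n < p" for p n
  proof -
    have "min (nat (p + 1)) (nat (n + 2)) = nat (n + 2)" using that by simp
    then show ?thesis
      unfolding Fil_def' CS_eq by (subst sym_upto_min) simp
  qed
qed

text \<open>Keeping leading arguments apart makes a cochain take values in the cochains of the
  remaining arguments. This provides the coefficients for that point of view, with the Lie
  derivative as action.\<close>

lemma coefficient_action_CL: "coefficient_action sg br (pointwise sm) (CLM q) L"
proof -
  interpret C: coefficients sg "pointwise sm" "CLM q" by (rule A.coefficients_CL)
  show ?thesis
  proof (intro coefficient_action.intro coefficient_action_axioms.intro
      C.coefficients_axioms commutative_lie_algebra_axioms)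
    show "L x a \<in> CLM q" if "a \<in> CLM q" for x a using A.lie_op_CL'[OF that] .
    show "Vector_Spaces.linear (pointwise sm) (pointwise sm) (L x)" for x by (rule A.lie_op_linear)
    show "Vector_Spaces.linear sg (pointwise sm) (\<lambda>x. L x a)" if a: "a \<in> CLM q" for a
    proof (cases "q < 0")
      case True
      then have "a = (\<lambda>_. 0)" using a by (auto simp: A.CL_neg)
      then show ?thesis
        unfolding C.linear_iff by (simp add: lie_op_def A.act_simps fun_eq_iff pointwise_def)
    next
      case False
      then have "a \<in> CLM (int (nat q))" using a by simp
      then have "Vector_Spaces.linear sg sm (\<lambda>x. L x a ys)" for ys using A.lie_op_CL by blast
      then show ?thesis
        unfolding C.linear_iff A.linear_iff by (simp add: fun_eq_iff pointwise_def)
    qed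
  qed
qed

end

section \<open>The second page\<close>

text \<open>
  \<open>W\<close> is a copy of the cohomology in degree \<open>q\<close>: the map \<open>\<pi>\<close> induces the isomorphism, \<open>\<sigma>\<close> chooses
  representing cocycles and \<open>\<tau>\<close> chooses primitives of coboundaries. Below, \<open>k\<close> stands for
  \<open>p + 1\<close>.
\<close>

locale second_page = lie_module_char_2 sg br sm act + W: vector_space sw
  for sg :: "'k::field \<Rightarrow> 'g::ab_group_add \<Rightarrow> 'g" and br
    and sm :: "'k \<Rightarrow> 'm::ab_group_add \<Rightarrow> 'm" and act
    and sw :: "'k \<Rightarrow> 'w::ab_group_add \<Rightarrow> 'w" +
  fixes W :: "'w set" and q :: int and \<pi> \<sigma> \<tau>
  assumes W_subspace: "W.subspace W" and q: "0 \<le> q"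
    and \<pi>_linear: "Vector_Spaces.linear (pointwise sm) sw \<pi>" and \<pi>_W: "\<pi> c \<in> W"
    and \<pi>_D: "c \<in> CL sg sm UNIV (q - 1) \<Longrightarrow> \<pi> (dCL br act c) = 0"
    and \<pi>_0: "c \<in> CL sg sm UNIV q \<Longrightarrow> dCL br act c = 0 \<Longrightarrow> \<pi> c = 0 \<Longrightarrow>
                c \<in> dCL br act ` CL sg sm UNIV (q - 1)"
    and \<sigma>_linear: "Vector_Spaces.linear sw (pointwise sm) \<sigma>"
    and \<sigma>_CL: "w \<in> W \<Longrightarrow> \<sigma> w \<in> CL sg sm UNIV q"
    and D_\<sigma>: "w \<in> W \<Longrightarrow> dCL br act (\<sigma> w) = 0"
    and \<pi>_\<sigma>: "w \<in> W \<Longrightarrow> \<pi> (\<sigma> w) = w"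
    and \<tau>_linear: "Vector_Spaces.linear (pointwise sm) (pointwise sm) \<tau>"
    and \<tau>_CL: "\<tau> c \<in> CL sg sm UNIV (q - 1)"
    and D_\<tau>: "c \<in> dCL br act ` CL sg sm UNIV (q - 1) \<Longrightarrow> dCL br act (\<tau> c) = c"
begin

sublocale \<pi>: Vector_Spaces.linear "pointwise sm" sw \<pi> by (rule \<pi>_linear)
sublocale \<sigma>: Vector_Spaces.linear sw "pointwise sm" \<sigma> by (rule \<sigma>_linear)
sublocale \<tau>: Vector_Spaces.linear "pointwise sm" "pointwise sm" \<tau> by (rule \<tau>_linear)

sublocale T: coefficient_action sg br sw W "\<lambda>_ _. 0"
  by (rule coefficient_action_trivial[OF commutative_lie_algebra_axioms W.vector_space_axioms W_subspace])

sublocale Cq: coefficient_action sg br "pointwise sm" "CL sg sm UNIV q" "lie_op br act"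
  by (rule coefficient_action_CL)

abbreviation CLW :: "int \<Rightarrow> ('g list \<Rightarrow> 'w) set" where "CLW \<equiv> CL sg sw W"
abbreviation D0 :: "('g list \<Rightarrow> 'w) \<Rightarrow> 'g list \<Rightarrow> 'w" where "D0 \<equiv> dCL br (\<lambda>_ _. 0)"
abbreviation V :: "('g list \<Rightarrow> 'm) \<Rightarrow> 'g list \<Rightarrow> 'g list \<Rightarrow> 'm" where "V f \<equiv> (\<lambda>us zs. f (us @ zs))"

lemma V_dCL: "V (D f) us = dCL br L (V f) us + D (V f us)"
  by (rule ext) (simp add: dCL_append)

text \<open>Of the two terms of the Cartan formula the coboundary is killed by \<open>\<pi>\<close>.
  The other term remains when \<open>c\<close> is not a cocycle, and its symmetry is exploited in
  \<open>sym_\<pi>_dCL\<close>.\<close>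

lemma \<pi>_L:
  assumes "c \<in> CLM q" shows "\<pi> (L x c) = \<pi> (\<lambda>zs. D c (x # zs))"
  unfolding cartan \<pi>.diff using \<pi>_D[OF A.CL_Cons_int[OF assms]] by simp

lemma \<pi>_L_cocycle:
  assumes "c \<in> CLM q" "D c = 0" shows "\<pi> (L x c) = 0"
  using \<pi>_L[OF assms(1)] assms(2) \<pi>.zero by (simp add: zero_fun_def)

lemma L_cocycle:
  assumes "c \<in> CLM q" "D c = 0" shows "L x c \<in> D ` CLM (q - 1)"
proof -
  have "L x c = 0 - D (\<lambda>zs. c (x # zs))" using assms(2) by (simp add: cartan zero_fun_def)
  moreover have "D (\<lambda>zs. c (x # zs)) \<in> D ` CLM (q - 1)"
    using A.CL_Cons_int[OF assms(1)] by blast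
  ultimately show ?thesis using P.subspace_neg[OF subspace_D_image[OF A.subspace_CL]] by simp
qed

lemma \<pi>_D0: "\<pi> (dCL br (\<lambda>_ _. 0) G us) = D0 (\<lambda>us. \<pi> (G us)) us"
  by (rule dCL_trivial_comp[where h = \<pi>]) (rule \<pi>.add \<pi>.zero)+

lemma \<sigma>_D0: "\<sigma> (D0 g us) = dCL br (\<lambda>_ _. 0) (\<lambda>us. \<sigma> (g us)) us"
  by (rule dCL_trivial_comp[where h = \<sigma>]) (rule \<sigma>.add \<sigma>.zero)+

lemma CLM_append:
  "f \<in> CLM (int k + r) \<Longrightarrow> length us = k + j \<Longrightarrow> V f us \<in> CLM (r - int j)"
  using A.CL_append[of f us "r - int j"] by (simp add: algebra_simps)

text \<open>By \<open>V_dCL\<close>, \<open>D\<close> of the values is the difference of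
  \<open>V (D f)\<close> and of the part of the differential that acts on the leading arguments.
  Both are symmetric in \<open>k + 1\<close> arguments, although the values of \<open>f\<close> are
  symmetric in \<open>k\<close> of them only.\<close>

lemma sym_D_V:
  assumes "sym_upto k k (V f)" "sym_upto (Suc k) (Suc k) (V (D f))"
  shows "sym_upto (Suc k) (Suc k) (\<lambda>us. D (V f us))"
proof -
  have "sym_upto (Suc k) (Suc k) (\<lambda>us. V (D f) us - dCL br L (V f) us)"
    by (intro sym_upto_diff assms sym_upto_dCL_full bracket_commute)
  then show ?thesis by (simp only: V_dCL add_diff_cancel_left')
qed

lemma \<pi>_V_dCL:
  assumes f: "f \<in> CLM (int (Suc k) + q)" and us: "length us = Suc (Suc k)"
  shows "\<pi> (V (D f) us) = D0 (\<lambda>us. \<pi> (V f us)) us +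
           \<pi> (\<Sum>i<length us. (\<lambda>zs. D (V f (delete_nth i us)) ((us ! i) # zs)))"
proof -
  have "V f us \<in> CLM (q - 1)" using CLM_append[OF f, of us 1] us by simp
  then have 1: "\<pi> (D (V f us)) = 0" by (rule \<pi>_D)
  have c: "V f (delete_nth i us) \<in> CLM q" if "i < length us" for i
    using CLM_append[OF f, of "delete_nth i us" 0] us length_delete_nth[OF that] by simp
  show ?thesis
    unfolding V_dCL dCL_split_action[of _ L] \<pi>.add \<pi>_D0 1 \<pi>.sum
    using \<pi>_L[OF c] by simp
qed

text \<open>By how much \<open>\<pi>\<close> fails to commute with the differentials: the error is a
  sum over the omitted argument \<open>x\<close>, each term being the contraction by
  \<open>x\<close> of \<open>D\<close> of a value. By \<open>sym_D_V\<close> these functions are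
  symmetric before the summation, so the sum is symmetric in all \<open>k + 2\<close>
  arguments.\<close>

lemma sym_\<pi>_dCL:
  assumes f: "f \<in> CLM (int (Suc k) + q)"
    and S: "sym_upto k k (V f)" "sym_upto (Suc k) (Suc k) (V (D f))"
  shows "sym_upto (Suc (Suc k)) (Suc (Suc k)) (\<lambda>us. \<pi> (V (D f) us) - D0 (\<lambda>us. \<pi> (V f us)) us)"
proof -
  have "sym_upto (Suc (Suc k)) (Suc (Suc k))
      (\<lambda>us. \<pi> (\<Sum>i<length us. (\<lambda>zs. D (V f (delete_nth i us)) ((us ! i) # zs))))"
    using sym_upto_sum_delete[OF sym_D_V[OF S], of "\<lambda>x c zs. c (x # zs)"] by (rule sym_upto_comp)
  then show ?thesis by (rule sym_upto_cong) (simp add: \<pi>_V_dCL[OF f])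
qed

text \<open>The comparison map: \<open>n\<close> leading arguments are kept, and the cochain in the
  remaining ones is replaced by its image under \<open>\<pi>\<close>, which is its class if it is a
  cocycle.\<close>

definition restrict_p :: "nat \<Rightarrow> ('g list \<Rightarrow> 'm) \<Rightarrow> 'g list \<Rightarrow> 'w" where
  "restrict_p n f us = \<pi> (split_args n f us)"

lemma restrict_p_eq: "length us = n \<Longrightarrow> restrict_p n f us = \<pi> (V f us)"
  by (simp add: restrict_p_def split_args_def)

lemma restrict_p_add: "restrict_p n (f + g) = restrict_p n f + restrict_p n g"
proof
  fix us
  have "split_args n (f + g) us = split_args n f us + split_args n g us"
    by (simp add: split_args_def fun_eq_iff)
  then show "restrict_p n (f + g) us = (restrict_p n f + restrict_p n g) us"
    by (simp add: restrict_p_def \<pi>.add)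
qed

lemma restrict_p_scale: "restrict_p n (pointwise sm c f) = pointwise sw c (restrict_p n f)"
proof
  fix us
  have "split_args n (pointwise sm c f) us = pointwise sm c (split_args n f us)"
    by (simp add: split_args_def fun_eq_iff pointwise_def)
  then show "restrict_p n (pointwise sm c f) us = pointwise sw c (restrict_p n f) us"
    by (simp add: restrict_p_def \<pi>.scale pointwise_def[of sw])
qed

lemma restrict_p_CL: "f \<in> CLM (int n + q) \<Longrightarrow> restrict_p n f \<in> CLW (int n)"
  unfolding restrict_p_def
  by (rule CL_comp[OF A.split_args_CL \<pi>_linear \<pi>_W])

lemma restrict_p_sym: "sym_upto j n (V f) \<Longrightarrow> sym_upto j n (restrict_p n f)"
  by (rule sym_upto_cong[OF sym_upto_comp[of j n "V f" \<pi>]]) (simp_all add: restrict_p_eq)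

lemma D0_restrict_p:
  assumes "length us = Suc n"
  shows "D0 (restrict_p n f) us = D0 (\<lambda>us. \<pi> (V f us)) us"
  by (rule dCL_cong) (use assms in \<open>simp add: restrict_p_eq\<close>)

abbreviation Sy :: "nat \<Rightarrow> int \<Rightarrow> ('g list \<Rightarrow> 'm) set" where
  "Sy \<equiv> sym_cochains sg sm UNIV"

abbreviation SyW :: "nat \<Rightarrow> nat \<Rightarrow> ('g list \<Rightarrow> 'w) set" where
  "SyW j n \<equiv> sym_cochains sg sw W j (int n)"

lemma Sy_def: "Sy j n = {f \<in> CLM n. sym_upto j (nat n) f}"
  by (simp add: sym_cochains_def)

lemma SyW_def: "SyW j n = {f \<in> CLW (int n). sym_upto j n f}"
  by (simp add: sym_cochains_def)

lemma SyW_CLW: "f \<in> SyW j n \<Longrightarrow> f \<in> CLW (int n)"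
  by (simp add: SyW_def del: of_nat_Suc)

lemma SyW_W: "f \<in> SyW j n \<Longrightarrow> f us \<in> W"
  by (rule T.CL_range[OF SyW_CLW])

lemma Sy_CLM: "f \<in> Sy j n \<Longrightarrow> f \<in> CLM n"
  by (simp add: Sy_def)

lemma Sy_V:
  assumes "f \<in> Sy j (int n + r)" "0 \<le> r" "j \<le> n"
  shows "sym_upto j n (V f)"
  using assms A.sym_upto_append_iff[of f n r j] by (simp add: Sy_def)

lemma Sy_VI:
  assumes "f \<in> CLM (int n + r)" "0 \<le> r" "j \<le> n" "sym_upto j n (V f)"
  shows "f \<in> Sy j (int n + r)"
  using assms A.sym_upto_append_iff[of f n r j] by (simp add: Sy_def)

lemma Sy_mono: "f \<in> Sy j n \<Longrightarrow> i \<le> j \<Longrightarrow> f \<in> Sy i n"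
  by (auto simp: Sy_def elim: sym_upto_mono)

lemma Sy_D: "f \<in> Sy j n \<Longrightarrow> 0 \<le> n \<Longrightarrow> D f \<in> Sy j (n + 1)"
  using sym_upto_dCL[of br j "nat n" f act] A.dCL_CL[of f n]
  by (simp add: Sy_def bracket_commute Suc_nat_eq_nat_zadd1 add.commute)

lemma subspace_Sy: "P.subspace (Sy j n)"
  unfolding Sy_def by (rule A.subspace_sym)

lemma subspace_SyW: "Modules.module.subspace (pointwise sw) (SyW j n)"
  unfolding SyW_def by (rule T.subspace_sym)

text \<open>For \<open>k = p + 1\<close> these are the cycles of the second page at position
  \<open>p\<close>, \<open>q\<close>, and \<open>BE\<close> gives its boundaries. The cochains have
  \<open>k + 1 + q\<close> arguments: \<open>k\<close> symmetric ones, the one whose symmetry is in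
  question, and \<open>q\<close> arguments of the Leibniz coefficients.\<close>

abbreviation ZE :: "nat \<Rightarrow> ('g list \<Rightarrow> 'm) set" where
  "ZE k \<equiv> {f \<in> Sy k (int (Suc k) + q). D f \<in> Sy (Suc (Suc k)) (int (Suc (Suc k)) + q)}"

abbreviation BE :: "nat \<Rightarrow> ('g list \<Rightarrow> 'm) set" where
  "BE k \<equiv> {u + D v | u v.
     u \<in> Sy (Suc k) (int (Suc k) + q) \<and> D u \<in> Sy (Suc (Suc k)) (int (Suc (Suc k)) + q) \<and>
     v \<in> Sy (k - 1) (int k + q) \<and> D v \<in> Sy k (int (Suc k) + q)}"

abbreviation ZR :: "nat \<Rightarrow> ('g list \<Rightarrow> 'w) set" where
  "ZR \<equiv> rel_cocycles sg br sw W"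

abbreviation BR :: "nat \<Rightarrow> ('g list \<Rightarrow> 'w) set" where
  "BR \<equiv> rel_coboundaries sg br sw W"

lemma D0_CLW: "g \<in> CLW (int n) \<Longrightarrow> D0 g \<in> CLW (int (Suc n))"
  using T.dCL_CL[of g "int n"] by (simp add: add.commute)

text \<open>\<open>D f\<close> is symmetric in \<open>k + 2\<close> arguments because
  \<open>f\<close> is a cycle for the second page, and \<open>D0\<close> of the restriction differs
  from \<open>\<pi> (V (D f) us)\<close> by the symmetric error of
  \<open>sym_\<pi>_dCL\<close>.\<close>

lemma restrict_p_ZR:
  assumes f: "f \<in> ZE k"
  shows "restrict_p (Suc k) f \<in> ZR k"
proof -
  have fS: "f \<in> Sy k (int (Suc k) + q)" "D f \<in> Sy (Suc (Suc k)) (int (Suc (Suc k)) + q)"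
    using f by blast+
  have fC: "f \<in> CLM (int (Suc k) + q)" by (rule Sy_CLM[OF fS(1)])
  have 1: "restrict_p (Suc k) f \<in> SyW k (Suc k)"
    unfolding SyW_def using restrict_p_CL[OF fC] restrict_p_sym[OF Sy_V[OF fS(1) q]] by simp
  \<comment> \<open>The same cochain read with one leading argument less, so that
    \<open>q + 1\<close> arguments remain.\<close>
  have e1: "int (Suc k) + q = int k + (q + 1)" "int (Suc (Suc k)) + q = int (Suc k) + (q + 1)" by simp_all
  have "sym_upto k k (V f)" using Sy_V[of f k k "q + 1"] fS(1) q unfolding e1 by simp
  moreover have "sym_upto (Suc k) (Suc k) (V (D f))"
    using Sy_V[of "D f" "Suc k" "Suc k" "q + 1"] Sy_mono[OF fS(2), of "Suc k"] q unfolding e1 by simp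
  ultimately have "sym_upto (Suc (Suc k)) (Suc (Suc k))
      (\<lambda>us. \<pi> (V (D f) us) - D0 (\<lambda>us. \<pi> (V f us)) us)"
    by (rule sym_\<pi>_dCL[OF fC])
  moreover have "sym_upto (Suc (Suc k)) (Suc (Suc k)) (\<lambda>us. \<pi> (V (D f) us))"
    by (rule sym_upto_comp[OF Sy_V[OF fS(2) q order.refl], of \<pi>])
  ultimately have "sym_upto (Suc (Suc k)) (Suc (Suc k)) (\<lambda>us. \<pi> (V (D f) us) -
      (\<pi> (V (D f) us) - D0 (\<lambda>us. \<pi> (V f us)) us))" by (rule sym_upto_diff[rotated])
  then have "sym_upto (Suc (Suc k)) (Suc (Suc k)) (D0 (restrict_p (Suc k) f))"
    by (rule sym_upto_cong) (simp add: D0_restrict_p)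
  then show ?thesis using 1 D0_CLW[of "restrict_p (Suc k) f" "Suc k"] by (simp add: SyW_def del: of_nat_Suc)
qed

text \<open>The two kinds of boundary go to the two summands of \<open>BR\<close>: \<open>u\<close>
  is symmetric in one more argument, and \<open>D v\<close> restricts to \<open>D0 g\<close> up to a
  symmetric error.\<close>

lemma restrict_p_BR:
  assumes f: "f \<in> BE k" and k: "k = Suc j"
  shows "restrict_p (Suc k) f \<in> BR k"
proof -
  obtain u v where f: "f = u + D v" and u: "u \<in> Sy (Suc k) (int (Suc k) + q)"
    and v: "v \<in> Sy j (int k + q)" "D v \<in> Sy k (int (Suc k) + q)"
    using f unfolding k by auto
  have vC: "v \<in> CLM (int (Suc j) + q)" using Sy_CLM[OF v(1)] by (simp add: k)
  have DvC: "D v \<in> CLM (int (Suc k) + q)" by (rule Sy_CLM[OF v(2)])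
  have ru: "restrict_p (Suc k) u \<in> SyW (Suc k) (Suc k)"
    unfolding SyW_def
    using restrict_p_CL[OF Sy_CLM[OF u]] restrict_p_sym[OF Sy_V[OF u q order.refl]] by simp
  have e1: "int k + q = int j + (q + 1)" "int (Suc k) + q = int k + (q + 1)" by (simp_all add: k)
  define g where "g = restrict_p k v"
  have gS: "g \<in> SyW j k"
    unfolding g_def SyW_def
    using restrict_p_CL[of v k] Sy_CLM[OF v(1)] restrict_p_sym[OF Sy_V[OF v(1) q]] k by simp
  have "sym_upto j j (V v)" using Sy_V[of v j j "q + 1"] v(1) q unfolding e1 by simp
  moreover have "sym_upto k k (V (D v))"
    using Sy_V[of "D v" k k "q + 1"] v(2) q unfolding e1 by simp
  ultimately have "sym_upto (Suc k) (Suc k) (\<lambda>us. \<pi> (V (D v) us) - D0 (\<lambda>us. \<pi> (V v us)) us)"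
    using sym_\<pi>_dCL[OF vC] by (simp add: k)
  then have "sym_upto (Suc k) (Suc k) (\<lambda>us. restrict_p (Suc k) (D v) us - D0 g us)"
    by (rule sym_upto_cong) (simp add: D0_restrict_p g_def restrict_p_eq)
  moreover have "(\<lambda>us. restrict_p (Suc k) (D v) us - D0 g us) \<in> CLW (int (Suc k))"
    using D0_CLW[of g k] gS restrict_p_CL[OF DvC] by (intro T.CL_diff) (simp_all add: SyW_def del: of_nat_Suc)
  ultimately have rv: "restrict_p (Suc k) (D v) - D0 g \<in> SyW (Suc k) (Suc k)"
    by (simp add: SyW_def fun_diff_def del: of_nat_Suc)
  have "restrict_p (Suc k) f = (restrict_p (Suc k) u + (restrict_p (Suc k) (D v) - D0 g)) + D0 g"
    by (simp add: f restrict_p_add)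
  moreover have "restrict_p (Suc k) u + (restrict_p (Suc k) (D v) - D0 g) \<in> SyW (Suc k) (Suc k)"
    by (rule Modules.module.subspace_add[OF _ subspace_SyW ru rv])
      (simp add: module_iff_vector_space vector_space_pointwise W.vector_space_axioms)
  moreover have "g \<in> SyW (k - 1) k" using gS by (simp add: k)
  ultimately show ?thesis by blast
qed

text \<open>Representing cocycles turn a cochain with values in \<open>W\<close> into a Leibniz
  cochain. Its differential represents \<open>D0 g\<close> only up to coboundaries, since Lie
  derivatives of cocycles are coboundaries and need not vanish.\<close>

lemma sigma_lift:
  assumes g: "g \<in> SyW i n" and i: "i \<le> n"
  defines "f \<equiv> join_args n (\<lambda>us. \<sigma> (g us))"
  shows "f \<in> Sy i (int n + q)" "length us = n \<Longrightarrow> V f us = \<sigma> (g us)"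
    "length us = Suc n \<Longrightarrow>
       \<exists>c\<in>D ` CLM (q - 1). V (D f) us = \<sigma> (D0 g us) + c"
proof -
  have gC: "g \<in> CLW (int n)" "sym_upto i n g" using g by (simp_all add: SyW_def del: of_nat_Suc)
  have gW: "g us \<in> W" for us by (rule T.CL_range[OF gC(1)])
  have fC: "f \<in> CLM (int n + q)"
    unfolding f_def by (intro A.join_args_CL CL_comp[OF gC(1) \<sigma>_linear] \<sigma>_CL)
  show f: "f \<in> Sy i (int n + q)"
    using fC unfolding Sy_def f_def by (simp add: sym_upto_join_args sym_upto_comp gC(2) i)
  show V: "V f us = \<sigma> (g us)" if "length us = n" for us
    unfolding f_def join_args_append[OF that] ..
  assume us: "length us = Suc n"
  have d: "V f (delete_nth i us) = \<sigma> (g (delete_nth i us))" if "i < length us" for i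
    using length_delete_nth[OF that] us by (intro V) simp
  have "dCL br (\<lambda>_ _. 0) (V f) us = \<sigma> (D0 g us)"
    unfolding \<sigma>_D0 by (rule dCL_cong) (use us V in auto)
  then have "V (D f) us = \<sigma> (D0 g us) +
      ((\<Sum>i<length us. L (us ! i) (\<sigma> (g (delete_nth i us)))) + D (V f us))"
    unfolding V_dCL dCL_split_action[of _ L] using d by (simp add: add.assoc)
  moreover have "(\<Sum>i<length us. L (us ! i) (\<sigma> (g (delete_nth i us)))) + D (V f us) \<in> D ` CLM (q - 1)"
  proof (intro P.subspace_add P.subspace_sum subspace_D_image A.subspace_CL L_cocycle \<sigma>_CL D_\<sigma> gW)
    have "V f us \<in> CLM (q - 1)" using CLM_append[OF fC, of us 1] us by simp
    then show "D (V f us) \<in> D ` CLM (q - 1)" by (rule imageI)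
  qed
  ultimately show "\<exists>c\<in>D ` CLM (q - 1). V (D f) us = \<sigma> (D0 g us) + c" by blast
qed

lemma \<pi>_bnd: "c \<in> D ` CLM (q - 1) \<Longrightarrow> \<pi> c = 0"
  using \<pi>_D by blast

lemma V_diff: "V (f - g) us = V f us - V g us"
  by (simp add: fun_eq_iff)

text \<open>The lift \<open>f\<close> of \<open>g\<close> may fail to be a cycle: \<open>D f\<close>
  differs from the symmetric \<open>\<sigma> (D0 g us)\<close> by an error \<open>R\<close> with
  coboundary values. Subtracting the primitive \<open>f'\<close> of \<open>R\<close> repairs this.
  As \<open>R\<close> is symmetric in \<open>k + 1\<close> arguments, so is \<open>f'\<close>, and
  the restriction changes only by an element of \<open>SyW (Suc k) (Suc k)\<close>.\<close>

lemma surj_ZR: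
  assumes g: "g \<in> ZR k"
  shows "\<exists>f\<in>ZE k. g - restrict_p (Suc k) f \<in> SyW (Suc k) (Suc k)"
proof -
  have gS: "g \<in> SyW k (Suc k)" "D0 g \<in> SyW (Suc (Suc k)) (Suc (Suc k))" using g by blast+
  have gW: "g us \<in> W" for us by (rule SyW_W[OF gS(1)])
  have D0gC: "D0 g \<in> CLW (int (Suc (Suc k)))" using gS(2) by (simp add: SyW_def del: of_nat_Suc)
  define f where "f = join_args (Suc k) (\<lambda>us. \<sigma> (g us))"
  have kk: "k \<le> Suc k" by simp
  note lift = sigma_lift[OF gS(1) kk, folded f_def]
  have fS: "f \<in> Sy k (int (Suc k) + q)" using lift(1) by simp
  have fC: "f \<in> CLM (int (Suc k) + q)" by (rule Sy_CLM[OF fS])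
  have e1: "int (Suc k) + q = int k + (q + 1)" "int (Suc (Suc k)) + q = int (Suc k) + (q + 1)" by simp_all
  have Vk: "sym_upto k k (V f)" using Sy_V[of f k k "q + 1"] fS q unfolding e1 by simp
  have DfC: "D f \<in> CLM (int (Suc (Suc k)) + q)" using A.dCL_CL[OF fC] by (simp add: algebra_simps)
  have "sym_upto (Suc k) (Suc k) (V (D f))"
  proof (rule sym_upto_cong)
    show "sym_upto (Suc k) (Suc k) (dCL br L (V f))"
      by (rule sym_upto_dCL_full[OF bracket_commute Vk])
    show "dCL br L (V f) us = V (D f) us" if "length us = Suc k" for us
      using lift(2)[OF that] D_\<sigma>[OF gW] by (simp add: V_dCL)
  qed
  then have DfS: "D f \<in> Sy (Suc k) (int (Suc (Suc k)) + q)"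
    using Sy_VI[of "D f" "Suc k" "q + 1" "Suc k"] DfC q unfolding e1 by simp
  define R where "R us = split_args (Suc (Suc k)) (D f) us - \<sigma> (D0 g us)" for us
  have RC: "R \<in> CL sg (pointwise sm) (CLM q) (int (Suc (Suc k)))"
    unfolding R_def
    by (intro Cq.CL_diff A.split_args_CL[OF DfC] CL_comp[OF D0gC \<sigma>_linear] \<sigma>_CL)
  have R_eq: "R us = V (D f) us - \<sigma> (D0 g us)" if "length us = Suc (Suc k)" for us
    using that by (simp add: R_def split_args_def)
  have Rbnd: "R us \<in> D ` CLM (q - 1)" if us: "length us = Suc (Suc k)" for us
  proof -
    obtain c where "c \<in> D ` CLM (q - 1)" "V (D f) us = \<sigma> (D0 g us) + c"
      using lift(3)[of us] us by auto
    then show ?thesis using R_eq[OF us] by simp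
  qed
  have "sym_upto (Suc k) (Suc (Suc k)) (\<lambda>us. V (D f) us - \<sigma> (D0 g us))"
  proof (rule sym_upto_diff)
    show "sym_upto (Suc k) (Suc (Suc k)) (V (D f))" by (rule Sy_V[OF DfS q]) simp
    have "sym_upto (Suc k) (Suc (Suc k)) (D0 g)"
      using gS(2) by (auto simp: SyW_def simp del: of_nat_Suc elim: sym_upto_mono)
    then show "sym_upto (Suc k) (Suc (Suc k)) (\<lambda>us. \<sigma> (D0 g us))" by (rule sym_upto_comp)
  qed
  then have RS: "sym_upto (Suc k) (Suc (Suc k)) R"
    by (rule sym_upto_cong) (simp add: R_eq)
  define f' where "f' = join_args (Suc (Suc k)) (\<lambda>us. \<tau> (R us))"
  \<comment> \<open>One more argument is kept apart, and primitives have one argument less than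
    \<open>R us\<close>, so \<open>f'\<close> has as many arguments as \<open>f\<close>.\<close>
  have "f' \<in> CLM (int (Suc (Suc k)) + (q - 1))"
    unfolding f'_def by (rule A.join_args_CL[OF CL_comp[OF RC \<tau>_linear \<tau>_CL]])
  then have f'C: "f' \<in> CLM (int (Suc k) + q)" by (simp add: algebra_simps)
  have f'S: "f' \<in> Sy (Suc k) (int (Suc k) + q)"
    unfolding Sy_def using f'C
    by (simp add: f'_def sym_upto_join_args sym_upto_comp RS)
  have Vf': "sym_upto (Suc k) (Suc k) (V f')" by (rule Sy_V[OF f'S q order.refl])
  define h where "h = f - f'"
  have hS: "h \<in> Sy k (int (Suc k) + q)"
    unfolding h_def by (rule P.subspace_diff[OF subspace_Sy fS Sy_mono[OF f'S]]) simp
  have hC: "D h \<in> CLM (int (Suc (Suc k)) + q)"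
    using A.dCL_CL[OF Sy_CLM[OF hS]] by (simp add: algebra_simps)
  \<comment> \<open>\<open>D\<close> of the primitives cancels \<open>R\<close>. The rest of
    \<open>D f'\<close> is the differential in the leading arguments of a cochain symmetric in
    \<open>k + 1\<close> of them, hence symmetric in all \<open>k + 2\<close>.\<close>
  have "sym_upto (Suc (Suc k)) (Suc (Suc k)) (V (D h))"
  proof (rule sym_upto_cong)
    show "sym_upto (Suc (Suc k)) (Suc (Suc k)) (\<lambda>us. \<sigma> (D0 g us) - dCL br L (V f') us)"
      using gS(2) sym_upto_comp[of "Suc (Suc k)" "Suc (Suc k)" "D0 g" \<sigma>]
      by (intro sym_upto_diff sym_upto_dCL_full[OF bracket_commute Vf']) (simp add: SyW_def del: of_nat_Suc)
    show "\<sigma> (D0 g us) - dCL br L (V f') us = V (D h) us" if us: "length us = Suc (Suc k)" for us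
    proof -
      have "V f' us = \<tau> (R us)" unfolding f'_def by (rule ext) (simp add: join_args_append[OF us])
      then have "V (D f') us = dCL br L (V f') us + R us"
        using D_\<tau>[OF Rbnd[OF us]] by (simp add: V_dCL)
      then show ?thesis unfolding h_def D.diff V_diff R_eq[OF us] by (simp only: algebra_simps)
    qed
  qed
  then have "D h \<in> Sy (Suc (Suc k)) (int (Suc (Suc k)) + q)"
    using Sy_VI[OF hC q] by simp
  then have hZ: "h \<in> ZE k" using hS by blast
  have "g - restrict_p (Suc k) h = restrict_p (Suc k) f'"
  proof
    fix us
    show "(g - restrict_p (Suc k) h) us = restrict_p (Suc k) f' us"
    proof (cases "length us = Suc k")
      case True
      have "\<pi> (V h us) = g us - \<pi> (V f' us)"
        unfolding h_def V_diff \<pi>.diff lift(2)[OF True] \<pi>_\<sigma>[OF gW] ..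
      then show ?thesis by (simp add: restrict_p_eq[OF True])
    next
      case False
      have "g us = 0" by (rule T.CL_length[OF SyW_CLW[OF gS(1)]]) (use False in simp)
      then show ?thesis using False by (simp add: restrict_p_def split_args_def \<pi>.zero)
    qed
  qed
  moreover have "restrict_p (Suc k) f' \<in> SyW (Suc k) (Suc k)"
    unfolding SyW_def using restrict_p_CL[OF f'C] restrict_p_sym[OF Vf'] by simp
  ultimately show ?thesis using hZ by (intro bexI[of _ h]) simp_all
qed

text \<open>Subtracting \<open>D f1\<close> for the lift \<open>f1\<close> of \<open>g\<close>
  leaves \<open>f2\<close>, whose values have the symmetric image \<open>b\<close> under
  \<open>\<pi>\<close>. The values need not be symmetric themselves, but a swap changes them by a
  cocycle of class 0, that is, by a coboundary. Subtracting \<open>D\<close> of primitives therefore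
  makes them symmetric in \<open>k + 1\<close> arguments.\<close>

lemma inj_BE:
  assumes f: "f \<in> ZE k" and k: "k = Suc j" and fB: "restrict_p (Suc k) f \<in> BR k"
  shows "f \<in> BE k"
proof -
  have fS: "f \<in> Sy k (int (Suc k) + q)" "D f \<in> Sy (Suc (Suc k)) (int (Suc (Suc k)) + q)"
    using f by blast+
  obtain b g where b: "b \<in> SyW (Suc k) (Suc k)" and g: "g \<in> SyW j k"
    and bg: "restrict_p (Suc k) f = b + D0 g" using fB unfolding k by auto
  have gW: "g us \<in> W" for us by (rule SyW_W[OF g])
  define f1 where "f1 = join_args k (\<lambda>us. \<sigma> (g us))"
  have jk: "j \<le> k" by (simp add: k)
  note lift = sigma_lift[OF g jk, folded f1_def]
  have f1C: "f1 \<in> CLM (int k + q)" by (rule Sy_CLM[OF lift(1)])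
  have e1: "int k + q = int j + (q + 1)" "int (Suc k) + q = int k + (q + 1)" by (simp_all add: k)
  have "sym_upto j j (V f1)" using Sy_V[of f1 j j "q + 1"] lift(1) q unfolding e1 by simp
  then have "sym_upto k k (dCL br L (V f1))"
    unfolding k by (rule sym_upto_dCL_full[OF bracket_commute])
  then have "sym_upto k k (V (D f1))"
    by (rule sym_upto_cong) (use lift(2) D_\<sigma>[OF gW] in \<open>simp add: V_dCL\<close>)
  moreover have "D f1 \<in> CLM (int (Suc k) + q)" using A.dCL_CL[OF f1C] by (simp add: algebra_simps)
  ultimately have Df1S: "D f1 \<in> Sy k (int (Suc k) + q)"
    using Sy_VI[of "D f1" k "q + 1" k] q unfolding e1 by simp
  define f2 where "f2 = f - D f1"
  have f2S: "f2 \<in> Sy k (int (Suc k) + q)"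
    unfolding f2_def by (rule P.subspace_diff[OF subspace_Sy fS(1) Df1S])
  have f2C: "f2 \<in> CLM (int (Suc k) + q)" by (rule Sy_CLM[OF f2S])
  have Df2: "D f2 = D f" unfolding f2_def D.diff using dCL_dCL[OF f1C] by simp
  have \<pi>f2: "\<pi> (V f2 us) = b us" if us: "length us = Suc k" for us
  proof -
    obtain c where c: "c \<in> D ` CLM (q - 1)" "V (D f1) us = \<sigma> (D0 g us) + c"
      using lift(3)[OF us] by blast
    have "D0 g us \<in> W" by (rule T.CL_range[OF D0_CLW[OF SyW_CLW[OF g]]])
    then have "\<pi> (V (D f1) us) = D0 g us" using c \<pi>_bnd \<pi>_\<sigma> by (simp add: \<pi>.add)
    moreover have "\<pi> (V f us) = b us + D0 g us"
      using fun_cong[OF bg, of us] us by (simp add: restrict_p_eq)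
    ultimately show ?thesis unfolding f2_def V_diff \<pi>.diff by simp
  qed
  have Vk: "sym_upto k k (V f2)" using Sy_V[of f2 k k "q + 1"] f2S q unfolding e1 by simp
  have e2: "int (Suc (Suc k)) + q = int (Suc k) + (q + 1)" by simp
  have "sym_upto (Suc k) (Suc k) (V (D f2))"
    using Sy_V[of "D f" "Suc k" "Suc k" "q + 1"] Sy_mono[OF fS(2), of "Suc k"] q unfolding e2 Df2
    by simp
  then have DV: "sym_upto (Suc k) (Suc k) (\<lambda>us. D (V f2 us))" by (rule sym_D_V[OF Vk])
  \<comment> \<open>The values of \<open>f2\<close> need not be coboundaries, and
    \<open>\<tau>\<close> is a section of \<open>D\<close> only on coboundaries. Linearity of
    \<open>\<tau>\<close> makes it enough that the differences under swaps are coboundaries.\<close>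
  define a where "a = join_args (Suc k) (\<lambda>us. \<tau> (split_args (Suc k) f2 us))"
  have "a \<in> CLM (int (Suc k) + (q - 1))"
    unfolding a_def
    by (rule A.join_args_CL[OF CL_comp[OF A.split_args_CL[OF f2C] \<tau>_linear \<tau>_CL]])
  then have aC: "a \<in> CLM (int k + q)" by (simp add: algebra_simps)
  have "sym_upto k (Suc k) (split_args (Suc k) f2)"
    by (rule sym_upto_cong[OF Sy_V[OF f2S q]]) (simp_all add: split_args_def)
  then have aS: "a \<in> Sy k (int k + q)"
    unfolding Sy_def using aC by (simp add: a_def sym_upto_join_args sym_upto_comp)
  have Va: "V a us = \<tau> (V f2 us)" if us: "length us = Suc k" for us
    unfolding a_def by (rule ext) (simp add: join_args_append[OF us] split_args_def us)
  have DaS: "D a \<in> Sy k (int (Suc k) + q)" using Sy_D[OF aS] q by (simp add: algebra_simps)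
  define u where "u = f2 - D a"
  have uC: "u \<in> CLM (int (Suc k) + q)"
    unfolding u_def by (rule Sy_CLM, rule P.subspace_diff[OF subspace_Sy f2S DaS])
  have "sym_upto (Suc k) (Suc k) (\<lambda>us. (V f2 us - D (\<tau> (V f2 us))) - dCL br L (V a) us)"
  proof (rule sym_upto_diff)
    show "sym_upto (Suc k) (Suc k) (dCL br L (V a))"
      by (rule sym_upto_dCL_full[OF bracket_commute Sy_V[OF aS q order.refl]])
    show "sym_upto (Suc k) (Suc k) (\<lambda>us. V f2 us - D (\<tau> (V f2 us)))"
      unfolding sym_upto_def
    proof (intro allI impI)
      fix x y and vs ws :: "'g list"
      assume l: "length vs + 2 \<le> Suc k" "length vs + 2 + length ws = Suc k"
      let ?us = "vs @ x # y # ws" and ?us' = "vs @ y # x # ws"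
      define c where "c = V f2 ?us - V f2 ?us'"
      have len: "length ?us = Suc k" "length ?us' = Suc k" using l by simp_all
      have "c \<in> CLM q"
        unfolding c_def using CLM_append[OF f2C, of ?us 0] CLM_append[OF f2C, of ?us' 0] len
        by (intro P.subspace_diff[OF A.subspace_CL]) simp_all
      moreover have "D (V f2 ?us) = D (V f2 ?us')"
        by (rule DV[unfolded sym_upto_def, rule_format, OF l])
      then have "D c = 0" unfolding c_def D.diff by simp
      moreover have "b ?us = b ?us'"
        using b l unfolding SyW_def sym_upto_def by blast
      then have "\<pi> c = 0" unfolding c_def \<pi>.diff \<pi>f2[OF len(1)] \<pi>f2[OF len(2)] by simp
      ultimately have "D (\<tau> c) = c" by (intro D_\<tau> \<pi>_0)
      then have "D (\<tau> (V f2 ?us)) - D (\<tau> (V f2 ?us')) = V f2 ?us - V f2 ?us'"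
        by (simp add: c_def \<tau>.diff D.diff)
      then show "V f2 ?us - D (\<tau> (V f2 ?us)) = V f2 ?us' - D (\<tau> (V f2 ?us'))"
        by (simp add: algebra_simps)
    qed
  qed
  then have "sym_upto (Suc k) (Suc k) (V u)"
  proof (rule sym_upto_cong)
    show "(V f2 us - D (\<tau> (V f2 us))) - dCL br L (V a) us = V u us" if us: "length us = Suc k" for us
      unfolding u_def V_diff V_dCL Va[OF us] by (simp add: algebra_simps)
  qed
  then have uS: "u \<in> Sy (Suc k) (int (Suc k) + q)" using Sy_VI[OF uC q] by simp
  have "D u = D f" unfolding u_def D.diff Df2 using dCL_dCL[OF aC] by simp
  then have DuS: "D u \<in> Sy (Suc (Suc k)) (int (Suc (Suc k)) + q)" using fS(2) by simp
  have "f1 + a \<in> Sy (k - 1) (int k + q)"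
    using lift(1) Sy_mono[OF aS jk] by (simp add: k P.subspace_add[OF subspace_Sy])
  moreover have "D (f1 + a) \<in> Sy k (int (Suc k) + q)"
    unfolding D.add by (rule P.subspace_add[OF subspace_Sy Df1S DaS])
  moreover have "f = u + D (f1 + a)" by (simp add: u_def f2_def D.add algebra_simps)
  ultimately show ?thesis using uS DuS by blast
qed

theorem iso_second_page:
  assumes P: "presents (pointwise sm) (ZE (Suc j)) (BE (Suc j)) X x"
    and P': "presents (pointwise sw) (ZR (Suc j)) (BR (Suc j)) Y y"
  shows "iso_vs X Y"
proof (rule iso_vs_presents[OF P P', where h = "restrict_p (Suc (Suc j))"])
  show "restrict_p (Suc (Suc j)) f \<in> ZR (Suc j)" if "f \<in> ZE (Suc j)" for f
    using restrict_p_ZR[OF that] .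
  show "restrict_p (Suc (Suc j)) f \<in> BR (Suc j) \<longleftrightarrow> f \<in> BE (Suc j)" if "f \<in> ZE (Suc j)" for f
    using restrict_p_BR[of f "Suc j"] inj_BE[OF that] by blast
  show "\<exists>f\<in>ZE (Suc j). g - restrict_p (Suc (Suc j)) f \<in> BR (Suc j)" if g: "g \<in> ZR (Suc j)" for g
  proof -
    obtain f where f: "f \<in> ZE (Suc j)" "g - restrict_p (Suc (Suc j)) f \<in> SyW (Suc (Suc j)) (Suc (Suc j))"
      using surj_ZR[OF g] by blast
    have "(0 :: 'g list \<Rightarrow> 'w) \<in> SyW j (Suc j)"
      using T.CL_zero[of "int (Suc j)"] by (simp add: SyW_def sym_upto_def zero_fun_def del: of_nat_Suc)
    then have "(g - restrict_p (Suc (Suc j)) f) + D0 0 \<in> BR (Suc j)"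
      using f(2) by fastforce
    moreover have "D0 0 = 0" by (rule ext) (simp add: dCL_def)
    ultimately show ?thesis using f(1) by (intro bexI[of _ f]) simp_all
  qed
qed (simp_all add: restrict_p_add restrict_p_scale)

end

section \<open>Presentations of the cohomology spaces\<close>

lemma quot_map_space_on:
  assumes s: "vector_space s" and Z: "Modules.module.subspace s Z"
    and B: "Modules.module.subspace s B" "B \<subseteq> Z"
    and z: "\<Delta> z \<in> Z" and b: "\<And>b. b \<in> B' \<Longrightarrow> \<exists>c\<in>B. \<Delta> (b + z) = c + \<Delta> z"
    and 0: "0 \<in> B'"
  shows "quot_map (space_on s Z) B \<Delta> (B' +>\<^bsub>space_on s' Z'\<^esub> z) = B +>\<^bsub>space_on s Z\<^esub> \<Delta> z"
proof (rule quot_map_coset)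
  show "VectorSpace.subspace class_ring B (space_on s Z)"
    using presents_subspace_image[OF presents_space_on[OF s Z] B] by simp
  show "\<Delta> z \<in> carrier (space_on s Z)" using z by (simp add: space_on_def)
  show "z \<in> B' +>\<^bsub>space_on s' Z'\<^esub> z" using 0 by (force simp: a_r_coset_def' space_on_def)
  show "\<Delta> x \<in> B +>\<^bsub>space_on s Z\<^esub> \<Delta> z" if "x \<in> B' +>\<^bsub>space_on s' Z'\<^esub> z" for x
    using that b by (auto simp: a_r_coset_def' space_on_def)
qed

text \<open>An application of \<open>presents_subquotient\<close>: the kernel and the image of
  \<open>d\<close> are both images of sets of representatives under \<open>f n\<close>. The
  cohomologies \<open>HL\<close>, \<open>H_rel\<close> and \<open>HR_coeff\<close> are all presented
  in this way.\<close>

lemma presents_cohomology: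
  assumes P: "\<And>n. presents s (Z n) (B n) (C n) (f n)"
    and \<Delta>: "\<And>u v n. u \<in> Z n \<Longrightarrow> v \<in> Z n \<Longrightarrow> \<Delta> (u + v) = \<Delta> u + \<Delta> v"
      "\<And>c u n. u \<in> Z n \<Longrightarrow> \<Delta> (s c u) = s c (\<Delta> u)"
    and \<Delta>Z: "\<And>n z. z \<in> Z n \<Longrightarrow> \<Delta> z \<in> Z (n + 1)"
    and \<Delta>\<Delta>: "\<And>n z. z \<in> Z n \<Longrightarrow> \<Delta> (\<Delta> z) \<in> B (n + 2)"
    and d: "\<And>n z. z \<in> Z n \<Longrightarrow> d n (f n z) = f (n + 1) (\<Delta> z)"
    and BZ: "\<And>n. B n \<subseteq> Z n"
  shows "\<exists>h. presents s {z \<in> Z n. \<Delta> z \<in> B (n + 1)} {b + \<Delta> c | b c. b \<in> B n \<and> c \<in> Z (n - 1)}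
           (cohomology C d n) h"
proof -
  interpret vector_space s using P by (rule presents_vector_space)
  have Zs: "subspace (Z n)" for n using P by (rule presents_subspace)
  have Bs: "subspace (B n)" for n
    using presents_kernel_subspace[OF P, of n] BZ[of n] by (simp add: Collect_conj_eq Int_absorb1)
  define Z' where "Z' = {z \<in> Z n. \<Delta> z \<in> B (n + 1)}"
  define Y where "Y = \<Delta> ` Z (n - 1)"
  have \<Delta>0: "\<Delta> 0 = 0" using \<Delta>(1)[of 0 n 0] subspace_0[OF Zs, of n] by simp
  have Z's: "subspace Z'"
    using Zs[of n] Bs[of "n + 1"] \<Delta> \<Delta>0 by (auto simp: Z'_def subspace_def)
  have Ys: "subspace Y"
    unfolding Y_def
  proof (rule subspaceI)
    show "0 \<in> \<Delta> ` Z (n - 1)" using \<Delta>0 subspace_0[OF Zs] by (metis imageI)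
    show "x + y \<in> \<Delta> ` Z (n - 1)" if "x \<in> \<Delta> ` Z (n - 1)" "y \<in> \<Delta> ` Z (n - 1)" for x y
      using that \<Delta>(1) subspace_add[OF Zs] by (auto simp: image_iff) metis
    show "s c x \<in> \<Delta> ` Z (n - 1)" if "x \<in> \<Delta> ` Z (n - 1)" for c x
      using that \<Delta>(2) subspace_scale[OF Zs] by (auto simp: image_iff) metis
  qed
  have "\<Delta> (\<Delta> z) \<in> B (n + 1)" if "z \<in> Z (n - 1)" for z
    using \<Delta>\<Delta>[OF that] by (simp add: algebra_simps)
  then have YZ': "Y \<subseteq> Z'" using \<Delta>Z[of _ "n - 1"] by (auto simp: Y_def Z'_def)
  have Z'Z: "Z' \<subseteq> Z n" by (auto simp: Z'_def)
  have Ker: "{x \<in> carrier (C n). d n x = \<zero>\<^bsub>C (n + 1)\<^esub>} = f n ` Z'"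
  proof -
    have "d n (f n z) = \<zero>\<^bsub>C (n + 1)\<^esub> \<longleftrightarrow> \<Delta> z \<in> B (n + 1)" if "z \<in> Z n" for z
      using presents_zero_iff[OF P \<Delta>Z[OF that]] d[OF that] by simp
    then show ?thesis unfolding Z'_def presents_image[OF P, symmetric] by auto
  qed
  have Im: "d (n - 1) ` carrier (C (n - 1)) = f n ` Y"
    using d[of _ "n - 1"] unfolding Y_def presents_image[OF P, symmetric] image_image by simp
  have S: "VectorSpace.subspace class_ring (f n ` Y) (C n)"
    by (rule presents_subspace_image[OF P Ys order.trans[OF YZ' Z'Z]])
  have "presents s Z' {z \<in> Z'. f n z \<in> f n ` Y} (quot (C n\<lparr>carrier := f n ` Z'\<rparr>) (f n ` Y))
      (\<lambda>z. f n ` Y +>\<^bsub>C n\<^esub> f n z)"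
    by (rule presents_subquotient[OF P Z's Z'Z S image_mono[OF YZ']])
  then have "presents s Z' {b + \<Delta> c | b c. b \<in> B n \<and> c \<in> Z (n - 1)}
      (quot (C n\<lparr>carrier := f n ` Z'\<rparr>) (f n ` Y)) (\<lambda>z. f n ` Y +>\<^bsub>C n\<^esub> f n z)"
  proof (rule presents_cong)
    fix z assume z: "z \<in> Z'"
    then have zZ: "z \<in> Z n" using Z'Z by blast
    have "f n z \<in> f n ` Y \<longleftrightarrow> (\<exists>y\<in>Y. z - y \<in> B n)"
      using presents_eq_iff[OF P zZ] YZ' Z'Z by (auto simp: image_iff subset_iff)
    also have "\<dots> \<longleftrightarrow> (\<exists>b c. z = b + \<Delta> c \<and> b \<in> B n \<and> c \<in> Z (n - 1))"
    proof
      assume "\<exists>y\<in>Y. z - y \<in> B n"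
      then obtain c where "c \<in> Z (n - 1)" "z - \<Delta> c \<in> B n" by (auto simp: Y_def)
      then show "\<exists>b c. z = b + \<Delta> c \<and> b \<in> B n \<and> c \<in> Z (n - 1)"
        by (intro exI[of _ "z - \<Delta> c"] exI[of _ c]) simp
    next
      assume "\<exists>b c. z = b + \<Delta> c \<and> b \<in> B n \<and> c \<in> Z (n - 1)"
      then obtain b c where "z = b + \<Delta> c" "b \<in> B n" "c \<in> Z (n - 1)" by blast
      then show "\<exists>y\<in>Y. z - y \<in> B n" unfolding Y_def by (intro bexI[of _ "\<Delta> c"]) simp_all
    qed
    finally show "z \<in> {z \<in> Z'. f n z \<in> f n ` Y} \<longleftrightarrow>
        z \<in> {b + \<Delta> c | b c. b \<in> B n \<and> c \<in> Z (n - 1)}" using z by simp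
  qed simp
  then show ?thesis unfolding cohomology_def Ker Im Z'_def by blast
qed

lemma iso_vs_zero:
  assumes "vectorspace class_ring X" "vectorspace class_ring Y"
    and "carrier X = {\<zero>\<^bsub>X\<^esub>}" "carrier Y = {\<zero>\<^bsub>Y\<^esub>}"
  shows "iso_vs X Y"
proof -
  interpret X: vectorspace class_ring X by fact
  interpret Y: vectorspace class_ring Y by fact
  have 0: "\<zero>\<^bsub>X\<^esub> \<oplus>\<^bsub>X\<^esub> \<zero>\<^bsub>X\<^esub> = \<zero>\<^bsub>X\<^esub>" "\<zero>\<^bsub>Y\<^esub> \<oplus>\<^bsub>Y\<^esub> \<zero>\<^bsub>Y\<^esub> = \<zero>\<^bsub>Y\<^esub>" by simp_all
  have "c \<odot>\<^bsub>Y\<^esub> \<zero>\<^bsub>Y\<^esub> = \<zero>\<^bsub>Y\<^esub>" for c by (rule Y.rmult_0) simp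
  then have "linear_map class_ring X Y (\<lambda>_. \<zero>\<^bsub>Y\<^esub>)"
    using 0 by (intro linear_mapI assms(1,2)) simp_all
  moreover have "bij_betw (\<lambda>_. \<zero>\<^bsub>Y\<^esub>) (carrier X) (carrier Y)"
    unfolding assms(3,4) by (simp add: bij_betw_def)
  ultimately show ?thesis unfolding iso_vs_def by blast
qed

lemma presents_carrier_zero:
  assumes P: "presents s Z B X f" and "Z \<subseteq> B"
  shows "carrier X = {\<zero>\<^bsub>X\<^esub>}"
proof -
  interpret vector_space s using P by (rule presents_vector_space)
  have "f z = \<zero>\<^bsub>X\<^esub>" if "z \<in> Z" for z using presents_zero_iff[OF P that] assms(2) that by blast
  moreover have "0 \<in> Z" using presents_subspace[OF P] by (rule subspace_0)
  ultimately show ?thesis unfolding presents_image[OF P, symmetric] by auto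
qed

context lie_module_char_2
begin

lemma presents_HL:
  "\<exists>h. presents (pointwise sm) {c \<in> CLM n. D c = 0} (D ` CLM (n - 1)) (HL sg br sm act n) h"
proof -
  have "\<exists>h. presents (pointwise sm) {c \<in> CLM n. D c \<in> {0}} {b + D c | b c. b \<in> {0} \<and> c \<in> CLM (n - 1)}
      (cohomology (\<lambda>n. space_on (pointwise sm) (CLM n)) (\<lambda>n. D) n) h"
  proof (rule presents_cohomology[where f = "\<lambda>_ z. z"])
    show "presents (pointwise sm) (CLM n) {0} (space_on (pointwise sm) (CLM n)) (\<lambda>z. z)" for n
      by (rule presents_space_on[OF P.vector_space_axioms A.subspace_CL])
    show "D (D z) \<in> {0}" if "z \<in> CLM n" for z n using dCL_dCL[OF that] by blast
    show "{0} \<subseteq> CLM n" for n using P.subspace_0[OF A.subspace_CL] by blast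
  qed (rule D.add D.scale refl A.dCL_CL, assumption?)+
  moreover have "{b + D c | b c. b \<in> {0} \<and> c \<in> CLM (n - 1)} = D ` CLM (n - 1)" by auto
  ultimately show ?thesis by (simp add: HL_def)
qed

lemma presents_H_rel:
  "\<exists>h. presents (pointwise sm) {z \<in> CLM (n + 2). D z \<in> CS sg sm UNIV (n + 1 + 2)}
     {k + D c | k c. k \<in> CS sg sm UNIV (n + 2) \<and> c \<in> CLM (n - 1 + 2)} (H_rel sg br sm act n) h"
proof -
  have CSC: "CS sg sm UNIV m \<subseteq> CLM m" for m by (auto simp: CS_def)
  have e: "m + 1 + 2 = m + 3" for m :: int by simp
  have "\<exists>h. presents (pointwise sm) {z \<in> CLM (n + 2). D z \<in> CS sg sm UNIV (n + 1 + 2)}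
     {k + D c | k c. k \<in> CS sg sm UNIV (n + 2) \<and> c \<in> CLM (n - 1 + 2)}
     (cohomology (C_rel sg sm)
       (\<lambda>n. quot_map (space_on (pointwise sm) (CLM (n + 3))) (CS sg sm UNIV (n + 3)) (dCL br act)) n) h"
  proof (rule presents_cohomology)
    show "presents (pointwise sm) (CLM (n + 2)) (CS sg sm UNIV (n + 2)) (C_rel sg sm n)
        (\<lambda>z. CS sg sm UNIV (n + 2) +>\<^bsub>space_on (pointwise sm) (CLM (n + 2))\<^esub> z)" for n
      unfolding C_rel_def
      by (rule presents_quot[OF P.vector_space_axioms A.subspace_CL A.subspace_CS CSC])
    show "D z \<in> CLM (m + 1 + 2)" if "z \<in> CLM (m + 2)" for z m
      using A.dCL_CL[OF that] by (simp add: algebra_simps)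
    show "D (D z) \<in> CS sg sm UNIV (m + 2 + 2)" if "z \<in> CLM (m + 2)" for z m
      using dCL_dCL[OF that] P.subspace_0[OF A.subspace_CS] by simp
    show "quot_map (space_on (pointwise sm) (CLM (m + 3))) (CS sg sm UNIV (m + 3)) D
        (CS sg sm UNIV (m + 2) +>\<^bsub>space_on (pointwise sm) (CLM (m + 2))\<^esub> z) =
      CS sg sm UNIV (m + 1 + 2) +>\<^bsub>space_on (pointwise sm) (CLM (m + 1 + 2))\<^esub> D z"
      if z: "z \<in> CLM (m + 2)" for z m
      unfolding e
    proof (rule quot_map_space_on[OF P.vector_space_axioms A.subspace_CL A.subspace_CS CSC])
      show "D z \<in> CLM (m + 3)" using A.dCL_CL[OF z] by (simp add: algebra_simps)
      show "\<exists>c\<in>CS sg sm UNIV (m + 3). D (b + z) = c + D z" if b: "b \<in> CS sg sm UNIV (m + 2)" for b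
      proof
        show "D (b + z) = D b + D z" by (rule D.add)
        \<comment> \<open>At the index \<open>m + 2\<close> the filtration equals \<open>CS\<close>
          in both degrees \<open>m\<close> and \<open>m + 1\<close>, so that stability of
          \<open>CS\<close> is stability of the filtration.\<close>
        show "D b \<in> CS sg sm UNIV (m + 3)"
          using D_F[of b "m + 1" m] b F_high[of m "m + 1"] D_F[of b "m + 2" m]
            F_high[of m "m + 2"] F_high[of "m + 1" "m + 2"] by (simp add: algebra_simps)
      qed
      show "0 \<in> CS sg sm UNIV (m + 2)" by (rule P.subspace_0[OF A.subspace_CS])
    qed
  qed (rule D.add D.scale CSC)+
  then show ?thesis unfolding H_rel_def .
qed

lemma page_converges_to_H_rel: "converges_to page page_d (H_rel sg br sm act)"
proof -
  have "\<forall>n. \<exists>h. presents (pointwise sm) {z \<in> CLM (n + 2). D z \<in> CS sg sm UNIV (n + 1 + 2)}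
     {k + D c | k c. k \<in> CS sg sm UNIV (n + 2) \<and> c \<in> CLM (n - 1 + 2)} (H_rel sg br sm act n) h"
    by (rule allI) (rule presents_H_rel)
  from choice[OF this] obtain h where
    "\<forall>n. presents (pointwise sm) {z \<in> CLM (n + 2). D z \<in> CS sg sm UNIV (n + 1 + 2)}
     {k + D c | k c. k \<in> CS sg sm UNIV (n + 2) \<and> c \<in> CLM (n - 1 + 2)} (H_rel sg br sm act n) (h n)" ..
  then show ?thesis by (intro page_converges_to) (rule spec)
qed

end

subsection \<open>The complex \<open>CR\<close>\<close>

lemma mset_delete_nth: "i < length xs \<Longrightarrow> mset (delete_nth i xs) = mset xs - {#xs ! i#}"
proof -
  assume "i < length xs"
  then have "xs = take i xs @ xs ! i # drop (Suc i) xs" by (rule id_take_nth_drop)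
  then have "mset xs = add_mset (xs ! i) (mset (delete_nth i xs))"
    unfolding delete_nth_def by (metis mset.simps(2) mset_append union_mset_add_mset_right)
  then show ?thesis by simp
qed

lemma nth_delete_nth: "a < b \<Longrightarrow> b < length xs \<Longrightarrow> delete_nth b xs ! a = xs ! a"
  by (simp add: delete_nth_def nth_append)

text \<open>The Leibniz differential puts the bracket in place of its second entry, the symmetric
  one puts it in front. On symmetric functions this difference is invisible.\<close>

lemma mset_delete_update:
  assumes "a < b" "b < length xs"
  shows "mset (delete_nth a (xs[b := z])) = mset (z # delete_nth a (delete_nth b xs))"
proof -
  have a: "a < length xs" "a < length (delete_nth b xs)"
    using assms length_delete_nth[of b xs] by simp_all
  have "xs ! a \<in># mset (delete_nth b xs)"
    using a(2) nth_delete_nth[OF assms] nth_mem by fastforce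
  moreover have "mset (xs[b := z]) = add_mset z (mset (delete_nth b xs))"
    using assms by (simp add: mset_update mset_delete_nth)
  ultimately show ?thesis
    using a assms by (simp add: mset_delete_nth nth_delete_nth)
qed

lemma sum_fun_apply: "(\<Sum>i\<in>A. f i) x = (\<Sum>i\<in>A. f i x)"
  by (induction A rule: infinite_finite_induct) simp_all

lemma delete_nth_append: "i < length xs \<Longrightarrow> delete_nth i (xs @ ys) = delete_nth i xs @ ys"
  by (simp add: delete_nth_def)

locale trivial_coefficients = commutative_lie_algebra sg br + W: vector_space sw
  for sg :: "'k::field \<Rightarrow> 'g::ab_group_add \<Rightarrow> 'g" and br
    and sw :: "'k \<Rightarrow> 'w::ab_group_add \<Rightarrow> 'w" +
  fixes W :: "'w set"
  assumes W_subspace: "W.subspace W"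
begin

sublocale T: coefficient_action sg br sw W "\<lambda>_ _. 0"
  by (rule coefficient_action_trivial[OF commutative_lie_algebra_axioms W.vector_space_axioms W_subspace])

abbreviation D0 :: "('g list \<Rightarrow> 'w) \<Rightarrow> 'g list \<Rightarrow> 'w" where "D0 \<equiv> dCL br (\<lambda>_ _. 0)"
abbreviation S :: "nat \<Rightarrow> int \<Rightarrow> ('g list \<Rightarrow> 'w) set" where "S \<equiv> sym_cochains sg sw W"
abbreviation SR :: "int \<Rightarrow> ('g list \<Rightarrow> 'g \<Rightarrow> 'w) set" where
  "SR \<equiv> CS sg (pointwise sw) (lin_maps sg sw W)"

sublocale D0: Vector_Spaces.linear "pointwise sw" "pointwise sw" "dCL br (\<lambda>_ _. 0)"
  by (rule T.dCL_linear)

lemma vs_pointwise: "vector_space (pointwise sw)" "vector_space (pointwise (pointwise sw))"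
  by (intro vector_space_pointwise W.vector_space_axioms)+

lemma subspace_lin_maps: "Modules.module.subspace (pointwise sw) (lin_maps sg sw W)"
proof -
  interpret P: vector_space "pointwise sw" by (rule vs_pointwise)
  show ?thesis
    using T.N_closed unfolding P.subspace_def lin_maps_def T.linear_iff
    by (simp add: pointwise_def W.scale_right_distrib image_subset_iff algebra_simps)
qed

sublocale R: coefficients sg "pointwise sw" "lin_maps sg sw W"
  by (intro coefficients.intro coefficients_axioms.intro vector_space_axioms vs_pointwise subspace_lin_maps)

lemma subspace_S: "Modules.module.subspace (pointwise sw) (S j n)"
  unfolding sym_cochains_def by (rule T.subspace_sym)

lemma m3_CL:
  assumes g: "g \<in> CL sg sw W (int (Suc j))"
  shows "m3 g \<in> CL sg (pointwise sw) (lin_maps sg sw W) (int j)"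
proof -
  have lin: "Vector_Spaces.linear sg sw (\<lambda>x. g (xs[i := x]))" if "length xs = Suc j" "i < Suc j" for xs i
    using g that by (simp add: CL_def del: of_nat_Suc)
  have z: "g xs = 0" if "length xs \<noteq> Suc j" for xs
    using T.CL_length[OF g] that by simp
  have "m3 g xs \<in> lin_maps sg sw W" for xs
  proof (cases "length xs = j")
    case True
    have "Vector_Spaces.linear sg sw (\<lambda>x. g ((xs @ [0])[j := x]))" using True by (intro lin) auto
    moreover have "(xs @ [0])[j := x] = xs @ [x]" for x using True by (simp add: list_update_append)
    ultimately show ?thesis using T.CL_range[OF g] by (auto simp: lin_maps_def m3_def)
  next
    case False
    then have "m3 g xs = (\<lambda>_. 0)" using z by (simp add: m3_def)
    then show ?thesis using T.N_closed by (auto simp: lin_maps_def T.linear_iff)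
  qed
  moreover have "m3 g xs = 0" if "length xs \<noteq> j" for xs
    using z that by (simp add: m3_def fun_eq_iff)
  moreover have "Vector_Spaces.linear sg (pointwise sw) (\<lambda>x. m3 g (xs[i := x]))"
    if "length xs = j" "i < j" for xs i
  proof -
    have "Vector_Spaces.linear sg sw (\<lambda>x. g ((xs @ [y])[i := x]))" for y
      using that by (intro lin) auto
    then have "Vector_Spaces.linear sg sw (\<lambda>x. g (xs[i := x] @ [y]))" for y
      using that by (simp add: list_update_append1)
    then show ?thesis by (simp add: R.linear_iff T.linear_iff m3_def fun_eq_iff pointwise_def)
  qed
  ultimately show ?thesis by (simp add: CL_def)
qed

text \<open>Inverse to \<open>m3\<close> on cochains of positive degree, which have to vanish on the
  empty list.\<close>

definition m3_inv :: "('g list \<Rightarrow> 'g \<Rightarrow> 'w) \<Rightarrow> 'g list \<Rightarrow> 'w" where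
  "m3_inv h l = (if l = [] then 0 else h (butlast l) (last l))"

lemma m3_m3_inv: "m3 (m3_inv h) = h"
  by (simp add: m3_def m3_inv_def)

lemma m3_inv_CL:
  assumes h: "h \<in> CL sg (pointwise sw) (lin_maps sg sw W) (int j)"
  shows "m3_inv h \<in> CL sg sw W (int (Suc j))"
proof -
  have hl: "h us \<in> lin_maps sg sw W" for us by (rule R.CL_range[OF h])
  have "m3_inv h l \<in> W" for l
    using hl T.N_closed(1) by (auto simp: m3_inv_def lin_maps_def)
  moreover have "m3_inv h l = 0" if l: "length l \<noteq> Suc j" for l
  proof (cases "l = []")
    case False
    then have "length (butlast l) \<noteq> j" using l by (cases l rule: rev_cases) simp_all
    then have "h (butlast l) = 0" by (intro R.CL_length[OF h]) simp
    then show ?thesis by (simp add: m3_inv_def)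
  qed (simp add: m3_inv_def)
  moreover have "Vector_Spaces.linear sg sw (\<lambda>x. m3_inv h (l[i := x]))"
    if l: "length l = Suc j" and i: "i < Suc j" for l i
  proof -
    obtain us y where us: "l = us @ [y]" "length us = j"
      using l by (metis length_Suc_conv_rev)
    show ?thesis
    proof (cases "i = j")
      case True
      then have "m3_inv h (l[i := x]) = h us x" for x
        using us by (simp add: m3_inv_def list_update_append)
      then show ?thesis using hl[of us] by (simp add: lin_maps_def)
    next
      case False
      then have "m3_inv h (l[i := x]) = h (us[i := x]) y" for x
        using us i by (simp add: m3_inv_def list_update_append)
      moreover have "Vector_Spaces.linear sg (pointwise sw) (\<lambda>x. h (us[i := x]))"
        using h us(2) i False by (simp add: CL_def)
      ultimately show ?thesis
        by (simp add: R.linear_iff T.linear_iff fun_eq_iff pointwise_def)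
    qed
  qed
  ultimately show ?thesis by (simp add: CL_def del: of_nat_Suc)
qed

lemma sym_upto_m3:
  fixes g :: "'g list \<Rightarrow> 'w"
  shows "sym_upto j (Suc j) g \<longleftrightarrow> sym_upto j j (m3 g)"
proof
  assume s: "sym_upto j (Suc j) g"
  show "sym_upto j j (m3 g)"
    unfolding sym_upto_def m3_def
  proof (intro allI impI ext)
    fix x y z and vs ws :: "'g list" assume "length vs + 2 \<le> j" "length vs + 2 + length ws = j"
    then show "g ((vs @ x # y # ws) @ [z]) = g ((vs @ y # x # ws) @ [z])"
      using s[unfolded sym_upto_def, rule_format, of vs "ws @ [z]" x y] by simp
  qed
next
  assume s: "sym_upto j j (m3 g)"
  show "sym_upto j (Suc j) g"
    unfolding sym_upto_def
  proof (intro allI impI)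
    fix x y and vs ws :: "'g list"
    assume l: "length vs + 2 \<le> j" "length vs + 2 + length ws = Suc j"
    then have "ws \<noteq> []" by auto
    then obtain us z where ws: "ws = us @ [z]" by (metis append_butlast_last_id)
    have "m3 g (vs @ x # y # us) = m3 g (vs @ y # x # us)"
      using l ws by (intro s[unfolded sym_upto_def, rule_format]) simp_all
    then show "g (vs @ x # y # ws) = g (vs @ y # x # ws)"
      unfolding ws by (simp add: m3_def fun_eq_iff)
  qed
qed

lemma m3_image: "m3 ` S j (int (Suc j)) = SR (int j)"
proof (intro subset_antisym subsetI)
  fix h assume "h \<in> m3 ` S j (int (Suc j))"
  then obtain g where g: "g \<in> S j (int (Suc j))" "h = m3 g" by blast
  then show "h \<in> SR (int j)"
    using m3_CL[of g j] sym_upto_m3[of j g] by (simp add: CS_eq sym_cochains_def del: of_nat_Suc)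
next
  fix h assume h: "h \<in> SR (int j)"
  then have "m3_inv h \<in> S j (int (Suc j))"
    using m3_inv_CL[of h j] sym_upto_m3[of j "m3_inv h"]
    by (simp add: CS_eq sym_cochains_def m3_m3_inv del: of_nat_Suc)
  then show "h \<in> m3 ` S j (int (Suc j))" by (metis m3_m3_inv imageI)
qed

lemma m3_inj:
  assumes "g \<in> CL sg sw W (int (Suc j))" "g' \<in> CL sg sw W (int (Suc j))" "m3 g = m3 g'"
  shows "g = g'"
proof
  fix l show "g l = g' l"
  proof (cases "l = []")
    case True
    then show ?thesis using T.CL_length[OF assms(1)] T.CL_length[OF assms(2)] by simp
  next
    case False
    then show ?thesis using fun_cong[OF fun_cong[OF assms(3)], of "butlast l" "last l"]
      by (simp add: m3_def)
  qed
qed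

lemma m3_linear: "m3 (f + g) = m3 f + m3 g" "m3 (pointwise sw c f) = pointwise (pointwise sw) c (m3 f)"
  by (simp_all add: m3_def fun_eq_iff pointwise_def)

lemma D0_S_full: "g \<in> S n (int n) \<Longrightarrow> D0 g \<in> S (Suc n) (int (Suc n))"
  using sym_upto_dCL_full[of br n g] T.dCL_CL[of g "int n"]
  by (simp add: sym_cochains_def bracket_commute nat_add_distrib add.commute)

text \<open>The brackets of \<open>D0 g\<close> that land in the last argument make up the coadjoint
  action. Those among the other arguments are brought to the front by symmetry.\<close>

lemma dCS_m3:
  assumes g: "g \<in> S j (int (Suc j))"
  shows "dCS br (coad br) (m3 g) = m3 (D0 g)"
proof (intro ext)
  fix xs :: "'g list" and y
  have gC: "g \<in> CL sg sw W (int (Suc j))" using g by (simp add: sym_cochains_def)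
  have gs: "sym_upto j j (m3 g)"
    using g by (simp add: sym_cochains_def sym_upto_m3 del: of_nat_Suc)
  have swap: "g (us @ [z]) = g (vs @ [z])" if "length us = j" "mset us = mset vs" for us vs z
    using fun_cong[OF sym_upto_mset[OF gs that], of z] by (simp add: m3_def)
  show "dCS br (coad br) (m3 g) xs y = m3 (D0 g) xs y"
  proof (cases "length xs = Suc j")
    case True
    have "D0 g (xs @ [y]) =
        (\<Sum>b<length xs. \<Sum>a<b. g (delete_nth a ((xs @ [y])[b := br ((xs @ [y]) ! a) ((xs @ [y]) ! b)]))) +
        (\<Sum>a<length xs. g (delete_nth a ((xs @ [y])[length xs := br ((xs @ [y]) ! a) y])))"
      by (simp add: dCL_def)
    also have "(\<Sum>a<length xs. g (delete_nth a ((xs @ [y])[length xs := br ((xs @ [y]) ! a) y]))) =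
        (\<Sum>a<length xs. coad br (xs ! a) (m3 g (delete_nth a xs)) y)"
      by (intro sum.cong refl)
        (simp add: list_update_append nth_append delete_nth_append coad_def m3_def)
    also have "(\<Sum>b<length xs. \<Sum>a<b. g (delete_nth a ((xs @ [y])[b := br ((xs @ [y]) ! a) ((xs @ [y]) ! b)]))) =
        (\<Sum>b<length xs. \<Sum>a<b. m3 g (br (xs ! a) (xs ! b) # delete_nth a (delete_nth b xs)) y)"
    proof (intro sum.cong refl)
      fix b a assume ab: "b \<in> {..<length xs}" "a \<in> {..<b}"
      let ?z = "br (xs ! a) (xs ! b)"
      have "delete_nth a ((xs @ [y])[b := ?z]) = delete_nth a (xs[b := ?z]) @ [y]"
        using ab by (simp add: list_update_append1 delete_nth_append)
      moreover have "g (delete_nth a (xs[b := ?z]) @ [y]) = g ((?z # delete_nth a (delete_nth b xs)) @ [y])"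
        using ab True length_delete_nth[of a "xs[b := ?z]"]
        by (intro swap mset_delete_update) simp_all
      ultimately show "g (delete_nth a ((xs @ [y])[b := br ((xs @ [y]) ! a) ((xs @ [y]) ! b)])) =
          m3 g (?z # delete_nth a (delete_nth b xs)) y"
        using ab by (simp add: nth_append m3_def)
    qed
    finally show ?thesis
      by (simp add: dCS_def m3_def[of "D0 g"] add.commute sum_fun_apply)
  next
    case False
    have "D0 g (xs @ [y]) = 0"
      using False by (intro T.CL_length[OF T.dCL_CL[OF gC]]) simp
    moreover have "g (l @ [z]) = 0" if "length l \<noteq> j" for l z
      using that by (intro T.CL_length[OF gC]) simp
    then have "dCS br (coad br) (m3 g) xs y = 0"
    proof -
      assume z: "g (l @ [z]) = 0" if "length l \<noteq> j" for l z
      have "g (delete_nth i xs @ [u]) = 0" if "i < length xs" for i u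
        using length_delete_nth[OF that] False by (intro z) simp
      moreover have "g ((v # delete_nth i (delete_nth b xs)) @ [u]) = 0"
        if "b < length xs" "i < b" for i b u v
        using length_delete_nth[OF that(1)] length_delete_nth[of i "delete_nth b xs"] that False
        by (intro z) simp
      ultimately show ?thesis
        by (simp add: dCS_def m3_def coad_def sum_fun_apply)
    qed
    ultimately show ?thesis by (simp add: m3_def)
  qed
qed

end

context trivial_coefficients
begin

abbreviation BM :: "int \<Rightarrow> ('g list \<Rightarrow> 'g \<Rightarrow> 'w) set" where
  "BM n \<equiv> m3 ` CS_bar sg sw W (n + 2)"

abbreviation \<Delta> :: "('g list \<Rightarrow> 'g \<Rightarrow> 'w) \<Rightarrow> 'g list \<Rightarrow> 'g \<Rightarrow> 'w" where
  "\<Delta> \<equiv> dCS br (coad br)"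

sublocale M3: Vector_Spaces.linear "pointwise sw" "pointwise (pointwise sw)" m3
  by (simp add: Vector_Spaces.linear_iff vs_pointwise m3_linear)

lemma dCS_coad_linear: "\<Delta> (f + g) = \<Delta> f + \<Delta> g"
  "\<Delta> (pointwise (pointwise sw) c f) = pointwise (pointwise sw) c (\<Delta> f)"
  by (simp_all add: dCS_def coad_def fun_eq_iff pointwise_def sum_fun_apply sum.distrib
      W.scale_right_distrib W.scale_sum_right)

lemma dCS_coad_zero: "\<Delta> 0 = 0"
  by (simp add: dCS_def coad_def fun_eq_iff sum_fun_apply)

lemma S_CL: "g \<in> S j n \<Longrightarrow> g \<in> CL sg sw W n"
  by (simp add: sym_cochains_def)

lemma S_mono: "g \<in> S j n \<Longrightarrow> i \<le> j \<Longrightarrow> g \<in> S i n"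
  by (auto simp: sym_cochains_def elim: sym_upto_mono)

text \<open>\<open>BM n\<close> lies in \<open>SR (n + 1)\<close>; for \<open>n = j - 1\<close> both
  consist of cochains with \<open>j + 1\<close> arguments, symmetric in all of them and in the first
  \<open>j\<close>, respectively.\<close>

lemma BM_eq: "BM (int j - 1) = m3 ` S (Suc j) (int (Suc j))"
  by (simp add: CS_bar_def CS_eq_sym_cochains nat_add_distrib add.commute)

lemma SR_neg: "n < 0 \<Longrightarrow> SR n = {0}"
  by (auto simp: CS_def R.CL_neg)

lemma BM_neg: "n < - 1 \<Longrightarrow> BM n = {0}"
  by (simp add: CS_bar_def M3.zero)

lemma BM_SR: "BM n \<subseteq> SR (n + 1)"
proof (cases "n < - 1")
  case True
  then show ?thesis by (simp add: BM_neg SR_neg)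
next
  case False
  obtain j where n: "n = int j - 1" using False by (intro that[of "nat (n + 1)"]) simp
  show ?thesis
    using m3_image[of j] S_mono[of _ "Suc j" "int (Suc j)" j] unfolding n BM_eq by auto
qed

lemma subspace_BM: "Modules.module.subspace (pointwise (pointwise sw)) (BM n)"
proof -
  have "Modules.module.subspace (pointwise sw) (CS_bar sg sw W (n + 2))"
    unfolding CS_bar_def using T.subspace_CS M3.vs1.subspace_single_0 by simp
  then show ?thesis by (rule M3.subspace_image)
qed

text \<open>With \<open>j + 1\<close> arguments kept apart the values of \<open>g\<close> are
  cochains of degree 0, which the differential for the zero action kills. Hence \<open>D0 g\<close>
  reduces to the differential in the leading arguments, which gains one symmetric argument.\<close>

lemma D0_S_Suc:
  assumes g: "g \<in> S j (int (Suc j))"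
  shows "D0 g \<in> S (Suc j) (int (Suc (Suc j)))"
proof -
  let ?V = "\<lambda>(g :: 'g list \<Rightarrow> 'w) us zs. g (us @ zs)"
  have gC: "g \<in> CL sg sw W (int j + 1)" using S_CL[OF g] by (simp add: add.commute)
  have gD: "D0 g \<in> CL sg sw W (int (Suc j) + 1)" using T.dCL_CL[OF gC] by (simp add: add.commute)
  have "sym_upto j j (?V g)"
    using T.sym_upto_append_iff[OF gC, of j] g by (simp add: sym_cochains_def nat_add_distrib)
  then have "sym_upto (Suc j) (Suc j) (dCL br (lie_op br (\<lambda>_ _. 0)) (?V g))"
    by (rule sym_upto_dCL_full[OF bracket_commute])
  then have "sym_upto (Suc j) (Suc j) (?V (D0 g))"
  proof (rule sym_upto_cong)
    fix us :: "'g list" assume us: "length us = Suc j"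
    show "dCL br (lie_op br (\<lambda>_ _. 0)) (?V g) us = ?V (D0 g) us"
    proof
      fix zs :: "'g list"
      have "D0 (\<lambda>zs. g (us @ zs)) zs = 0"
      proof (cases zs)
        case (Cons z ys)
        have "g (us @ l) = 0" if "l \<noteq> []" for l
          using us that by (intro T.CL_length[OF gC]) (cases l; simp)
        moreover from this have "g (us @ l[i := v]) = 0" if "i < length l" for l i v
        proof -
          have "l[i := v] \<noteq> []" using that by auto
          then show ?thesis by (rule \<open>\<And>l. l \<noteq> [] \<Longrightarrow> g (us @ l) = 0\<close>)
        qed
        ultimately have "(\<lambda>zs. g (us @ z # zs)) = (\<lambda>_. 0)"
          "\<And>l. lie_op br (\<lambda>_ _. 0) z (\<lambda>zs. g (us @ zs)) l = 0"
          by (simp_all add: lie_op_def)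
        then show ?thesis unfolding Cons dCL_Cons by (simp add: dCL_def)
      qed simp
      then show "dCL br (lie_op br (\<lambda>_ _. 0)) (?V g) us zs = ?V (D0 g) us zs"
        unfolding dCL_append by simp
    qed
  qed
  then have "sym_upto (Suc j) (nat (int (Suc j) + 1)) (D0 g)"
    using T.sym_upto_append_iff[OF gD, of "Suc j"] by simp
  then show ?thesis using gD by (simp add: sym_cochains_def add.commute)
qed

lemma SR_cases:
  assumes "z \<in> SR (n + 1)"
  obtains "z = 0" "n < - 1" | j g where "n = int j - 1" "g \<in> S j (int (Suc j))" "z = m3 g"
proof (cases "n < - 1")
  case True
  then show ?thesis using assms SR_neg[of "n + 1"] that(1) by simp
next
  case False
  obtain j where n: "n = int j - 1" using False by (intro that[of "nat (n + 1)"]) simp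
  then have "z \<in> m3 ` S j (int (Suc j))" unfolding m3_image using assms by simp
  then show ?thesis using n that(2) by blast
qed

lemma dCS_SR: "z \<in> SR (n + 1) \<Longrightarrow> \<Delta> z \<in> SR (n + 1 + 1)"
proof (erule SR_cases)
  assume "z = 0"
  then show "\<Delta> z \<in> SR (n + 1 + 1)"
    using M3.vs2.subspace_0[OF R.subspace_CS] by (simp add: dCS_coad_zero)
next
  fix j g assume *: "n = int j - 1" "g \<in> S j (int (Suc j))" "z = m3 g"
  have "n + 1 + 1 = int (Suc j)" using *(1) by simp
  then show "\<Delta> z \<in> SR (n + 1 + 1)"
    using D0_S_Suc[OF *(2)] unfolding *(3) dCS_m3[OF *(2)] by (simp only: m3_image[symmetric] imageI)
qed

lemma dCS_BM:
  assumes "b \<in> BM n" shows "\<Delta> b \<in> BM (n + 1)"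
proof (cases "n < - 1")
  case True
  then show ?thesis
    using assms M3.vs2.subspace_0[OF subspace_BM, of "n + 1"] BM_neg[of n]
    by (simp only: singleton_iff dCS_coad_zero)
next
  case False
  obtain j where n: "n = int j - 1" using False by (intro that[of "nat (n + 1)"]) simp
  then obtain g where g: "g \<in> S (Suc j) (int (Suc j))" "b = m3 g" using assms BM_eq by blast
  have "\<Delta> b = m3 (D0 g)" unfolding g(2) by (rule dCS_m3[OF S_mono[OF g(1)]]) simp
  moreover have "n + 1 = int (Suc j) - 1" using n by simp
  ultimately show ?thesis using D0_S_full[OF g(1)] BM_eq[of "Suc j"] by (metis imageI)
qed

text \<open>The type of \<open>W\<close> with the zero action is itself a module, to which
  \<open>dCL_dCL\<close> applies.\<close>

lemma D0_D0:
  assumes "CHAR('k) = 2" "g \<in> CL sg sw W n"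
  shows "D0 (D0 g) = 0"
proof -
  interpret lie_module_char_2 sg br sw "\<lambda>_ _. 0"
    by (intro lie_module_char_2.intro lie_module.intro lie_module_axioms.intro
        lie_module_char_2_axioms.intro commutative_lie_algebra_axioms W.vector_space_axioms assms(1))
      (simp_all add: Vector_Spaces.linear_iff W.vector_space_axioms vector_space_axioms)
  have "g \<in> CL sg sw UNIV n" using assms(2) by (auto simp: CL_def split: if_splits)
  then show ?thesis by (rule dCL_dCL)
qed

lemma presents_HR_coeff:
  assumes char_2: "CHAR('k) = 2"
  shows "\<exists>h. presents (pointwise (pointwise sw)) {z \<in> SR (n + 1). \<Delta> z \<in> BM (n + 1)}
     {b + \<Delta> c | b c. b \<in> BM n \<and> c \<in> SR (n - 1 + 1)} (HR_coeff sg br sw W n) h"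
proof -
  let ?s = "pointwise (pointwise sw)"
  have e: "m + 1 + 2 = m + 3" "m + 1 + 1 = m + 2" for m :: int by simp_all
  have "\<exists>h. presents ?s {z \<in> SR (n + 1). \<Delta> z \<in> BM (n + 1)}
     {b + \<Delta> c | b c. b \<in> BM n \<and> c \<in> SR (n - 1 + 1)}
     (cohomology (CR_coeff sg sw W)
       (\<lambda>n. quot_map (space_on ?s (SR (n + 2))) (m3 ` CS_bar sg sw W (n + 3)) \<Delta>) n) h"
  proof (rule presents_cohomology)
    show "presents ?s (SR (n + 1)) (BM n) (CR_coeff sg sw W n)
        (\<lambda>z. BM n +>\<^bsub>space_on ?s (SR (n + 1))\<^esub> z)" for n
      unfolding CR_coeff_def by (rule presents_quot[OF vs_pointwise(2) R.subspace_CS subspace_BM BM_SR])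
    show "\<Delta> (\<Delta> z) \<in> BM (m + 2)" if "z \<in> SR (m + 1)" for z m
    proof -
      have "\<Delta> (\<Delta> z) = 0"
        using that
      proof (rule SR_cases)
        fix j g assume *: "m = int j - 1" "g \<in> S j (int (Suc j))" "z = m3 g"
        show ?thesis
          using D0_S_Suc[OF *(2)] *(2) D0_D0[OF char_2 S_CL[OF *(2)]]
          by (simp add: *(3) dCS_m3 M3.zero del: of_nat_Suc)
      qed (simp add: dCS_coad_zero)
      then show ?thesis using M3.vs2.subspace_0[OF subspace_BM] by (simp only:)
    qed
    show "quot_map (space_on ?s (SR (m + 2))) (m3 ` CS_bar sg sw W (m + 3)) \<Delta>
        (BM m +>\<^bsub>space_on ?s (SR (m + 1))\<^esub> z) = BM (m + 1) +>\<^bsub>space_on ?s (SR (m + 1 + 1))\<^esub> \<Delta> z"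
      if z: "z \<in> SR (m + 1)" for z m
      unfolding e
    proof (rule quot_map_space_on[OF vs_pointwise(2) R.subspace_CS])
      show "Modules.module.subspace ?s (m3 ` CS_bar sg sw W (m + 3))"
        using subspace_BM[of "m + 1"] by (simp add: e)
      show "m3 ` CS_bar sg sw W (m + 3) \<subseteq> SR (m + 2)" using BM_SR[of "m + 1"] by (simp add: e)
      show "\<Delta> z \<in> SR (m + 2)" using dCS_SR[OF z] by (simp add: e)
      show "\<exists>c\<in>m3 ` CS_bar sg sw W (m + 3). \<Delta> (b + z) = c + \<Delta> z" if "b \<in> BM m" for b
        using dCS_BM[OF that] dCS_coad_linear(1) unfolding e by blast
      show "0 \<in> BM m" by (rule M3.vs2.subspace_0[OF subspace_BM])
    qed
  qed (rule dCS_coad_linear dCS_SR BM_SR, assumption?)+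
  then show ?thesis unfolding HR_coeff_def .
qed

text \<open>Symmetry in a single argument is no condition, so that in degree -1 all of
  \<open>SR 0\<close> is divided out; in lower degrees there are no cochains.\<close>

lemma HR_coeff_neg:
  assumes "CHAR('k) = 2" "n < 0"
  shows "vectorspace class_ring (HR_coeff sg br sw W n)"
    "carrier (HR_coeff sg br sw W n) = {\<zero>\<^bsub>HR_coeff sg br sw W n\<^esub>}"
proof -
  obtain h where h: "presents (pointwise (pointwise sw)) {z \<in> SR (n + 1). \<Delta> z \<in> BM (n + 1)}
     {b + \<Delta> c | b c. b \<in> BM n \<and> c \<in> SR (n - 1 + 1)} (HR_coeff sg br sw W n) h"
    using presents_HR_coeff[OF assms(1), of n] by blast
  show "vectorspace class_ring (HR_coeff sg br sw W n)" by (rule presents_vectorspace[OF h])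
  have "SR (n + 1) \<subseteq> BM n"
  proof (cases "n = - 1")
    case True
    have "S 0 1 = S (Suc 0) 1" by (auto simp: sym_cochains_def sym_upto_def)
    then show ?thesis using m3_image[of 0] BM_eq[of 0] True by simp
  next
    case False
    then show ?thesis using assms(2) SR_neg[of "n + 1"] BM_neg[of n] by simp
  qed
  moreover have "b \<in> {b + \<Delta> c | b c. b \<in> BM n \<and> c \<in> SR (n - 1 + 1)}" if "b \<in> BM n" for b
  proof -
    have "b + \<Delta> 0 \<in> {b + \<Delta> c | b c. b \<in> BM n \<and> c \<in> SR (n - 1 + 1)}"
      using that M3.vs2.subspace_0[OF R.subspace_CS] by blast
    then show ?thesis by (simp add: dCS_coad_zero)
  qed
  ultimately show "carrier (HR_coeff sg br sw W n) = {\<zero>\<^bsub>HR_coeff sg br sw W n\<^esub>}"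
    by (intro presents_carrier_zero[OF h]) blast
qed

lemma subspace_rel_cocycles: "Modules.module.subspace (pointwise sw) (rel_cocycles sg br sw W k)"
proof -
  interpret P: vector_space "pointwise sw" by (rule vs_pointwise)
  show ?thesis
    using subspace_S[of k "int (Suc k)"] subspace_S[of "Suc (Suc k)" "int (Suc (Suc k))"]
    unfolding P.subspace_def by (simp add: D0.add D0.scale D0.zero)
qed

text \<open>The presentation is transported along \<open>m3\<close>. Injectivity of
  \<open>m3\<close> on cochains makes it possible to recover the symmetry of \<open>D0 g\<close>
  from \<open>m3 (D0 g)\<close>.\<close>

theorem presents_HR_nonneg:
  assumes "CHAR('k) = 2"
  shows "\<exists>h. presents (pointwise sw) (rel_cocycles sg br sw W (Suc j))
     (rel_coboundaries sg br sw W (Suc j)) (HR_coeff sg br sw W (int j)) h"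
proof -
  let ?k = "Suc j"
  have e: "int j + 1 = int ?k" "int j = int ?k - 1" "int j - 1 + 1 = int j" "int j + 1 = int (Suc ?k) - 1"
    by simp_all
  obtain h where h: "presents (pointwise (pointwise sw)) {z \<in> SR (int j + 1). \<Delta> z \<in> BM (int j + 1)}
     {b + \<Delta> c | b c. b \<in> BM (int j) \<and> c \<in> SR (int j - 1 + 1)} (HR_coeff sg br sw W (int j)) h"
    using presents_HR_coeff[OF assms] by blast
  have B: "BM (int j) = m3 ` S (Suc ?k) (int (Suc ?k))"
    "BM (int j + 1) = m3 ` S (Suc (Suc ?k)) (int (Suc (Suc ?k)))"
    unfolding e(4) by (subst e(2), rule BM_eq) (rule BM_eq)
  have Z: "SR (int j + 1) = m3 ` S ?k (int (Suc ?k))" "SR (int j - 1 + 1) = m3 ` S j (int ?k)"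
    using m3_image[of ?k] m3_image[of j] by (simp_all only: e(1,3))
  have D: "\<Delta> (m3 g) \<in> BM (int j + 1) \<longleftrightarrow> D0 g \<in> S (Suc (Suc ?k)) (int (Suc (Suc ?k)))"
    if g: "g \<in> S ?k (int (Suc ?k))" for g
  proof -
    have "D0 g = g'" if "g' \<in> S (Suc (Suc ?k)) (int (Suc (Suc ?k)))" "m3 (D0 g) = m3 g'" for g'
      by (rule m3_inj[OF S_CL[OF D0_S_Suc[OF g]] S_CL[OF that(1)] that(2)])
    then show ?thesis unfolding dCS_m3[OF g] B by (auto simp: image_iff)
  qed
  have "presents (pointwise sw) (rel_cocycles sg br sw W ?k) (rel_coboundaries sg br sw W ?k)
      (HR_coeff sg br sw W (int j)) (\<lambda>g. h (m3 g))"
  proof (rule presents_pullback[OF h vs_pointwise(1) subspace_rel_cocycles])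
    show "m3 ` rel_cocycles sg br sw W ?k = {z \<in> SR (int j + 1). \<Delta> z \<in> BM (int j + 1)}"
      using D unfolding Z by blast
    fix u assume u: "u \<in> rel_cocycles sg br sw W ?k"
    have uC: "u \<in> CL sg sw W (int (Suc ?k))" using u S_CL by blast
    show "m3 u \<in> {b + \<Delta> c | b c. b \<in> BM (int j) \<and> c \<in> SR (int j - 1 + 1)} \<longleftrightarrow>
        u \<in> rel_coboundaries sg br sw W ?k"
    proof
      assume "m3 u \<in> {b + \<Delta> c | b c. b \<in> BM (int j) \<and> c \<in> SR (int j - 1 + 1)}"
      then obtain b c where b: "b \<in> S (Suc ?k) (int (Suc ?k))" and c: "c \<in> S j (int ?k)"
        and eq: "m3 u = m3 b + \<Delta> (m3 c)" unfolding B Z by blast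
      have "m3 u = m3 (b + D0 c)" unfolding eq dCS_m3[OF c] m3_linear ..
      moreover have "b + D0 c \<in> CL sg sw W (int (Suc ?k))"
        using T.CL_add[OF S_CL[OF b] S_CL[OF D0_S_Suc[OF c]]] by (simp add: plus_fun_def)
      ultimately have "u = b + D0 c" using m3_inj[OF uC] by blast
      then show "u \<in> rel_coboundaries sg br sw W ?k" using b c by auto
    next
      assume "u \<in> rel_coboundaries sg br sw W ?k"
      then obtain b c where b: "b \<in> S (Suc ?k) (int (Suc ?k))" and c: "c \<in> S j (int ?k)"
        and eq: "u = b + D0 c" by auto
      have "m3 u = m3 b + \<Delta> (m3 c)" unfolding eq dCS_m3[OF c] m3_linear ..
      then show "m3 u \<in> {b + \<Delta> c | b c. b \<in> BM (int j) \<and> c \<in> SR (int j - 1 + 1)}"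
        unfolding B Z using b c by blast
    qed
  qed (rule m3_linear)+
  then show ?thesis by blast
qed

end

section \<open>Linear systems with values in a vector space\<close>

lemma exists_functional:
  assumes "vector_space s" "v \<noteq> 0"
  shows "\<exists>\<xi>. Vector_Spaces.linear s (*) \<xi> \<and> \<xi> v = (1 :: 'k::field)"
proof -
  interpret vector_space_pair s "(*) :: 'k \<Rightarrow> 'k \<Rightarrow> 'k"
    using assms(1) vector_space_mult by (simp add: vector_space_pair_def)
  have "vs1.independent {v}" using assms(2) by simp
  from linear_independent_extend[OF this, of "\<lambda>_. 1"] show ?thesis by auto
qed

text \<open>\<open>\<Theta>\<close> is prescribed on a maximal independent set of left-hand sides.
  If a further equation failed, some functional \<open>\<xi>\<close> would separate its two sides.
  The scalar solution belonging to \<open>\<xi>\<close> agrees with the composite of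
  \<open>\<xi>\<close> and \<open>\<Theta>\<close> on the independent set, hence on all left-hand
  sides, which is a contradiction.\<close>

lemma linear_system_solvable:
  fixes sT :: "'k::field \<Rightarrow> 't::ab_group_add \<Rightarrow> 't" and sw :: "'k \<Rightarrow> 'w::ab_group_add \<Rightarrow> 'w"
  assumes sT: "vector_space sT" and sw: "vector_space sw" and W: "Modules.module.subspace sw W"
    and E: "\<And>t w. (t, w) \<in> E \<Longrightarrow> w \<in> W"
    and sol: "\<And>\<xi>. Vector_Spaces.linear sw (*) \<xi> \<Longrightarrow>
      \<exists>\<theta>. Vector_Spaces.linear sT (*) \<theta> \<and> (\<forall>(t, w)\<in>E. \<theta> t = \<xi> w)"
  shows "\<exists>\<Theta>. Vector_Spaces.linear sT sw \<Theta> \<and> range \<Theta> \<subseteq> W \<and> (\<forall>(t, w)\<in>E. \<Theta> t = w)"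
proof -
  interpret TW: vector_space_pair sT sw using sT sw by (simp add: vector_space_pair_def)
  obtain B where B: "B \<subseteq> fst ` E" "TW.vs1.independent B" "fst ` E \<subseteq> TW.vs1.span B"
    using TW.vs1.maximal_independent_subset by blast
  define r where "r b = (SOME w. (b, w) \<in> E)" for b
  have r: "(b, r b) \<in> E" if "b \<in> B" for b
  proof -
    have "\<exists>w. (b, w) \<in> E" using B(1) that by force
    then show ?thesis unfolding r_def by (rule someI_ex)
  qed
  obtain \<Theta> where \<Theta>: "Vector_Spaces.linear sT sw \<Theta>" "\<forall>b\<in>B. \<Theta> b = r b"
    "range \<Theta> = TW.vs2.span (r ` B)"
    using TW.linear_independent_extend_subspace[OF B(2), of r] by auto
  have "r ` B \<subseteq> W" using r E by blast
  then have "range \<Theta> \<subseteq> W" unfolding \<Theta>(3) using W by (rule TW.vs2.span_minimal)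
  moreover have "\<Theta> t = w" if tw: "(t, w) \<in> E" for t w
  proof (rule ccontr)
    assume "\<Theta> t \<noteq> w"
    then obtain \<xi> where \<xi>: "Vector_Spaces.linear sw (*) \<xi>" "\<xi> (\<Theta> t - w) = (1 :: 'k)"
      using exists_functional[OF sw, of "\<Theta> t - w"] by auto
    interpret \<xi>: Vector_Spaces.linear sw "(*)" \<xi> by (rule \<xi>(1))
    obtain \<theta> where \<theta>: "Vector_Spaces.linear sT (*) \<theta>" "\<forall>(t, w)\<in>E. \<theta> t = \<xi> w"
      using sol[OF \<xi>(1)] by blast
    interpret TK: vector_space_pair sT "(*) :: 'k \<Rightarrow> 'k \<Rightarrow> 'k"
      using sT vector_space_mult by (simp add: vector_space_pair_def)
    have "Vector_Spaces.linear sT (*) (\<lambda>x. \<xi> (\<Theta> x))"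
      using Vector_Spaces.linear_compose[OF \<Theta>(1) \<xi>(1)] by (simp add: comp_def)
    moreover have "t \<in> TW.vs1.span B" using B(3) tw by force
    moreover have "\<xi> (\<Theta> b) = \<theta> b" if "b \<in> B" for b
      using \<Theta>(2) \<theta>(2) r[OF that] that by auto
    ultimately have "\<xi> (\<Theta> t) = \<theta> t" using TK.linear_eq_on[OF _ \<theta>(1)] by blast
    then show False using \<theta>(2) tw \<xi>(2) by (auto simp: \<xi>.diff)
  qed
  ultimately show ?thesis using \<Theta>(1) by blast
qed

lemma independent_unit_vec:
  "\<not> Modules.module.dependent (pointwise (*)) (range (unit_vec :: 'a \<Rightarrow> 'a \<Rightarrow> 'k::field))"
proof -
  interpret P: vector_space "pointwise ((*) :: 'k \<Rightarrow> 'k \<Rightarrow> 'k) :: 'k \<Rightarrow> ('a \<Rightarrow> 'k) \<Rightarrow> ('a \<Rightarrow> 'k)"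
    by (rule vector_space_pointwise[OF vector_space_mult])
  show ?thesis
  proof
    assume "P.dependent (range unit_vec)"
    then obtain z where z: "unit_vec z \<in> P.span (range unit_vec - {unit_vec z})"
      unfolding P.dependent_def by blast
    have "P.subspace {f. f z = 0}" by (simp add: P.subspace_def pointwise_def)
    moreover have "range unit_vec - {unit_vec z} \<subseteq> {f. f z = 0}"
      by (auto simp: unit_vec_def)
    ultimately have "unit_vec z \<in> {f. f z = (0::'k)}" using z P.span_minimal by blast
    then show False by (simp add: unit_vec_def)
  qed
qed

text \<open>The domain consists of all functions, so the unit vectors are merely independent;
  outside their span the map is arbitrary.\<close>

lemma unit_vec_extend:
  fixes s :: "'k::field \<Rightarrow> 'v::ab_group_add \<Rightarrow> 'v"
  assumes "vector_space s"
  shows "\<exists>\<theta>. Vector_Spaces.linear (pointwise (*)) s \<theta> \<and> (\<forall>a. \<theta> (unit_vec a) = val a)"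
proof -
  interpret vector_space_pair "pointwise ((*) :: 'k \<Rightarrow> 'k \<Rightarrow> 'k) :: 'k \<Rightarrow> ('a \<Rightarrow> 'k) \<Rightarrow> ('a \<Rightarrow> 'k)" s
    using assms vector_space_pointwise[OF vector_space_mult] by (simp add: vector_space_pair_def)
  have inj: "inj (unit_vec :: 'a \<Rightarrow> 'a \<Rightarrow> 'k)"
    by (rule injI) (metis unit_vec_def zero_neq_one)
  from linear_independent_extend[OF independent_unit_vec, of "\<lambda>f. val (the_inv unit_vec f)"]
  show ?thesis by (simp add: the_inv_f_f[OF inj])
qed

section \<open>Scalar components of cochains with values in \<open>W\<close>\<close>

context trivial_coefficients
begin

lemma trivial_coefficients_field: "trivial_coefficients sg br (*) UNIV"
proof -
  interpret K: vector_space "(*) :: 'k \<Rightarrow> 'k \<Rightarrow> 'k" by (rule vector_space_mult)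
  show ?thesis
    by (intro trivial_coefficients.intro trivial_coefficients_axioms.intro
        commutative_lie_algebra_axioms vector_space_mult K.subspace_UNIV)
qed

sublocale k: trivial_coefficients sg br "(*) :: 'k \<Rightarrow> 'k \<Rightarrow> 'k" UNIV
  by (rule trivial_coefficients_field)

lemma S_comp:
  assumes "Vector_Spaces.linear sw (*) \<xi>" "f \<in> S j n"
  shows "(\<lambda>l. \<xi> (f l)) \<in> k.S j n"
  using assms(2) CL_comp[OF _ assms(1), of f sg W n UNIV]
  by (auto simp: sym_cochains_def intro: sym_upto_comp)

lemma D0_comp:
  assumes "Vector_Spaces.linear sw (*) \<xi>"
  shows "k.D0 (\<lambda>l. \<xi> (f l)) xs = \<xi> (D0 f xs)"
proof -
  interpret \<xi>: Vector_Spaces.linear sw "(*)" \<xi> by fact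
  show ?thesis using dCL_trivial_comp[of \<xi> br f xs] \<xi>.add \<xi>.zero by simp
qed

lemma rel_cocycles_comp:
  assumes "Vector_Spaces.linear sw (*) \<xi>" "f \<in> rel_cocycles sg br sw W k"
  shows "(\<lambda>l. \<xi> (f l)) \<in> rel_cocycles sg br (*) UNIV k"
proof -
  have "k.D0 (\<lambda>l. \<xi> (f l)) = (\<lambda>l. \<xi> (D0 f l))" by (rule ext) (rule D0_comp[OF assms(1)])
  then show ?thesis using assms(2) S_comp[OF assms(1)] by auto
qed

lemma rel_coboundaries_comp:
  assumes \<xi>: "Vector_Spaces.linear sw (*) \<xi>" and "f \<in> rel_coboundaries sg br sw W k"
  shows "(\<lambda>l. \<xi> (f l)) \<in> rel_coboundaries sg br (*) UNIV k"
proof -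
  interpret \<xi>: Vector_Spaces.linear sw "(*)" \<xi> by fact
  obtain b g where f: "f = b + D0 g" and b: "b \<in> S (Suc k) (int (Suc k))" and g: "g \<in> S (k - 1) (int k)"
    using assms(2) by blast
  have "(\<lambda>l. \<xi> (f l)) = (\<lambda>l. \<xi> (b l)) + k.D0 (\<lambda>l. \<xi> (g l))"
    by (rule ext) (simp add: f \<xi>.add D0_comp[OF \<xi>])
  then show ?thesis using S_comp[OF \<xi> b] S_comp[OF \<xi> g] by blast
qed

lemma linear_scale_left: "Vector_Spaces.linear (*) sw (\<lambda>a. sw a w)"
  by (simp add: Vector_Spaces.linear_iff vector_space_mult W.vector_space_axioms W.scale_left_distrib)

lemma S_scale:
  assumes "z \<in> k.S j n" "w \<in> W"
  shows "(\<lambda>l. sw (z l) w) \<in> S j n"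
proof -
  have "(\<lambda>l. sw (z l) w) \<in> CL sg sw W n"
    by (rule CL_comp[OF k.S_CL[OF assms(1)] linear_scale_left]) (rule T.N_closed(3)[OF assms(2)])
  moreover have "sym_upto j (nat n) (\<lambda>l. sw (z l) w)"
    using assms(1) sym_upto_comp[of j "nat n" z "\<lambda>a. sw a w"] by (simp add: sym_cochains_def)
  ultimately show ?thesis by (simp add: sym_cochains_def)
qed

lemma D0_scale_left: "D0 (\<lambda>l. sw (z l) w) xs = sw (k.D0 z xs) w"
  using dCL_trivial_comp[of "\<lambda>a. sw a w" br z xs] by (simp add: W.scale_left_distrib)

lemma rel_cocycles_scale:
  assumes "z \<in> rel_cocycles sg br (*) UNIV k" "w \<in> W"
  shows "(\<lambda>l. sw (z l) w) \<in> rel_cocycles sg br sw W k"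
proof -
  have "D0 (\<lambda>l. sw (z l) w) = (\<lambda>l. sw (k.D0 z l) w)" by (rule ext) (rule D0_scale_left)
  then show ?thesis using assms S_scale by auto
qed

lemma rel_coboundaries_scale:
  assumes "z \<in> rel_coboundaries sg br (*) UNIV k" and w: "w \<in> W"
  shows "(\<lambda>l. sw (z l) w) \<in> rel_coboundaries sg br sw W k"
proof -
  obtain b g where z: "z = b + k.D0 g" and b: "b \<in> k.S (Suc k) (int (Suc k))" and g: "g \<in> k.S (k - 1) (int k)"
    using assms(1) by blast
  have "(\<lambda>l. sw (z l) w) = (\<lambda>l. sw (b l) w) + D0 (\<lambda>l. sw (g l) w)"
    by (rule ext) (simp add: z W.scale_left_distrib D0_scale_left)
  then show ?thesis using S_scale[OF b w] S_scale[OF g w] by blast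
qed

text \<open>
  That \<open>g\<close> is cohomologous to a sum of terms \<open>z\<^sub>i \<otimes> w\<^sub>i\<close> is a linear system for the \<open>w\<^sub>i\<close> and for a
  cochain. By assumption it can be solved after applying any functional to \<open>g\<close>, hence it can be
  solved in \<open>W\<close>.
\<close>

lemma rel_cocycle_decomposition:
  fixes z :: "nat \<Rightarrow> 'g list \<Rightarrow> 'k"
  assumes z: "\<And>i. i < n \<Longrightarrow> z i \<in> rel_cocycles sg br (*) UNIV (Suc j)"
    and gen: "\<And>f. f \<in> rel_cocycles sg br (*) UNIV (Suc j) \<Longrightarrow>
      \<exists>c. f - (\<Sum>i<n. pointwise (*) (c i) (z i)) \<in> rel_coboundaries sg br (*) UNIV (Suc j)"
    and g: "g \<in> rel_cocycles sg br sw W (Suc j)"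
  shows "\<exists>w. (\<forall>i<n. w i \<in> W) \<and>
    g - (\<Sum>i<n. (\<lambda>l. sw (z i l) (w i))) \<in> rel_coboundaries sg br sw W (Suc j)"
proof -
  let ?k = "Suc j"
  let ?sT = "pointwise ((*) :: 'k \<Rightarrow> 'k \<Rightarrow> 'k) :: 'k \<Rightarrow> ('g list + nat \<Rightarrow> 'k) \<Rightarrow> ('g list + nat \<Rightarrow> 'k)"
  interpret T': vector_space ?sT by (rule vector_space_pointwise[OF vector_space_mult])
  \<comment> \<open>The unknowns are the values of a cochain \<open>g'\<close> on lists of length
    \<open>?k\<close>, indexed by \<open>Inl\<close>, and the vectors \<open>w i\<close>, indexed by
    \<open>Inr\<close>. On lists of another length \<open>u\<close> is 0, as \<open>g'\<close> has
    to be.\<close>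
  define u :: "'g list \<Rightarrow> 'g list + nat \<Rightarrow> 'k" where
    "u l = (if length l = ?k then unit_vec (Inl l) else 0)" for l
  define e :: "nat \<Rightarrow> 'g list + nat \<Rightarrow> 'k" where "e i = unit_vec (Inr i)" for i
  \<comment> \<open>The symbolic form of \<open>D0 g'\<close> plus the sum of the pure tensors of
    \<open>z i\<close> and \<open>w i\<close>.\<close>
  define q where "q l = dCL br (\<lambda>_ _. 0) u l + (\<Sum>i<n. ?sT (z i l) (e i))" for l
  \<comment> \<open>\<open>E1\<close> and \<open>E2\<close> express that \<open>g'\<close> is
    multilinear, \<open>E3\<close> that it is symmetric in \<open>j\<close> arguments, and
    \<open>E4\<close> that the remainder \<open>b\<close>, which is \<open>g\<close> minus the
    quantity encoded by \<open>q\<close>, is symmetric in all of them.\<close>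
  define E1 where "E1 = {(u (xs[i := x + y]) - u (xs[i := x]) - u (xs[i := y]), 0 :: 'w) | xs i x y.
      length xs = ?k \<and> i < ?k}"
  define E2 where "E2 = {(u (xs[i := sg c x]) - ?sT c (u (xs[i := x])), 0 :: 'w) | xs i c x.
      length xs = ?k \<and> i < ?k}"
  define E3 where "E3 = {(u (vs @ x # y # ws) - u (vs @ y # x # ws), 0 :: 'w) | vs x y ws.
      length vs + 2 \<le> j \<and> length vs + 2 + length ws = ?k}"
  define E4 where "E4 = {(q (vs @ x # y # ws) - q (vs @ y # x # ws),
      g (vs @ x # y # ws) - g (vs @ y # x # ws)) | vs x y ws.
      length vs + 2 \<le> Suc ?k \<and> length vs + 2 + length ws = Suc ?k}"
  define E where "E = E1 \<union> E2 \<union> E3 \<union> E4"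
  have gS: "g \<in> S ?k (int (Suc ?k))" using g by blast
  have gW: "g l \<in> W" for l by (rule T.CL_range[OF S_CL[OF gS]])
  have \<theta>q: "\<theta> (q l) = dCL br (\<lambda>_ _. 0) (\<lambda>l. \<theta> (u l)) l + (\<Sum>i<n. s (z i l) (\<theta> (e i)))"
    if "Vector_Spaces.linear ?sT s \<theta>" for s :: "'k \<Rightarrow> 'x::ab_group_add \<Rightarrow> 'x" and \<theta> l
  proof -
    interpret \<theta>: Vector_Spaces.linear ?sT s \<theta> by fact
    show ?thesis
      using dCL_trivial_comp[of \<theta> br u l] by (simp add: q_def \<theta>.add \<theta>.zero \<theta>.sum \<theta>.scale)
  qed
  have "\<exists>\<Theta>. Vector_Spaces.linear ?sT sw \<Theta> \<and> range \<Theta> \<subseteq> W \<and> (\<forall>(t, w)\<in>E. \<Theta> t = w)"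
  proof (rule linear_system_solvable[OF T'.vector_space_axioms W.vector_space_axioms W_subspace])
    show "w \<in> W" if "(t, w) \<in> E" for t w
    proof -
      have "w = 0 \<or> (\<exists>l l'. w = g l - g l')" using that unfolding E_def E1_def E2_def E3_def E4_def by blast
      then show ?thesis using gW T.N_closed(1) W.subspace_diff[OF W_subspace] by auto
    qed
    fix \<xi> assume \<xi>: "Vector_Spaces.linear sw ((*) :: 'k \<Rightarrow> 'k \<Rightarrow> 'k) \<xi>"
    interpret \<xi>: Vector_Spaces.linear sw "(*)" \<xi> by (rule \<xi>)
    obtain c where "(\<lambda>l. \<xi> (g l)) - (\<Sum>i<n. pointwise (*) (c i) (z i)) \<in> rel_coboundaries sg br (*) UNIV ?k"
      using gen[OF rel_cocycles_comp[OF \<xi> g]] by blast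
    then obtain b g' where b: "b \<in> k.S (Suc ?k) (int (Suc ?k))" and g': "g' \<in> k.S j (int ?k)"
      and eq: "(\<lambda>l. \<xi> (g l)) - (\<Sum>i<n. pointwise (*) (c i) (z i)) = b + k.D0 g'" by auto
    obtain \<theta> where \<theta>: "Vector_Spaces.linear ?sT (*) \<theta>"
      "\<And>a. \<theta> (unit_vec a) = (case a of Inl l \<Rightarrow> g' l | Inr i \<Rightarrow> c i)"
      using unit_vec_extend[OF vector_space_mult, of "\<lambda>a. case a of Inl l \<Rightarrow> g' l | Inr i \<Rightarrow> c i"] by blast
    interpret \<theta>: Vector_Spaces.linear ?sT "(*)" \<theta> by (rule \<theta>(1))
    have g'C: "g' \<in> CL sg (*) UNIV (int ?k)" and g's: "sym_upto j ?k g'"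
      using g' by (simp_all add: sym_cochains_def del: of_nat_Suc)
    have \<theta>u: "\<theta> (u l) = g' l" for l
      using k.T.CL_length[OF g'C, of l] by (simp add: u_def \<theta>(2) \<theta>.zero)
    have g'lin: "g' (xs[i := x + y]) = g' (xs[i := x]) + g' (xs[i := y])"
      "g' (xs[i := sg a x]) = a * g' (xs[i := x])" if "length xs = ?k" "i < ?k" for xs i x y a
      using g'C that by (simp_all add: CL_def k.T.linear_iff del: of_nat_Suc)
    have \<theta>q': "\<theta> (q l) = \<xi> (g l) - b l" for l
      using fun_cong[OF eq, of l]
      by (simp add: \<theta>q[OF \<theta>(1)] \<theta>u e_def \<theta>(2) sum_fun_apply pointwise_def mult.commute algebra_simps)
    have bs: "b (vs @ x # y # ws) = b (vs @ y # x # ws)"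
      if "length vs + 2 \<le> Suc ?k" "length vs + 2 + length ws = Suc ?k" for vs x y ws
      using b that by (simp add: sym_cochains_def sym_upto_def nat_add_distrib)
    have "\<theta> t = \<xi> w" if "(t, w) \<in> E" for t w
      using that unfolding E_def
    proof (elim UnE)
      assume "(t, w) \<in> E1"
      then show ?thesis using g'lin(1) by (auto simp: E1_def \<theta>.diff \<theta>u \<xi>.zero)
    next
      assume "(t, w) \<in> E2"
      then show ?thesis using g'lin(2) by (auto simp: E2_def \<theta>.diff \<theta>.scale \<theta>u \<xi>.zero)
    next
      assume "(t, w) \<in> E3"
      then show ?thesis using g's unfolding sym_upto_def by (auto simp: E3_def \<theta>.diff \<theta>u \<xi>.zero)
    next
      assume "(t, w) \<in> E4"
      then show ?thesis using bs by (auto simp: E4_def \<theta>.diff \<xi>.diff \<theta>q')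
    qed
    then show "\<exists>\<theta>. Vector_Spaces.linear ?sT (*) \<theta> \<and> (\<forall>(t, w)\<in>E. \<theta> t = \<xi> w)"
      using \<theta>(1) by blast
  qed
  then obtain \<Theta> where \<Theta>: "Vector_Spaces.linear ?sT sw \<Theta>" "range \<Theta> \<subseteq> W"
    and \<Theta>E: "\<forall>(t, w)\<in>E. \<Theta> t = w" by (elim exE conjE)
  have \<Theta>E': "\<Theta> t = w" if "(t, w) \<in> E" for t w
    using bspec[OF \<Theta>E that] by simp
  interpret \<Theta>: Vector_Spaces.linear ?sT sw \<Theta> by (rule \<Theta>(1))
  define g' where "g' l = \<Theta> (u l)" for l
  define w where "w i = \<Theta> (e i)" for i
  have wW: "w i \<in> W" for i using \<Theta>(2) by (auto simp: w_def)
  have "g' (xs[i := x + y]) = g' (xs[i := x]) + g' (xs[i := y])"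
    if "length xs = ?k" "i < ?k" for xs i x y
  proof -
    have "\<Theta> (u (xs[i := x + y]) - u (xs[i := x]) - u (xs[i := y])) = 0"
      by (rule \<Theta>E', unfold E_def E1_def, rule UnI1, rule UnI1, rule UnI1, intro CollectI exI conjI, rule refl) (use that in simp_all)
    then have "g' (xs[i := x + y]) - g' (xs[i := x]) - g' (xs[i := y]) = 0"
      by (simp only: \<Theta>.diff g'_def)
    then show ?thesis by (simp only: diff_diff_eq right_minus_eq)
  qed
  moreover have "g' (xs[i := sg a x]) = sw a (g' (xs[i := x]))"
    if "length xs = ?k" "i < ?k" for xs i x a
  proof -
    have "\<Theta> (u (xs[i := sg a x]) - ?sT a (u (xs[i := x]))) = 0"
      by (rule \<Theta>E', unfold E_def E2_def, rule UnI1, rule UnI1, rule UnI2, intro CollectI exI conjI, rule refl) (use that in simp_all)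
    then show ?thesis by (simp add: g'_def \<Theta>.diff \<Theta>.scale)
  qed
  moreover have "g' l \<in> W" for l using \<Theta>(2) by (auto simp: g'_def)
  moreover have "g' l = 0" if "length l \<noteq> ?k" for l using that by (simp add: g'_def u_def \<Theta>.zero)
  ultimately have "g' \<in> CL sg sw W (int ?k)" by (simp add: CL_def T.linear_iff del: of_nat_Suc)
  moreover have "sym_upto j ?k g'"
    unfolding sym_upto_def
  proof (intro allI impI)
    fix x y and vs ws :: "'g list" assume "length vs + 2 \<le> j" "length vs + 2 + length ws = ?k"
    then have "\<Theta> (u (vs @ x # y # ws) - u (vs @ y # x # ws)) = 0"
      by - (rule \<Theta>E', unfold E_def E3_def, rule UnI1, rule UnI2, intro CollectI exI conjI, rule refl, assumption+)
    then show "g' (vs @ x # y # ws) = g' (vs @ y # x # ws)" by (simp add: g'_def \<Theta>.diff)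
  qed
  ultimately have g'S: "g' \<in> S j (int ?k)" by (simp add: sym_cochains_def del: of_nat_Suc)
  have qeq: "\<Theta> (q l) = D0 g' l + (\<Sum>i<n. sw (z i l) (w i))" for l
    unfolding \<theta>q[OF \<Theta>(1)] by (simp add: g'_def[abs_def] w_def)
  define b where "b = g - (\<Sum>i<n. (\<lambda>l. sw (z i l) (w i))) - D0 g'"
  have b_eq: "b l = g l - \<Theta> (q l)" for l
    by (simp add: b_def qeq sum_fun_apply algebra_simps)
  have "sym_upto (Suc ?k) (Suc ?k) b"
    unfolding sym_upto_def
  proof (intro allI impI)
    fix x y and vs ws :: "'g list" assume "length vs + 2 \<le> Suc ?k" "length vs + 2 + length ws = Suc ?k"
    then have "\<Theta> (q (vs @ x # y # ws) - q (vs @ y # x # ws)) = g (vs @ x # y # ws) - g (vs @ y # x # ws)"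
      by - (rule \<Theta>E', unfold E_def E4_def, rule UnI2, intro CollectI exI conjI, rule refl, assumption+)
    then show "b (vs @ x # y # ws) = b (vs @ y # x # ws)"
      unfolding b_eq by (simp add: \<Theta>.diff algebra_simps)
  qed
  moreover have "b \<in> CL sg sw W (int (Suc ?k))"
  proof -
    have "(\<lambda>l. sw (z i l) (w i)) \<in> CL sg sw W (int (Suc ?k))" if "i < n" for i
      using S_CL[OF S_scale[OF _ wW]] z[OF that] by blast
    then show ?thesis
      unfolding b_def
      by (intro M3.vs1.subspace_diff[OF T.subspace_CL] M3.vs1.subspace_sum[OF T.subspace_CL]
          S_CL[OF gS] S_CL[OF D0_S_Suc[OF g'S]]) simp
  qed
  ultimately have bS: "b \<in> S (Suc ?k) (int (Suc ?k))" by (simp add: sym_cochains_def del: of_nat_Suc)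
  have "g - (\<Sum>i<n. (\<lambda>l. sw (z i l) (w i))) = b + D0 g'" by (simp add: b_def)
  then have "g - (\<Sum>i<n. (\<lambda>l. sw (z i l) (w i))) \<in> rel_coboundaries sg br sw W ?k"
    using bS g'S by auto
  then show ?thesis using wW by blast
qed

end

section \<open>Tensor products\<close>

lemma fin_dim_presents:
  assumes P: "presents s Z B X f" and fd: "vectorspace.fin_dim class_ring X"
  shows "\<exists>S. finite S \<and> S \<subseteq> Z \<and> (\<forall>z\<in>Z. \<exists>u\<in>Modules.module.span s S. z - u \<in> B)"
proof -
  interpret vector_space s using P by (rule presents_vector_space)
  interpret X: vectorspace class_ring X using P by (rule presents_vectorspace)
  obtain A where A: "finite A" "A \<subseteq> carrier X" "X.span A = carrier X"
    using fd unfolding X.fin_dim_def by blast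
  have "\<forall>a\<in>A. \<exists>z\<in>Z. f z = a" using A(2) unfolding presents_image[OF P, symmetric] by blast
  then obtain r where r: "\<forall>a\<in>A. r a \<in> Z \<and> f (r a) = a" by metis
  have sub: "r ` A \<subseteq> Z" using r by blast
  have span: "span (r ` A) \<subseteq> Z" by (rule span_minimal[OF sub presents_subspace[OF P]])
  have "VectorSpace.subspace class_ring (f ` span (r ` A)) X"
    by (rule presents_subspace_image[OF P subspace_span span])
  then have "submodule class_ring (f ` span (r ` A)) X" by (simp add: VectorSpace.subspace_def)
  moreover have "A \<subseteq> f ` span (r ` A)"
  proof
    fix a assume a: "a \<in> A"
    then have "f (r a) \<in> f ` span (r ` A)" by (intro imageI span_base)
    then show "a \<in> f ` span (r ` A)" using r a by simp
  qed
  ultimately have "carrier X \<subseteq> f ` span (r ` A)" using X.span_is_subset A(3) by metis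
  then have "\<exists>u\<in>span (r ` A). z - u \<in> B" if z: "z \<in> Z" for z
  proof -
    obtain u where u: "u \<in> span (r ` A)" "f z = f u"
      using \<open>carrier X \<subseteq> f ` span (r ` A)\<close> presents_in[OF P z] by blast
    then show ?thesis using presents_eq_iff[OF P z subsetD[OF span u(1)]] by blast
  qed
  then show ?thesis using A(1) sub by blast
qed

section \<open>Free vector spaces and the tensor relations\<close>

lemma vector_space_functions:
  "vector_space (pointwise ((*) :: 'k::field \<Rightarrow> 'k \<Rightarrow> 'k) :: 'k \<Rightarrow> ('a \<Rightarrow> 'k) \<Rightarrow> ('a \<Rightarrow> 'k))"
  by (rule vector_space_pointwise[OF vector_space_mult])

lemma subspace_free_vs:
  "Modules.module.subspace (pointwise (*)) (free_vs A :: ('a \<Rightarrow> 'k::field) set)"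
proof -
  interpret T: vector_space "pointwise ((*) :: 'k \<Rightarrow> 'k \<Rightarrow> 'k) :: 'k \<Rightarrow> ('a \<Rightarrow> 'k) \<Rightarrow> ('a \<Rightarrow> 'k)"
    by (rule vector_space_functions)
  show ?thesis
    unfolding T.subspace_def free_vs_def
  proof (intro conjI ballI allI)
    fix x y :: "'a \<Rightarrow> 'k" assume "x \<in> {\<phi>. finite {z. \<phi> z \<noteq> 0} \<and> {z. \<phi> z \<noteq> 0} \<subseteq> A}"
      "y \<in> {\<phi>. finite {z. \<phi> z \<noteq> 0} \<and> {z. \<phi> z \<noteq> 0} \<subseteq> A}"
    moreover have "{z. (x + y) z \<noteq> 0} \<subseteq> {z. x z \<noteq> 0} \<union> {z. y z \<noteq> 0}" by auto
    ultimately show "x + y \<in> {\<phi>. finite {z. \<phi> z \<noteq> 0} \<and> {z. \<phi> z \<noteq> 0} \<subseteq> A}"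
      by (auto dest: finite_subset)
  qed (auto simp: pointwise_def)
qed

lemma unit_vec_free: "a \<in> A \<Longrightarrow> unit_vec a \<in> free_vs A"
  by (auto simp: free_vs_def unit_vec_def)

lemma free_vs_span:
  assumes "\<phi> \<in> (free_vs A :: ('a \<Rightarrow> 'k::field) set)"
  shows "\<phi> \<in> Modules.module.span (pointwise (*)) (unit_vec ` A)"
proof -
  interpret T: vector_space "pointwise ((*) :: 'k \<Rightarrow> 'k \<Rightarrow> 'k) :: 'k \<Rightarrow> ('a \<Rightarrow> 'k) \<Rightarrow> ('a \<Rightarrow> 'k)"
    by (rule vector_space_functions)
  let ?F = "{z. \<phi> z \<noteq> 0}"
  have F: "finite ?F" "?F \<subseteq> A" using assms by (auto simp: free_vs_def)
  have "\<phi> = (\<Sum>p\<in>?F. pointwise (*) (\<phi> p) (unit_vec p))"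
  proof
    fix z
    have "(\<Sum>p\<in>?F. pointwise (*) (\<phi> p) (unit_vec p)) z = (\<Sum>p\<in>?F. if p = z then \<phi> p else 0)"
      unfolding sum_fun_apply by (intro sum.cong) (auto simp: pointwise_def unit_vec_def)
    also have "\<dots> = \<phi> z" using F(1) by (simp add: sum.delta')
    finally show "\<phi> z = (\<Sum>p\<in>?F. pointwise (*) (\<phi> p) (unit_vec p)) z" by simp
  qed
  moreover have "(\<Sum>p\<in>?F. pointwise (*) (\<phi> p) (unit_vec p)) \<in> T.span (unit_vec ` A)"
    using F(2) by (intro T.span_sum T.span_scale T.span_base) auto
  ultimately show ?thesis by simp
qed

lemma presents_tensor:
  fixes V :: "('k::field, 'v) module" and Y :: "('k, 'y) module"
  assumes "vectorspace class_ring V" "vectorspace class_ring Y"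
  shows "presents (pointwise (*)) (free_vs (carrier V \<times> carrier Y))
    (Modules.module.span (pointwise (*)) (tensor_rels V Y)) (tensor V Y)
    (\<lambda>\<phi>. Modules.module.span (pointwise (*)) (tensor_rels V Y)
       +>\<^bsub>space_on (pointwise (*)) (free_vs (carrier V \<times> carrier Y))\<^esub> \<phi>)"
proof -
  interpret V: vectorspace class_ring V by fact
  interpret Y: vectorspace class_ring Y by fact
  interpret T: vector_space "pointwise ((*) :: 'k \<Rightarrow> 'k \<Rightarrow> 'k) ::
      'k \<Rightarrow> ('v \<times> 'y \<Rightarrow> 'k) \<Rightarrow> ('v \<times> 'y \<Rightarrow> 'k)"
    by (rule vector_space_functions)
  let ?F = "free_vs (carrier V \<times> carrier Y) :: ('v \<times> 'y \<Rightarrow> 'k) set"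
  have s: "c \<odot>\<^bsub>V\<^esub> v \<in> carrier V" if "v \<in> carrier V" for c v
    using V.module.smult_closed[of c v] that by simp
  have s': "c \<odot>\<^bsub>Y\<^esub> v \<in> carrier Y" if "v \<in> carrier Y" for c v
    using Y.module.smult_closed[of c v] that by simp
  have d: "a - b \<in> ?F" "pointwise (*) c a \<in> ?F" if "a \<in> ?F" "b \<in> ?F" for a b c
    using T.subspace_diff[OF subspace_free_vs that] T.subspace_scale[OF subspace_free_vs that(1)] .
  have "tensor_rels V Y \<subseteq> ?F"
    unfolding tensor_rels_def
    using s s' by (auto intro!: d unit_vec_free)
  then have "T.span (tensor_rels V Y) \<subseteq> ?F" by (rule T.span_minimal[OF _ subspace_free_vs])
  then show ?thesis
    unfolding tensor_def
    by (intro presents_quot T.vector_space_axioms subspace_free_vs T.subspace_span)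
qed

lemma tensor_rels_zero:
  fixes V :: "('k::field, 'v) module" and Y :: "('k, 'y) module"
  assumes "vectorspace class_ring V" "w \<in> carrier Y"
  shows "unit_vec (\<zero>\<^bsub>V\<^esub>, w) \<in> Modules.module.span (pointwise (*)) (tensor_rels V Y)"
proof -
  interpret V: vectorspace class_ring V by fact
  interpret T: vector_space "pointwise ((*) :: 'k \<Rightarrow> 'k \<Rightarrow> 'k) ::
      'k \<Rightarrow> ('v \<times> 'y \<Rightarrow> 'k) \<Rightarrow> ('v \<times> 'y \<Rightarrow> 'k)"
    by (rule vector_space_functions)
  have "unit_vec (0 \<odot>\<^bsub>V\<^esub> \<zero>\<^bsub>V\<^esub>, w) - pointwise (*) 0 (unit_vec (\<zero>\<^bsub>V\<^esub>, w)) \<in> T.span (tensor_rels V Y)"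
    by (rule T.span_base) (use assms(2) V.module.M.zero_closed in \<open>unfold tensor_rels_def, blast\<close>)
  then show ?thesis using V.lmult_0[OF V.module.M.zero_closed] by simp
qed

text \<open>Elements with a normal form modulo the relations make up a subspace; to add two of them,
  their index sets are united by inserting zero summands. Expanding the second factor over
  \<open>Bs\<close> shows that the subspace contains all pure tensors.\<close>

lemma tensor_normal_form:
  fixes V :: "('k::field, 'v) module" and Y :: "('k, 'y) module"
    and sw :: "'k \<Rightarrow> 'w::ab_group_add \<Rightarrow> 'w"
  assumes V: "vectorspace class_ring V" and PY: "presents sw Wt {0} Y fw"
    and Bs: "Bs \<subseteq> Wt" "Wt \<subseteq> Modules.module.span sw Bs"
    and \<phi>: "\<phi> \<in> free_vs (carrier V \<times> carrier Y)"
  shows "\<exists>I v. finite I \<and> I \<subseteq> Bs \<and> (\<forall>b. v b \<in> carrier V) \<and>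
    \<phi> - (\<Sum>b\<in>I. unit_vec (v b, fw b)) \<in> Modules.module.span (pointwise (*)) (tensor_rels V Y)"
proof -
  interpret V: vectorspace class_ring V by (rule V)
  interpret Y: vectorspace class_ring Y using PY by (rule presents_vectorspace)
  interpret sw: vector_space sw using PY by (rule presents_vector_space)
  let ?sT = "pointwise ((*) :: 'k \<Rightarrow> 'k \<Rightarrow> 'k) :: 'k \<Rightarrow> ('v \<times> 'y \<Rightarrow> 'k) \<Rightarrow> ('v \<times> 'y \<Rightarrow> 'k)"
  interpret T: vector_space ?sT by (rule vector_space_functions)
  define R where "R = T.span (tensor_rels V Y)"
  have Rsub: "T.subspace R" by (simp add: R_def)
  have Wsub: "sw.subspace Wt" by (rule presents_subspace[OF PY])
  have Vs: "c \<odot>\<^bsub>V\<^esub> v \<in> carrier V" if "v \<in> carrier V" for c v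
    using V.module.smult_closed[of c v] that by simp
  have R1: "unit_vec (v \<oplus>\<^bsub>V\<^esub> v', w) - (unit_vec (v, w) + unit_vec (v', w)) \<in> R"
    if "v \<in> carrier V" "v' \<in> carrier V" "w \<in> carrier Y" for v v' w
    unfolding R_def diff_diff_eq[symmetric]
    by (rule T.span_base) (use that in \<open>unfold tensor_rels_def, blast\<close>)
  have R2: "unit_vec (v, w \<oplus>\<^bsub>Y\<^esub> w') - (unit_vec (v, w) + unit_vec (v, w')) \<in> R"
    if "v \<in> carrier V" "w \<in> carrier Y" "w' \<in> carrier Y" for v w w'
    unfolding R_def diff_diff_eq[symmetric]
    by (rule T.span_base) (use that in \<open>unfold tensor_rels_def, blast\<close>)
  have R3: "unit_vec (c \<odot>\<^bsub>V\<^esub> v, w) - ?sT c (unit_vec (v, w)) \<in> R"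
    if "v \<in> carrier V" "w \<in> carrier Y" for c v w
    unfolding R_def by (rule T.span_base) (use that in \<open>unfold tensor_rels_def, blast\<close>)
  have R4: "unit_vec (v, c \<odot>\<^bsub>Y\<^esub> w) - ?sT c (unit_vec (v, w)) \<in> R"
    if "v \<in> carrier V" "w \<in> carrier Y" for c v w
    unfolding R_def by (rule T.span_base) (use that in \<open>unfold tensor_rels_def, blast\<close>)
  have R0v: "unit_vec (\<zero>\<^bsub>V\<^esub>, w) \<in> R" if "w \<in> carrier Y" for w
    unfolding R_def by (rule tensor_rels_zero[OF V that])
  have R0y: "unit_vec (v, \<zero>\<^bsub>Y\<^esub>) \<in> R" if "v \<in> carrier V" for v
    using R4[of v "\<zero>\<^bsub>Y\<^esub>" 0] Y.lmult_0[of "\<zero>\<^bsub>Y\<^esub>"] that by simp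
  define N where "N = {\<phi>. \<exists>I v. finite I \<and> I \<subseteq> Bs \<and> (\<forall>b. v b \<in> carrier V) \<and>
      \<phi> - (\<Sum>b\<in>I. unit_vec (v b, fw b)) \<in> R}"
  have fwB: "fw b \<in> carrier Y" if "b \<in> Bs" for b using presents_in[OF PY] Bs(1) that by blast
  have N_R: "\<psi> \<in> N" if "\<phi> \<in> N" "\<psi> - \<phi> \<in> R" for \<phi> \<psi>
  proof -
    obtain I v where I: "finite I" "I \<subseteq> Bs" "\<forall>b. v b \<in> carrier V"
      "\<phi> - (\<Sum>b\<in>I. unit_vec (v b, fw b)) \<in> R" using \<open>\<phi> \<in> N\<close> unfolding N_def by blast
    have "(\<psi> - \<phi>) + (\<phi> - (\<Sum>b\<in>I. unit_vec (v b, fw b))) \<in> R"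
      by (rule T.subspace_add[OF Rsub \<open>\<psi> - \<phi> \<in> R\<close> I(4)])
    then show ?thesis unfolding N_def using I(1-3) by (simp add: algebra_simps) blast
  qed
  have N0: "0 \<in> N"
    unfolding N_def using T.subspace_0[OF Rsub]
    by (auto intro!: exI[of _ "{}"] exI[of _ "\<lambda>_. \<zero>\<^bsub>V\<^esub>"])
  have N_mono: "\<exists>w. (\<forall>b. w b \<in> carrier V) \<and> \<phi> - (\<Sum>b\<in>L. unit_vec (w b, fw b)) \<in> R"
    if I: "I \<subseteq> L" "\<forall>b. v b \<in> carrier V" "\<phi> - (\<Sum>b\<in>I. unit_vec (v b, fw b)) \<in> R"
      and L: "finite L" "L \<subseteq> Bs" for \<phi> I L v
  proof (intro exI conjI allI)
    let ?w = "\<lambda>b. if b \<in> I then v b else \<zero>\<^bsub>V\<^esub>"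
    show "?w b \<in> carrier V" for b using I(2) by simp
    have eq: "(\<Sum>b\<in>L. unit_vec (?w b, fw b)) =
        (\<Sum>b\<in>I. unit_vec (v b, fw b)) + (\<Sum>b\<in>L - I. unit_vec (\<zero>\<^bsub>V\<^esub>, fw b))"
      using sum.subset_diff[OF I(1) L(1), of "\<lambda>b. unit_vec (?w b, fw b)"] by (simp add: add.commute)
    have "(\<Sum>b\<in>L - I. unit_vec (\<zero>\<^bsub>V\<^esub>, fw b)) \<in> R"
      using L(2) fwB by (intro T.subspace_sum[OF Rsub] R0v) auto
    then show "\<phi> - (\<Sum>b\<in>L. unit_vec (?w b, fw b)) \<in> R"
      unfolding eq diff_diff_eq[symmetric] by (rule T.subspace_diff[OF Rsub I(3)])
  qed
  have N_add: "\<phi> + \<psi> \<in> N" if "\<phi> \<in> N" "\<psi> \<in> N" for \<phi> \<psi>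
  proof -
    obtain I v where I: "finite I" "I \<subseteq> Bs" "\<forall>b. v b \<in> carrier V"
      "\<phi> - (\<Sum>b\<in>I. unit_vec (v b, fw b)) \<in> R" using \<open>\<phi> \<in> N\<close> unfolding N_def by blast
    obtain J w where J: "finite J" "J \<subseteq> Bs" "\<forall>b. w b \<in> carrier V"
      "\<psi> - (\<Sum>b\<in>J. unit_vec (w b, fw b)) \<in> R" using \<open>\<psi> \<in> N\<close> unfolding N_def by blast
    let ?L = "I \<union> J"
    have L: "finite ?L" "?L \<subseteq> Bs" using I(1,2) J(1,2) by auto
    obtain v' where v': "\<forall>b. v' b \<in> carrier V" "\<phi> - (\<Sum>b\<in>?L. unit_vec (v' b, fw b)) \<in> R"
      using N_mono[OF Un_upper1 I(3,4) L] by (elim exE conjE)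
    obtain w' where w': "\<forall>b. w' b \<in> carrier V" "\<psi> - (\<Sum>b\<in>?L. unit_vec (w' b, fw b)) \<in> R"
      using N_mono[OF Un_upper2 J(3,4) L] by (elim exE conjE)
    have "(\<Sum>b\<in>?L. unit_vec (v' b \<oplus>\<^bsub>V\<^esub> w' b, fw b)) -
        ((\<Sum>b\<in>?L. unit_vec (v' b, fw b)) + (\<Sum>b\<in>?L. unit_vec (w' b, fw b))) \<in> R"
      unfolding sum.distrib[symmetric] sum_subtractf[symmetric]
      using L(2) fwB v'(1) w'(1) by (intro T.subspace_sum[OF Rsub] R1) auto
    from T.subspace_diff[OF Rsub T.subspace_add[OF Rsub v'(2) w'(2)] this]
    have "(\<phi> + \<psi>) - (\<Sum>b\<in>?L. unit_vec (v' b \<oplus>\<^bsub>V\<^esub> w' b, fw b)) \<in> R"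
      by (simp add: add_diff_eq)
    then show ?thesis
      unfolding N_def using L v'(1) w'(1)
      by (intro CollectI exI[of _ ?L] exI[of _ "\<lambda>b. v' b \<oplus>\<^bsub>V\<^esub> w' b"]) simp
  qed
  have N_scale: "?sT c \<phi> \<in> N" if "\<phi> \<in> N" for c \<phi>
  proof -
    obtain I v where I: "finite I" "I \<subseteq> Bs" "\<forall>b. v b \<in> carrier V"
      "\<phi> - (\<Sum>b\<in>I. unit_vec (v b, fw b)) \<in> R" using \<open>\<phi> \<in> N\<close> unfolding N_def by blast
    have "(\<Sum>b\<in>I. unit_vec (c \<odot>\<^bsub>V\<^esub> v b, fw b)) - (\<Sum>b\<in>I. ?sT c (unit_vec (v b, fw b))) \<in> R"
      unfolding sum_subtractf[symmetric]
      using I(2,3) fwB by (intro T.subspace_sum[OF Rsub] R3) auto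
    then have "?sT c (\<phi> - (\<Sum>b\<in>I. unit_vec (v b, fw b))) -
        ((\<Sum>b\<in>I. unit_vec (c \<odot>\<^bsub>V\<^esub> v b, fw b)) - (\<Sum>b\<in>I. ?sT c (unit_vec (v b, fw b)))) \<in> R"
      by (rule T.subspace_diff[OF Rsub T.subspace_scale[OF Rsub I(4)]])
    then have "?sT c \<phi> - (\<Sum>b\<in>I. unit_vec (c \<odot>\<^bsub>V\<^esub> v b, fw b)) \<in> R"
      by (simp add: T.scale_right_diff_distrib T.scale_sum_right)
    then show ?thesis
      unfolding N_def using I(1,2,3) Vs
      by (intro CollectI exI[of _ I] exI[of _ "\<lambda>b. c \<odot>\<^bsub>V\<^esub> v b"]) simp
  qed
  have Nsub: "T.subspace N" using N0 N_add N_scale by (simp add: T.subspace_def)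
  have N_unit: "unit_vec (v, fw w) \<in> N" if v: "v \<in> carrier V" and w: "w \<in> Wt" for v w
  proof -
    have sub: "sw.subspace {w \<in> Wt. unit_vec (v, fw w) \<in> N}"
    proof (rule sw.subspaceI)
      have "fw 0 = \<zero>\<^bsub>Y\<^esub>" using presents_zero_iff[OF PY sw.subspace_0[OF Wsub]] by simp
      then have "unit_vec (v, fw 0) - 0 \<in> R" using R0y[OF v] by simp
      then show "0 \<in> {w \<in> Wt. unit_vec (v, fw w) \<in> N}" using N_R[OF N0] sw.subspace_0[OF Wsub] by blast
      show "x + y \<in> {w \<in> Wt. unit_vec (v, fw w) \<in> N}"
        if x: "x \<in> {w \<in> Wt. unit_vec (v, fw w) \<in> N}" and y: "y \<in> {w \<in> Wt. unit_vec (v, fw w) \<in> N}" for x y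
      proof -
        have W: "x \<in> Wt" "y \<in> Wt" using x y by simp_all
        have "unit_vec (v, fw x) + unit_vec (v, fw y) \<in> N" using x y by (intro N_add) simp_all
        moreover have "unit_vec (v, fw (x + y)) - (unit_vec (v, fw x) + unit_vec (v, fw y)) \<in> R"
          unfolding presents_add[OF PY W] by (intro R2 v presents_in[OF PY] W)
        ultimately have "unit_vec (v, fw (x + y)) \<in> N" by (rule N_R)
        then show ?thesis using sw.subspace_add[OF Wsub W] by simp
      qed
      show "sw c x \<in> {w \<in> Wt. unit_vec (v, fw w) \<in> N}"
        if x: "x \<in> {w \<in> Wt. unit_vec (v, fw w) \<in> N}" for c x
      proof -
        have W: "x \<in> Wt" using x by simp
        have "?sT c (unit_vec (v, fw x)) \<in> N" using x by (intro N_scale) simp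
        moreover have "unit_vec (v, fw (sw c x)) - ?sT c (unit_vec (v, fw x)) \<in> R"
          unfolding presents_scale[OF PY W] by (intro R4 v presents_in[OF PY] W)
        ultimately have "unit_vec (v, fw (sw c x)) \<in> N" by (rule N_R)
        then show ?thesis using sw.subspace_scale[OF Wsub W] by simp
      qed
    qed
    have "Bs \<subseteq> {w \<in> Wt. unit_vec (v, fw w) \<in> N}"
    proof
      fix b assume b: "b \<in> Bs"
      have "unit_vec (v, fw b) \<in> N"
        unfolding N_def using b v T.subspace_0[OF Rsub]
        by (intro CollectI exI[of _ "{b}"] exI[of _ "\<lambda>_. v"]) simp
      then show "b \<in> {w \<in> Wt. unit_vec (v, fw w) \<in> N}" using b Bs(1) by blast
    qed
    then have "sw.span Bs \<subseteq> {w \<in> Wt. unit_vec (v, fw w) \<in> N}" by (rule sw.span_minimal[OF _ sub])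
    then show ?thesis using w Bs(2) by blast
  qed
  have "unit_vec (v, y) \<in> N" if v: "v \<in> carrier V" and y: "y \<in> carrier Y" for v y
  proof -
    obtain w where "w \<in> Wt" "y = fw w" using y unfolding presents_image[OF PY, symmetric] by (elim imageE)
    then show ?thesis using N_unit[OF v] by simp
  qed
  then have "unit_vec ` (carrier V \<times> carrier Y) \<subseteq> N" by auto
  then have "T.span (unit_vec ` (carrier V \<times> carrier Y)) \<subseteq> N" by (rule T.span_minimal[OF _ Nsub])
  then have "\<phi> \<in> N" using free_vs_span[OF \<phi>] by blast
  then show ?thesis by (simp only: N_def R_def mem_Collect_eq)
qed

text \<open>
  The normal form of a tensor with respect to a basis of one factor reduces the injectivity of the
  induced map to finite sums \<open>\<Sum> z\<^sub>b \<otimes> b\<close> over independent \<open>b\<close>.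
\<close>

lemma iso_vs_tensor:
  fixes sv :: "'k::field \<Rightarrow> 'a::ab_group_add \<Rightarrow> 'a" and sw :: "'k \<Rightarrow> 'w::ab_group_add \<Rightarrow> 'w"
    and sx :: "'k \<Rightarrow> 'x::ab_group_add \<Rightarrow> 'x"
    and V :: "('k, 'v) module" and Y :: "('k, 'y) module" and X :: "('k, 'z) module"
  assumes PV: "presents sv ZV BV V fv" and PY: "presents sw Wt {0} Y fw" and PX: "presents sx ZX BX X fx"
    and \<beta>_in: "\<And>z w. z \<in> ZV \<Longrightarrow> w \<in> Wt \<Longrightarrow> \<beta> z w \<in> ZX"
    and \<beta>_add1: "\<And>z z' w. \<beta> (z + z') w = \<beta> z w + \<beta> z' w"
    and \<beta>_add2: "\<And>z w w'. \<beta> z (w + w') = \<beta> z w + \<beta> z w'"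
    and \<beta>_scale1: "\<And>c z w. \<beta> (sv c z) w = sx c (\<beta> z w)"
    and \<beta>_scale2: "\<And>c z w. \<beta> z (sw c w) = sx c (\<beta> z w)"
    and \<beta>_B: "\<And>z w. z \<in> BV \<Longrightarrow> w \<in> Wt \<Longrightarrow> \<beta> z w \<in> BX"
    and inj: "\<And>I z b. finite I \<Longrightarrow> I \<subseteq> Wt \<Longrightarrow> \<not> Modules.module.dependent sw I \<Longrightarrow>
      (\<And>b. z b \<in> ZV) \<Longrightarrow> (\<Sum>b\<in>I. \<beta> (z b) b) \<in> BX \<Longrightarrow> b \<in> I \<Longrightarrow> z b \<in> BV"
    and surj: "\<And>x. x \<in> ZX \<Longrightarrow> \<exists>n zs ws. (\<forall>i<n::nat. zs i \<in> ZV \<and> ws i \<in> Wt) \<and>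
      x - (\<Sum>i<n. \<beta> (zs i) (ws i)) \<in> BX"
  shows "iso_vs X (tensor V Y)"
proof -
  interpret V: vectorspace class_ring V using PV by (rule presents_vectorspace)
  interpret Y: vectorspace class_ring Y using PY by (rule presents_vectorspace)
  interpret sv: vector_space sv using PV by (rule presents_vector_space)
  interpret sw: vector_space sw using PY by (rule presents_vector_space)
  interpret sx: vector_space sx using PX by (rule presents_vector_space)
  let ?sT = "pointwise ((*) :: 'k \<Rightarrow> 'k \<Rightarrow> 'k) :: 'k \<Rightarrow> ('v \<times> 'y \<Rightarrow> 'k) \<Rightarrow> ('v \<times> 'y \<Rightarrow> 'k)"
  interpret T: vector_space ?sT by (rule vector_space_functions)
  let ?F = "free_vs (carrier V \<times> carrier Y) :: ('v \<times> 'y \<Rightarrow> 'k) set"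
  define R where "R = T.span (tensor_rels V Y)"
  have Rsub: "T.subspace R" by (simp add: R_def)
  have PT: "presents ?sT ?F R (tensor V Y) (\<lambda>\<phi>. R +>\<^bsub>space_on ?sT ?F\<^esub> \<phi>)"
    unfolding R_def by (rule presents_tensor[OF V.vectorspace_axioms Y.vectorspace_axioms])
  define K where "K = {z \<in> ZX. z \<in> BX}"
  have Ksub: "sx.subspace K" unfolding K_def by (rule presents_kernel_subspace[OF PX])
  have ZXsub: "sx.subspace ZX" by (rule presents_subspace[OF PX])
  have ZVsub: "sv.subspace ZV" by (rule presents_subspace[OF PV])
  have Wsub: "sw.subspace Wt" by (rule presents_subspace[OF PY])
  have Vs: "c \<odot>\<^bsub>V\<^esub> v \<in> carrier V" if "v \<in> carrier V" for c v
    using V.module.smult_closed[of c v] that by simp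
  have Ys: "c \<odot>\<^bsub>Y\<^esub> v \<in> carrier Y" if "v \<in> carrier Y" for c v
    using Y.module.smult_closed[of c v] that by simp
  \<comment> \<open>This section need not be linear; its deviation lies in \<open>BV\<close>, and
    \<open>\<beta>_B\<close> sends that to \<open>BX\<close>. The section \<open>ry\<close> of the
    other factor respects the operations, as \<open>fw\<close> is injective on
    \<open>Wt\<close>.\<close>
  define rv where "rv v = (SOME z. z \<in> ZV \<and> fv z = v)" for v
  have rv: "rv v \<in> ZV" "fv (rv v) = v" if v: "v \<in> carrier V" for v
  proof -
    have "v \<in> fv ` ZV" using v by (simp add: presents_image[OF PV])
    then have "\<exists>z. z \<in> ZV \<and> fv z = v" by (elim imageE) blast
    then have "rv v \<in> ZV \<and> fv (rv v) = v" unfolding rv_def by (rule someI_ex)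
    then show "rv v \<in> ZV" "fv (rv v) = v" by simp_all
  qed
  define ry where "ry v = (SOME z. z \<in> Wt \<and> fw z = v)" for v
  have ry: "ry v \<in> Wt" "fw (ry v) = v" if v: "v \<in> carrier Y" for v
  proof -
    have "v \<in> fw ` Wt" using v by (simp add: presents_image[OF PY])
    then have "\<exists>z. z \<in> Wt \<and> fw z = v" by (elim imageE) blast
    then have "ry v \<in> Wt \<and> fw (ry v) = v" unfolding ry_def by (rule someI_ex)
    then show "ry v \<in> Wt" "fw (ry v) = v" by simp_all
  qed
  have fw_inj: "w = w'" if "w \<in> Wt" "w' \<in> Wt" "fw w = fw w'" for w w'
    using presents_eq_iff[OF PY that(1,2)] that(3) by simp
  have ry_fw: "ry (fw w) = w" if "w \<in> Wt" for w
    using fw_inj[OF _ that] ry[OF presents_in[OF PY that]] by blast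
  have \<beta>_diff1: "\<beta> (z - z') w = \<beta> z w - \<beta> z' w" for z z' w
    using \<beta>_add1[of "z - z'" z' w] by (simp add: eq_diff_eq)
  have \<beta>K: "\<beta> z w - \<beta> z' w \<in> K" if "z \<in> ZV" "z' \<in> ZV" "fv z = fv z'" "w \<in> Wt" for z z' w
  proof -
    have "z - z' \<in> BV" using presents_eq_iff[OF PV that(1,2)] that(3) by blast
    then have "\<beta> (z - z') w \<in> BX" "\<beta> (z - z') w \<in> ZX"
      using \<beta>_B \<beta>_in sv.subspace_diff[OF ZVsub that(1,2)] that(4) by blast+
    then show ?thesis by (simp add: K_def \<beta>_diff1)
  qed
  obtain \<theta> where \<theta>_lin: "Vector_Spaces.linear ?sT sx \<theta>"
    and \<theta>_unit: "\<forall>p. \<theta> (unit_vec p) = \<beta> (rv (fst p)) (ry (snd p))"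
    using unit_vec_extend[OF sx.vector_space_axioms, of "\<lambda>p. \<beta> (rv (fst p)) (ry (snd p))"] by blast
  interpret \<theta>: Vector_Spaces.linear ?sT sx \<theta> by (rule \<theta>_lin)
  have \<theta>u: "\<theta> (unit_vec (v, y)) = \<beta> (rv v) (ry y)" for v y using \<theta>_unit by simp
  have preim: "T.subspace {\<phi>. \<theta> \<phi> \<in> A}" if "sx.subspace A" for A
    using that by (simp add: T.subspace_def sx.subspace_def \<theta>.add \<theta>.scale \<theta>.zero)
  have \<theta>F: "\<theta> \<phi> \<in> ZX" if "\<phi> \<in> ?F" for \<phi>
  proof -
    have "unit_vec ` (carrier V \<times> carrier Y) \<subseteq> {\<phi>. \<theta> \<phi> \<in> ZX}" using \<beta>_in rv ry by (auto simp: \<theta>u)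
    then have "T.span (unit_vec ` (carrier V \<times> carrier Y)) \<subseteq> {\<phi>. \<theta> \<phi> \<in> ZX}"
      by (rule T.span_minimal[OF _ preim[OF ZXsub]])
    then show ?thesis using free_vs_span[OF that] by blast
  qed
  have "tensor_rels V Y \<subseteq> {\<phi>. \<theta> \<phi> \<in> K}"
  proof
    fix \<rho> assume "\<rho> \<in> tensor_rels V Y"
    then consider
      (1) v v' w where "\<rho> = unit_vec (v \<oplus>\<^bsub>V\<^esub> v', w) - unit_vec (v, w) - unit_vec (v', w)"
        "v \<in> carrier V" "v' \<in> carrier V" "w \<in> carrier Y"
    | (2) v w w' where "\<rho> = unit_vec (v, w \<oplus>\<^bsub>Y\<^esub> w') - unit_vec (v, w) - unit_vec (v, w')"
        "v \<in> carrier V" "w \<in> carrier Y" "w' \<in> carrier Y"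
    | (3) c v w where "\<rho> = unit_vec (c \<odot>\<^bsub>V\<^esub> v, w) - ?sT c (unit_vec (v, w))"
        "v \<in> carrier V" "w \<in> carrier Y"
    | (4) c v w where "\<rho> = unit_vec (v, c \<odot>\<^bsub>Y\<^esub> w) - ?sT c (unit_vec (v, w))"
        "v \<in> carrier V" "w \<in> carrier Y"
      unfolding tensor_rels_def by blast
    then have "\<theta> \<rho> \<in> K"
    proof cases
      case 1
      have "\<theta> \<rho> = \<beta> (rv (v \<oplus>\<^bsub>V\<^esub> v')) (ry w) - \<beta> (rv v + rv v') (ry w)"
        unfolding 1(1) \<theta>.diff \<theta>u \<beta>_add1 by (rule diff_diff_eq)
      also have "\<dots> \<in> K"
        using 1 rv ry presents_add[OF PV rv(1)[OF 1(2)] rv(1)[OF 1(3)]]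
        by (intro \<beta>K sv.subspace_add[OF ZVsub]) simp_all
      finally show ?thesis .
    next
      case 2
      have "ry (w \<oplus>\<^bsub>Y\<^esub> w') = ry w + ry w'"
        using 2 ry presents_add[OF PY ry(1)[OF 2(3)] ry(1)[OF 2(4)]]
        by (intro fw_inj sw.subspace_add[OF Wsub]) simp_all
      then have "\<theta> \<rho> = 0" unfolding 2(1) by (simp only: \<theta>.diff \<theta>u \<beta>_add2) simp
      then show ?thesis using sx.subspace_0[OF Ksub] by simp
    next
      case 3
      have "\<theta> \<rho> = \<beta> (rv (c \<odot>\<^bsub>V\<^esub> v)) (ry w) - \<beta> (sv c (rv v)) (ry w)"
        unfolding 3(1) by (simp only: \<theta>.diff \<theta>.scale \<theta>u \<beta>_scale1)
      also have "\<dots> \<in> K"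
        using 3 rv ry presents_scale[OF PV rv(1)[OF 3(2)], of c] Vs
        by (intro \<beta>K sv.subspace_scale[OF ZVsub]) simp_all
      finally show ?thesis .
    next
      case 4
      have "ry (c \<odot>\<^bsub>Y\<^esub> w) = sw c (ry w)"
        using 4 ry presents_scale[OF PY ry(1)[OF 4(3)], of c] Ys
        by (intro fw_inj sw.subspace_scale[OF Wsub]) simp_all
      then have "\<theta> \<rho> = 0" unfolding 4(1) by (simp only: \<theta>.diff \<theta>.scale \<theta>u \<beta>_scale2) simp
      then show ?thesis using sx.subspace_0[OF Ksub] by simp
    qed
    then show "\<rho> \<in> {\<phi>. \<theta> \<phi> \<in> K}" by simp
  qed
  then have \<theta>R: "\<theta> \<phi> \<in> K" if "\<phi> \<in> R" for \<phi>
    using that T.span_minimal[OF _ preim[OF Ksub]] unfolding R_def by blast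
  obtain Bs where Bs: "Bs \<subseteq> Wt" "sw.independent Bs" "Wt \<subseteq> sw.span Bs"
    using sw.maximal_independent_subset by blast
  have fwB: "fw b \<in> carrier Y" if "b \<in> Bs" for b using presents_in[OF PY] Bs(1) that by blast
  have "iso_vs (tensor V Y) X"
  proof (rule iso_vs_presents[OF PT PX \<theta>F])
    show "\<theta> \<phi> \<in> BX \<longleftrightarrow> \<phi> \<in> R" if \<phi>: "\<phi> \<in> ?F" for \<phi>
    proof
      assume "\<phi> \<in> R" then show "\<theta> \<phi> \<in> BX" using \<theta>R by (simp add: K_def)
    next
      assume B: "\<theta> \<phi> \<in> BX"
      obtain I v where I: "finite I" "I \<subseteq> Bs" "\<forall>b. v b \<in> carrier V"
        "\<phi> - (\<Sum>b\<in>I. unit_vec (v b, fw b)) \<in> R" unfolding R_def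
        using tensor_normal_form[OF V.vectorspace_axioms PY Bs(1,3) \<phi>] by (elim exE conjE)
      have "\<theta> \<phi> - \<theta> (\<phi> - (\<Sum>b\<in>I. unit_vec (v b, fw b))) \<in> K"
        using B \<theta>F[OF \<phi>] \<theta>R[OF I(4)] by (intro sx.subspace_diff[OF Ksub]) (simp_all add: K_def)
      moreover have "\<theta> \<phi> - \<theta> (\<phi> - (\<Sum>b\<in>I. unit_vec (v b, fw b))) = (\<Sum>b\<in>I. \<beta> (rv (v b)) b)"
      proof -
        have "\<theta> (\<Sum>b\<in>I. unit_vec (v b, fw b)) = (\<Sum>b\<in>I. \<beta> (rv (v b)) b)"
          unfolding \<theta>.sum \<theta>u using ry_fw I(2) Bs(1) by (intro sum.cong) auto
        then show ?thesis by (simp add: \<theta>.diff)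
      qed
      ultimately have "(\<Sum>b\<in>I. \<beta> (rv (v b)) b) \<in> BX" by (simp add: K_def)
      then have zB: "rv (v b) \<in> BV" if "b \<in> I" for b
        using inj[of I "\<lambda>b. rv (v b)"] I Bs(1) sw.independent_mono[OF Bs(2) I(2)] rv(1) that by blast
      have "v b = \<zero>\<^bsub>V\<^esub>" if "b \<in> I" for b
        using presents_zero_iff[OF PV rv(1)] zB[OF that] rv(2) I(3) by metis
      then have "(\<Sum>b\<in>I. unit_vec (v b, fw b)) \<in> R"
        using I(2) fwB by (intro T.subspace_sum[OF Rsub]) (auto simp: R_def intro!: tensor_rels_zero[OF V.vectorspace_axioms])
      from T.subspace_add[OF Rsub I(4) this] show "\<phi> \<in> R" by simp
    qed
    show "\<exists>\<phi>\<in>?F. x - \<theta> \<phi> \<in> BX" if x: "x \<in> ZX" for x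
    proof -
      obtain n :: nat and zs ws where zw: "\<forall>i<n. zs i \<in> ZV \<and> ws i \<in> Wt"
        and xB: "x - (\<Sum>i<n. \<beta> (zs i) (ws i)) \<in> BX" using surj[OF x] by blast
      define \<phi> where "\<phi> = (\<Sum>i<n. unit_vec (fv (zs i), fw (ws i)) :: 'v \<times> 'y \<Rightarrow> 'k)"
      have in_car: "fv (zs i) \<in> carrier V" "fw (ws i) \<in> carrier Y" if "i < n" for i
        using zw that presents_in[OF PV] presents_in[OF PY] by auto
      have "\<phi> \<in> ?F"
        unfolding \<phi>_def using in_car by (intro T.subspace_sum[OF subspace_free_vs] unit_vec_free) auto
      moreover have "(\<Sum>i<n. \<beta> (zs i) (ws i)) - \<theta> \<phi> \<in> K"
        unfolding \<phi>_def \<theta>.sum \<theta>u sum_subtractf[symmetric]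
      proof (rule sx.subspace_sum[OF Ksub])
        fix i assume "i \<in> {..<n}"
        then have i: "i < n" by simp
        have "ry (fw (ws i)) = ws i" using ry_fw zw i by blast
        then show "\<beta> (zs i) (ws i) - \<beta> (rv (fv (zs i))) (ry (fw (ws i))) \<in> K"
          using rv[OF in_car(1)[OF i]] zw i by (simp add: \<beta>K)
      qed
      moreover have "x - (\<Sum>i<n. \<beta> (zs i) (ws i)) \<in> K"
        using xB x zw \<beta>_in unfolding K_def
        by (auto intro!: sx.subspace_diff[OF ZXsub] sx.subspace_sum[OF ZXsub])
      ultimately have "(x - (\<Sum>i<n. \<beta> (zs i) (ws i))) + ((\<Sum>i<n. \<beta> (zs i) (ws i)) - \<theta> \<phi>) \<in> K"
        by (intro sx.subspace_add[OF Ksub])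
      then show ?thesis using \<open>\<phi> \<in> ?F\<close> by (intro bexI[of _ \<phi>]) (simp_all add: K_def)
    qed
  qed (simp_all add: \<theta>.add \<theta>.scale)
  then show ?thesis by (rule iso_vs_sym)
qed

text \<open>The prescribed map is linear on \<open>S\<close> only, as a class map is on cocycles. It
  is extended from a basis of \<open>S\<close>, which keeps the range inside
  \<open>W\<close>.\<close>

lemma extend_linear_on:
  assumes V: "vector_space s1" "vector_space s2" and S: "Modules.module.subspace s1 S"
    and W: "Modules.module.subspace s2 W" and f: "f ` S \<subseteq> W"
    and add: "\<And>u v. u \<in> S \<Longrightarrow> v \<in> S \<Longrightarrow> f (u + v) = f u + f v"
    and scale: "\<And>c u. u \<in> S \<Longrightarrow> f (s1 c u) = s2 c (f u)"
  shows "\<exists>g. Vector_Spaces.linear s1 s2 g \<and> (\<forall>x\<in>S. g x = f x) \<and> range g \<subseteq> W"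
proof -
  interpret vector_space_pair s1 s2 using V by (simp add: vector_space_pair_def)
  obtain B where B: "B \<subseteq> S" "vs1.independent B" "S \<subseteq> vs1.span B"
    using vs1.maximal_independent_subset by blast
  obtain g where g: "Vector_Spaces.linear s1 s2 g" "\<forall>x\<in>B. g x = f x" "range g = vs2.span (f ` B)"
    using linear_independent_extend_subspace[OF B(2), of f] by (elim exE conjE)
  interpret g: Vector_Spaces.linear s1 s2 g by (rule g(1))
  have "f 0 = 0" using add[of 0 0] vs1.subspace_0[OF S] by simp
  then have "vs1.subspace {x \<in> S. g x = f x}"
    using vs1.subspace_0[OF S] vs1.subspace_add[OF S] vs1.subspace_scale[OF S]
    by (intro vs1.subspaceI) (auto simp: g.zero g.add g.scale add scale)
  then have "vs1.span B \<subseteq> {x \<in> S. g x = f x}" using B(1) g(2) by (intro vs1.span_minimal) auto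
  then have "\<forall>x\<in>S. g x = f x" using B(3) by auto
  moreover have "range g \<subseteq> W" unfolding g(3) using B(1) f by (intro vs2.span_minimal W) auto
  ultimately show ?thesis using g(1) by (intro exI[of _ g] conjI)
qed

lemma presents_linear_iso:
  assumes P: "presents s Z B X f" and g: "linear_map class_ring X Y g" "bij_betw g (carrier X) (carrier Y)"
  shows "presents s Z B Y (\<lambda>z. g (f z))"
proof -
  interpret g: linear_map class_ring X Y g by (rule g(1))
  have inj: "inj_on g (carrier X)" and im: "g ` carrier X = carrier Y" using g(2) by (auto simp: bij_betw_def)
  have fX: "f z \<in> carrier X" if "z \<in> Z" for z by (rule presents_in[OF P that])
  show ?thesis
    unfolding presents_def
  proof (intro conjI ballI allI)
    show "(\<lambda>z. g (f z)) ` Z = carrier Y"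
      using im unfolding presents_image[OF P, symmetric] by (simp add: image_image)
    show "g (f (u + v)) = g (f u) \<oplus>\<^bsub>Y\<^esub> g (f v)" if "u \<in> Z" "v \<in> Z" for u v
      using presents_add[OF P that] g.f_add[OF fX[OF that(1)] fX[OF that(2)]] by simp
    show "g (f (s c u)) = c \<odot>\<^bsub>Y\<^esub> g (f u)" if "u \<in> Z" for c u
      using presents_scale[OF P that, of c] g.f_smult[OF _ fX[OF that], of c] by simp
    show "g (f u) = \<zero>\<^bsub>Y\<^esub> \<longleftrightarrow> u \<in> B" if "u \<in> Z" for u
    proof -
      have "g (f u) = \<zero>\<^bsub>Y\<^esub> \<longleftrightarrow> g (f u) = g \<zero>\<^bsub>X\<^esub>" using g.f0_is_0 by simp
      also have "\<dots> \<longleftrightarrow> f u = \<zero>\<^bsub>X\<^esub>"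
        using inj_on_eq_iff[OF inj fX[OF that] g.V.module.M.zero_closed] .
      finally show ?thesis using presents_zero_iff[OF P that] by simp
    qed
  qed (use presents_vector_space[OF P] presents_subspace[OF P] g.W.vectorspace_axioms in auto)
qed

text \<open>The kernel of a linear retraction onto \<open>B\<close> meets every class of
  \<open>Z\<close> exactly once. This realises cohomology as a subspace of the cochains, which can
  then serve as coefficients \<open>W\<close>.\<close>

lemma presents_complement:
  assumes P: "presents s Z B X f" and B: "Modules.module.subspace s B" "B \<subseteq> Z"
  shows "\<exists>W. presents s W {0} X f"
proof -
  interpret vector_space s using P by (rule presents_vector_space)
  interpret vector_space_pair s s by unfold_locales
  have Z: "subspace Z" by (rule presents_subspace[OF P])
  have "Vector_Spaces.linear s s (\<lambda>x. x)" by (rule linear_id[unfolded id_def])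
  from linear_exists_left_inverse_on[OF this B(1) inj_on_id2] obtain g
    where g: "range g \<subseteq> B" "Vector_Spaces.linear s s g" "\<forall>v\<in>B. g v = v" by (elim exE conjE)
  interpret g: Vector_Spaces.linear s s g by (rule g(2))
  define W where "W = {z \<in> Z. g z = 0}"
  have W: "subspace W" using Z unfolding W_def subspace_def by (simp add: g.add g.scale g.zero)
  have "f ` W = carrier X"
  proof -
    have "f z \<in> f ` W" if z: "z \<in> Z" for z
    proof (intro image_eqI)
      have gz: "g z \<in> B" using g(1) by blast
      then have gZ: "g z \<in> Z" using B(2) by blast
      show "z - g z \<in> W"
        unfolding W_def using g(3) gz subspace_diff[OF Z z gZ] by (simp add: g.diff)
      show "f z = f (z - g z)"
        using presents_eq_iff[OF P z subspace_diff[OF Z z gZ]] gz by simp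
    qed
    then have "f ` Z \<subseteq> f ` W" by (rule image_subsetI)
    moreover have "f ` W \<subseteq> f ` Z" by (rule image_mono) (simp add: W_def)
    ultimately show ?thesis unfolding presents_image[OF P, symmetric] by (rule equalityI[rotated])
  qed
  moreover have "f u = \<zero>\<^bsub>X\<^esub> \<longleftrightarrow> u = 0" if "u \<in> W" for u
    using presents_zero_iff[OF P, of u] that g(3) subspace_0[OF B(1)] by (auto simp: W_def)
  ultimately have "presents s W {0} X f"
    using P W unfolding presents_def by (simp add: W_def)
  then show ?thesis ..
qed

section \<open>Comparison of \<open>HR_coeff\<close> with the tensor product\<close>

context trivial_coefficients
begin

lemma zero_rel_coboundaries: "0 \<in> rel_coboundaries sg br sw W k"
proof -
  have "(0 :: 'g list \<Rightarrow> 'w) = 0 + D0 0" by (simp add: D0.zero)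
  moreover have "0 \<in> S i n" for i n by (rule M3.vs1.subspace_0[OF subspace_S])
  ultimately show ?thesis by (intro CollectI exI conjI)
qed

lemma dual_vector:
  assumes "\<not> Modules.module.dependent sw I" "b \<in> I"
  shows "\<exists>\<xi>. Vector_Spaces.linear sw ((*) :: 'k \<Rightarrow> 'k \<Rightarrow> 'k) \<xi> \<and>
    (\<forall>b'\<in>I. \<xi> b' = (if b' = b then 1 else 0))"
proof -
  interpret vector_space_pair sw "(*) :: 'k \<Rightarrow> 'k \<Rightarrow> 'k"
    using vector_space_mult W.vector_space_axioms by (simp add: vector_space_pair_def)
  show ?thesis
    using linear_independent_extend[OF assms(1), of "\<lambda>b'. if b' = b then 1 else 0"] by blast
qed

text \<open>Finitely many cocycles generate \<open>HR\<close>, so after any functional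
  \<open>g\<close> is a combination of them modulo coboundaries. This is the hypothesis of
  \<open>rel_cocycle_decomposition\<close>.\<close>

lemma rel_cocycle_decomposition_fin_dim_HR:
  assumes char_2: "CHAR('k) = 2" and fd: "vectorspace.fin_dim class_ring (HR sg br (int j))"
    and g: "g \<in> rel_cocycles sg br sw W (Suc j)"
  shows "\<exists>n zs ws. (\<forall>i<n::nat. zs i \<in> rel_cocycles sg br (*) UNIV (Suc j) \<and> ws i \<in> W) \<and>
    g - (\<Sum>i<n. (\<lambda>l. sw (zs i l) (ws i))) \<in> rel_coboundaries sg br sw W (Suc j)"
proof -
  obtain h where P: "presents (pointwise (*)) (rel_cocycles sg br (*) UNIV (Suc j))
      (rel_coboundaries sg br (*) UNIV (Suc j)) (HR sg br (int j)) h"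
    using k.presents_HR_nonneg[OF char_2] unfolding HR_def by blast
  obtain A where A: "finite A" "A \<subseteq> rel_cocycles sg br (*) UNIV (Suc j)"
    "\<forall>z\<in>rel_cocycles sg br (*) UNIV (Suc j). \<exists>u\<in>k.M3.vs1.span A. z - u \<in> rel_coboundaries sg br (*) UNIV (Suc j)"
    using fin_dim_presents[OF P fd] by blast
  obtain n zs where zs: "A = zs ` {i::nat. i < n}" "inj_on zs {i. i < n}"
    using finite_imp_nat_seg_image_inj_on[OF A(1)] by blast
  have "\<exists>w. (\<forall>i<n. w i \<in> W) \<and>
      g - (\<Sum>i<n. (\<lambda>l. sw (zs i l) (w i))) \<in> rel_coboundaries sg br sw W (Suc j)"
  proof (rule rel_cocycle_decomposition[OF _ _ g])
    show "zs i \<in> rel_cocycles sg br (*) UNIV (Suc j)" if "i < n" for i using A(2) zs(1) that by blast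
    fix f assume "f \<in> rel_cocycles sg br (*) UNIV (Suc j)"
    then obtain u where u: "u \<in> k.M3.vs1.span A" "f - u \<in> rel_coboundaries sg br (*) UNIV (Suc j)"
      using A(3) by blast
    obtain c where "u = (\<Sum>v\<in>A. pointwise (*) (c v) v)" using u(1) unfolding k.M3.vs1.span_finite[OF A(1)] by blast
    also have "\<dots> = (\<Sum>i<n. pointwise (*) (c (zs i)) (zs i))"
      unfolding zs(1) sum.reindex[OF zs(2)] by (simp add: lessThan_def)
    finally show "\<exists>c. f - (\<Sum>i<n. pointwise (*) (c i) (zs i)) \<in> rel_coboundaries sg br (*) UNIV (Suc j)"
      using u(2) by (intro exI[of _ "\<lambda>i. c (zs i)"]) (simp only:)
  qed
  then obtain w where "\<forall>i<n. w i \<in> W"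
    "g - (\<Sum>i<n. (\<lambda>l. sw (zs i l) (w i))) \<in> rel_coboundaries sg br sw W (Suc j)" by (elim exE conjE)
  moreover have "\<forall>i<n. zs i \<in> rel_cocycles sg br (*) UNIV (Suc j)" using A(2) zs(1) by auto
  ultimately show ?thesis by (intro exI[of _ n] exI[of _ zs] exI[of _ w] conjI allI impI) simp_all
qed

text \<open>The coordinates of a cocycle with respect to a finite basis of \<open>W\<close> are
  scalar cocycles, and the decomposition is even an equality.\<close>

lemma rel_cocycle_decomposition_finite_basis:
  assumes B: "finite B" "B \<subseteq> W" "\<not> W.dependent B" "W \<subseteq> W.span B"
    and g: "g \<in> rel_cocycles sg br sw W k"
  shows "\<exists>n zs ws. (\<forall>i<n::nat. zs i \<in> rel_cocycles sg br (*) UNIV k \<and> ws i \<in> W) \<and>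
    g - (\<Sum>i<n. (\<lambda>l. sw (zs i l) (ws i))) \<in> rel_coboundaries sg br sw W k"
proof -
  have "\<forall>b\<in>B. \<exists>\<xi>. Vector_Spaces.linear sw ((*) :: 'k \<Rightarrow> 'k \<Rightarrow> 'k) \<xi> \<and>
      (\<forall>b'\<in>B. \<xi> b' = (if b' = b then 1 else 0))"
    using dual_vector[OF B(3)] by blast
  from bchoice[OF this] obtain \<xi> where \<xi>: "\<forall>b\<in>B. Vector_Spaces.linear sw ((*) :: 'k \<Rightarrow> 'k \<Rightarrow> 'k) (\<xi> b) \<and>
      (\<forall>b'\<in>B. \<xi> b b' = (if b' = b then 1 else 0))" by blast
  have lin: "\<xi> b (x + y) = \<xi> b x + \<xi> b y" "\<xi> b (sw c x) = c * \<xi> b x" "\<xi> b 0 = 0" if "b \<in> B" for b c x y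
  proof -
    interpret L: Vector_Spaces.linear sw "(*)" "\<xi> b" using \<xi> that by blast
    show "\<xi> b (x + y) = \<xi> b x + \<xi> b y" "\<xi> b (sw c x) = c * \<xi> b x" "\<xi> b 0 = 0"
      by (rule L.add L.scale L.zero)+
  qed
  have "W.subspace {x. x = (\<Sum>b\<in>B. sw (\<xi> b x) b)}"
  proof (rule W.subspaceI)
    show "0 \<in> {x. x = (\<Sum>b\<in>B. sw (\<xi> b x) b)}" using lin by simp
    show "x + y \<in> {x. x = (\<Sum>b\<in>B. sw (\<xi> b x) b)}"
      if "x \<in> {x. x = (\<Sum>b\<in>B. sw (\<xi> b x) b)}" "y \<in> {x. x = (\<Sum>b\<in>B. sw (\<xi> b x) b)}" for x y
      using that lin(1) by (simp add: W.scale_left_distrib sum.distrib)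
    show "sw c x \<in> {x. x = (\<Sum>b\<in>B. sw (\<xi> b x) b)}" if x: "x \<in> {x. x = (\<Sum>b\<in>B. sw (\<xi> b x) b)}" for c x
    proof -
      have "(\<Sum>b\<in>B. sw (\<xi> b (sw c x)) b) = sw c (\<Sum>b\<in>B. sw (\<xi> b x) b)"
        unfolding W.scale_sum_right using lin(2) by (intro sum.cong) simp_all
      then show ?thesis using x by simp
    qed
  qed
  moreover have "B \<subseteq> {x. x = (\<Sum>b\<in>B. sw (\<xi> b x) b)}"
  proof
    fix a assume a: "a \<in> B"
    have "(\<Sum>b\<in>B. sw (\<xi> b a) b) = (\<Sum>b\<in>B. if b = a then b else 0)"
      using \<xi> a by (intro sum.cong) auto
    then show "a \<in> {x. x = (\<Sum>b\<in>B. sw (\<xi> b x) b)}" using a B(1) by (simp add: sum.delta')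
  qed
  ultimately have coord: "x = (\<Sum>b\<in>B. sw (\<xi> b x) b)" if "x \<in> W" for x
    using W.span_minimal B(4) that by blast
  obtain n bs where bs: "B = bs ` {i::nat. i < n}" "inj_on bs {i. i < n}"
    using finite_imp_nat_seg_image_inj_on[OF B(1)] by blast
  have gS: "g \<in> S k (int (Suc k))" using g by blast
  have "g l = (\<Sum>i<n. sw (\<xi> (bs i) (g l)) (bs i))" for l
    using coord[OF T.CL_range[OF S_CL[OF gS]], of l]
    unfolding bs(1) sum.reindex[OF bs(2)] by (simp add: lessThan_def)
  then have "g - (\<Sum>i<n. (\<lambda>l. sw (\<xi> (bs i) (g l)) (bs i))) = 0"
    by (simp add: fun_eq_iff sum_fun_apply)
  then have "g - (\<Sum>i<n. (\<lambda>l. sw (\<xi> (bs i) (g l)) (bs i))) \<in> rel_coboundaries sg br sw W k"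
    using zero_rel_coboundaries by (simp only:)
  moreover have "\<forall>i<n. (\<lambda>l. \<xi> (bs i) (g l)) \<in> rel_cocycles sg br (*) UNIV k \<and> bs i \<in> W"
    using rel_cocycles_comp[OF _ g] \<xi> bs(1) B(2) by blast
  ultimately show ?thesis by (intro exI[of _ n] exI[of _ "\<lambda>i l. \<xi> (bs i) (g l)"] exI[of _ bs]) simp
qed

text \<open>Injectivity comes from dual functionals: the one that is 1 at \<open>b0\<close> and 0 on
  the other elements of \<open>I\<close> maps the sum to \<open>z b0\<close>, and functionals
  preserve coboundaries. Surjectivity is where finiteness of a factor enters.\<close>

theorem HR_coeff_iso_tensor:
  assumes char_2: "CHAR('k) = 2" and PY: "presents sw W {0} Y fw"
    and fd: "vectorspace.fin_dim class_ring (HR sg br (int j)) \<or> vectorspace.fin_dim class_ring Y"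
  shows "iso_vs (HR_coeff sg br sw W (int j)) (tensor (HR sg br (int j)) Y)"
proof -
  let ?k = "Suc j"
  obtain h where P: "presents (pointwise (*)) (rel_cocycles sg br (*) UNIV ?k)
      (rel_coboundaries sg br (*) UNIV ?k) (HR sg br (int j)) h"
    using k.presents_HR_nonneg[OF char_2] unfolding HR_def by blast
  obtain h' where P': "presents (pointwise sw) (rel_cocycles sg br sw W ?k)
      (rel_coboundaries sg br sw W ?k) (HR_coeff sg br sw W (int j)) h'"
    using presents_HR_nonneg[OF char_2] by blast
  show ?thesis
  proof (rule iso_vs_tensor[OF P PY P', where \<beta> = "\<lambda>z w l. sw (z l) w"])
    show "z b0 \<in> rel_coboundaries sg br (*) UNIV ?k"
      if I: "finite I" "I \<subseteq> W" "\<not> W.dependent I" "\<And>b. z b \<in> rel_cocycles sg br (*) UNIV ?k"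
        "(\<Sum>b\<in>I. (\<lambda>l. sw (z b l) b)) \<in> rel_coboundaries sg br sw W ?k" "b0 \<in> I" for I z b0
    proof -
      obtain \<xi> where \<xi>: "Vector_Spaces.linear sw ((*) :: 'k \<Rightarrow> 'k \<Rightarrow> 'k) \<xi>"
        "\<forall>b\<in>I. \<xi> b = (if b = b0 then 1 else 0)"
        using dual_vector[OF I(3,6)] by blast
      interpret \<xi>: Vector_Spaces.linear sw "(*)" \<xi> by (rule \<xi>(1))
      have "\<xi> ((\<Sum>b\<in>I. (\<lambda>l. sw (z b l) b)) l) = z b0 l" for l
      proof -
        have "\<xi> ((\<Sum>b\<in>I. (\<lambda>l. sw (z b l) b)) l) = (\<Sum>b\<in>I. if b = b0 then z b l else 0)"
          unfolding sum_fun_apply \<xi>.sum \<xi>.scale using \<xi>(2) by (intro sum.cong) auto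
        then show ?thesis using I(1,6) by (simp add: sum.delta')
      qed
      then show ?thesis using rel_coboundaries_comp[OF \<xi>(1) I(5)] by simp
    qed
    show "\<exists>n zs ws. (\<forall>i<n::nat. zs i \<in> rel_cocycles sg br (*) UNIV ?k \<and> ws i \<in> W) \<and>
        x - (\<Sum>i<n. (\<lambda>l. sw (zs i l) (ws i))) \<in> rel_coboundaries sg br sw W ?k"
      if x: "x \<in> rel_cocycles sg br sw W ?k" for x
      using fd
    proof
      assume "vectorspace.fin_dim class_ring (HR sg br (int j))"
      then show ?thesis by (rule rel_cocycle_decomposition_fin_dim_HR[OF char_2 _ x])
    next
      assume "vectorspace.fin_dim class_ring Y"
      then obtain A where A: "finite A" "A \<subseteq> W" "\<forall>z\<in>W. \<exists>u\<in>W.span A. z - u \<in> {0}"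
        using fin_dim_presents[OF PY] by blast
      obtain B where B: "B \<subseteq> A" "W.independent B" "A \<subseteq> W.span B"
        using W.maximal_independent_subset by blast
      have "W \<subseteq> W.span A" using A(3) by auto
      also have "\<dots> \<subseteq> W.span B" using B(3) by (intro W.span_minimal W.subspace_span)
      finally show ?thesis
        using A(1,2) B by (intro rel_cocycle_decomposition_finite_basis[OF _ _ B(2) _ x])
          (auto intro: finite_subset)
    qed
    show "(\<lambda>l. sw (z l) w) \<in> rel_cocycles sg br sw W ?k"
      if "z \<in> rel_cocycles sg br (*) UNIV ?k" "w \<in> W" for z w
      using that by (rule rel_cocycles_scale)
    show "(\<lambda>l. sw (z l) w) \<in> rel_coboundaries sg br sw W ?k"
      if "z \<in> rel_coboundaries sg br (*) UNIV ?k" "w \<in> W" for z w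
      using that by (rule rel_coboundaries_scale)
  qed (simp_all add: fun_eq_iff pointwise_def W.scale_left_distrib W.scale_right_distrib mult.commute)
qed

end

section \<open>The second page of the spectral sequence\<close>

context lie_module_char_2
begin

lemma trivial_coefficients_pointwise:
  assumes "vector_space sw" "Modules.module.subspace sw W"
  shows "trivial_coefficients sg br sw W"
  by (intro trivial_coefficients.intro trivial_coefficients_axioms.intro
      commutative_lie_algebra_axioms assms)

text \<open>Outside the first quadrant two consecutive filtration steps coincide, so every cycle
  already has filtration \<open>p + 1\<close> and is a boundary of the first kind.\<close>

lemma page_2_trivial:
  assumes "p < 0 \<or> q < 0"
  shows "cycles (int 2) p (p + q) \<subseteq> boundaries (int 2) p (p + q)"
proof
  fix z assume z: "z \<in> cycles (int 2) p (p + q)"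
  have "Fil p (p + q) = Fil (p + 1) (p + q)"
    using assms
  proof
    assume "p < 0"
    then show ?thesis using F_low[of p "p + q"] F_low[of "p + 1" "p + q"] by simp
  next
    assume "q < 0"
    then show ?thesis using F_high[of "p + q" p] F_high[of "p + q" "p + 1"] by simp
  qed
  then have "z \<in> cycles (int 2 - 1) (p + 1) (p + q)" using z by (simp add: cycles_def add.commute)
  then show "z \<in> boundaries (int 2) p (p + q)"
    by (rule boundariesI[OF _ P.subspace_0[OF subspace_cycles]]) (simp add: D.zero)
qed

lemma page_2_zero:
  assumes "p < 0 \<or> q < 0"
  shows "vectorspace class_ring (page 2 p q)" "carrier (page 2 p q) = {\<zero>\<^bsub>page 2 p q\<^esub>}"
proof -
  have P: "presents (pointwise sm) (cycles (int 2) p (p + q)) (boundaries (int 2) p (p + q)) (page 2 p q)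
      (page_coset 2 p (p + q))" by (rule presents_page) simp
  show "vectorspace class_ring (page 2 p q)" by (rule presents_vectorspace[OF P])
  show "carrier (page 2 p q) = {\<zero>\<^bsub>page 2 p q\<^esub>}"
    by (rule presents_carrier_zero[OF P page_2_trivial[OF assms]])
qed

text \<open>Subspaces have complements, so \<open>\<pi>\<close>, \<open>\<sigma>\<close> and
  \<open>\<tau>\<close> can be chosen linear on whole spaces. Applied to the values of a cochain,
  they then preserve multilinearity and symmetry.\<close>

lemma exists_second_page:
  assumes sw: "vector_space sw" and W: "Modules.module.subspace sw W" and q: "0 \<le> q"
    and iso: "iso_vs (space_on sw W) (HL sg br sm act q)"
  shows "\<exists>\<pi> \<sigma> \<tau>. second_page sg br sm act sw W q \<pi> \<sigma> \<tau>"
proof -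
  let ?Z = "{c \<in> CLM q. D c = 0}" and ?B = "D ` CLM (q - 1)"
  obtain h where h: "presents (pointwise sm) ?Z ?B (HL sg br sm act q) h"
    using presents_HL by blast
  obtain \<psi> where "linear_map class_ring (HL sg br sm act q) (space_on sw W) \<psi>"
    "bij_betw \<psi> (carrier (HL sg br sm act q)) (carrier (space_on sw W))"
    using iso_vs_sym[OF iso] unfolding iso_vs_def by (elim exE conjE)
  from presents_linear_iso[OF h this]
  have P: "presents (pointwise sm) ?Z ?B (space_on sw W) (\<lambda>z. \<psi> (h z))" .
  note Zs = presents_subspace[OF P]
  have im: "(\<lambda>z. \<psi> (h z)) ` ?Z = W" using presents_image[OF P] by (simp add: space_on_def)
  obtain \<pi> where \<pi>: "Vector_Spaces.linear (pointwise sm) sw \<pi>" "\<forall>z\<in>?Z. \<pi> z = \<psi> (h z)" "range \<pi> \<subseteq> W"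
  proof -
    have "\<exists>\<pi>. Vector_Spaces.linear (pointwise sm) sw \<pi> \<and> (\<forall>z\<in>?Z. \<pi> z = \<psi> (h z)) \<and> range \<pi> \<subseteq> W"
    proof (rule extend_linear_on[OF P.vector_space_axioms sw Zs W])
      show "(\<lambda>z. \<psi> (h z)) ` ?Z \<subseteq> W" by (rule equalityD1[OF im])
      show "\<psi> (h (u + v)) = \<psi> (h u) + \<psi> (h v)" if "u \<in> ?Z" "v \<in> ?Z" for u v
        using presents_add[OF P that] by (simp add: space_on_def)
      show "\<psi> (h (pointwise sm c u)) = sw c (\<psi> (h u))" if "u \<in> ?Z" for c u
        using presents_scale[OF P that, of c] by (simp add: space_on_def)
    qed
    then show ?thesis using that by (elim exE conjE)
  qed
  have \<pi>0: "\<pi> z = 0 \<longleftrightarrow> z \<in> ?B" if "z \<in> ?Z" for z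
    using presents_zero_iff[OF P that] \<pi>(2) that by (simp add: space_on_def)
  have BZ: "?B \<subseteq> ?Z" using A.dCL_CL[of _ "q - 1"] dCL_dCL by auto
  have "\<pi> ` ?Z = (\<lambda>z. \<psi> (h z)) ` ?Z" by (rule image_cong[OF refl]) (use \<pi>(2) in blast)
  then have \<pi>im: "\<pi> ` ?Z = W" using im by simp
  interpret PW: vector_space_pair "pointwise sm" sw
    using P.vector_space_axioms sw by (simp add: vector_space_pair_def)
  interpret PP: vector_space_pair "pointwise sm" "pointwise sm :: 'k \<Rightarrow> ('g list \<Rightarrow> 'm) \<Rightarrow> _"
    by (intro vector_space_pair.intro P.vector_space_axioms)
  obtain \<sigma> where \<sigma>: "range \<sigma> \<subseteq> ?Z" "Vector_Spaces.linear sw (pointwise sm) \<sigma>" "\<forall>w\<in>W. \<pi> (\<sigma> w) = w"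
    using PW.linear_exists_right_inverse_on[OF \<pi>(1) Zs] unfolding \<pi>im by (elim exE conjE)
  obtain \<tau> where \<tau>: "range \<tau> \<subseteq> CLM (q - 1)" "Vector_Spaces.linear (pointwise sm) (pointwise sm) \<tau>"
    "\<forall>b\<in>?B. D (\<tau> b) = b"
    using PP.linear_exists_right_inverse_on[OF A.dCL_linear A.subspace_CL[of "q - 1"]] by (elim exE conjE)
  have "second_page sg br sm act sw W q \<pi> \<sigma> \<tau>"
  proof (intro second_page.intro second_page_axioms.intro lie_module_char_2_axioms sw W q \<pi>(1) \<sigma>(2) \<tau>(2))
    show "\<pi> c \<in> W" for c by (rule subsetD[OF \<pi>(3) rangeI])
    show "\<pi> (D c) = 0" if "c \<in> CLM (q - 1)" for c       using that by (intro iffD2[OF \<pi>0] subsetD[OF BZ] imageI)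
    show "c \<in> ?B" if "c \<in> CLM q" "D c = 0" "\<pi> c = 0" for c
      using that by (intro iffD1[OF \<pi>0]) simp_all
    show "\<sigma> w \<in> CLM q" "D (\<sigma> w) = 0" for w using subsetD[OF \<sigma>(1) rangeI[of \<sigma> w]] by simp_all
    show "\<pi> (\<sigma> w) = w" if "w \<in> W" for w by (rule bspec[OF \<sigma>(3) that])
    show "\<tau> c \<in> CLM (q - 1)" for c by (rule subsetD[OF \<tau>(1) rangeI])
    show "D (\<tau> c) = c" if "c \<in> ?B" for c by (rule bspec[OF \<tau>(3) that])
  qed
  then show ?thesis by blast
qed

text \<open>For nonnegative \<open>p\<close> and \<open>q\<close> this is
  \<open>iso_second_page\<close> with \<open>k = p + 1\<close>. Otherwise both sides vanish, for
  \<open>q < 0\<close> because \<open>W\<close> is a copy of zero.\<close>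

theorem page_2_iso_HR_coeff:
  assumes sw: "vector_space sw" and W: "Modules.module.subspace sw W"
    and iso: "iso_vs (space_on sw W) (HL sg br sm act q)"
  shows "iso_vs (page 2 p q) (HR_coeff sg br sw W p)"
proof -
  interpret C: trivial_coefficients sg br sw W by (rule trivial_coefficients_pointwise[OF sw W])
  consider "p < 0" | "0 \<le> p" "q < 0" | "0 \<le> p" "0 \<le> q" by linarith
  then show ?thesis
  proof cases
    case 1
    then show ?thesis
      using page_2_zero[of p q] C.HR_coeff_neg[OF char_2, of p] by (intro iso_vs_zero) simp_all
  next
    case 2
    then obtain j where p: "p = int j" using nonneg_int_cases by blast
    obtain h where h: "presents (pointwise sm) {c \<in> CLM q. D c = 0} (D ` CLM (q - 1)) (HL sg br sm act q) h"
      using presents_HL by blast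
    have "carrier (HL sg br sm act q) = {\<zero>\<^bsub>HL sg br sm act q\<^esub>}"
      by (rule presents_carrier_zero[OF h]) (use 2(2) in \<open>auto simp: A.CL_neg D.zero\<close>)
    then obtain f where f: "inj_on f W" "f ` W = {\<zero>\<^bsub>HL sg br sm act q\<^esub>}"
      using iso by (auto simp: iso_vs_def space_on_def bij_betw_def)
    have "w = 0" if "w \<in> W" for w
    proof (rule inj_onD[OF f(1) _ that])
      show "0 \<in> W" by (rule C.T.N_closed(1))
      then show "f w = f 0" using f(2) that by blast
    qed
    then have W0: "W = {0}" using C.T.N_closed(1) by blast
    obtain h' where h': "presents (pointwise sw) (rel_cocycles sg br sw W (Suc j))
        (rel_coboundaries sg br sw W (Suc j)) (HR_coeff sg br sw W p) h'"
      using C.presents_HR_nonneg[OF char_2] p by blast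
    have "g = 0" if "g \<in> rel_cocycles sg br sw W (Suc j)" for g
    proof -
      have "g l \<in> W" for l by (rule C.T.CL_range[OF C.S_CL]) (use that in blast)
      then show ?thesis by (auto simp: W0)
    qed
    then have "rel_cocycles sg br sw W (Suc j) \<subseteq> rel_coboundaries sg br sw W (Suc j)"
      using C.zero_rel_coboundaries by blast
    then show ?thesis
      using page_2_zero[of p q] 2 presents_carrier_zero[OF h'] presents_vectorspace[OF h']
      by (intro iso_vs_zero) simp_all
  next
    case 3
    then obtain j where p: "p = int j" using nonneg_int_cases by blast
    obtain \<pi> \<sigma> \<tau> where "second_page sg br sm act sw W q \<pi> \<sigma> \<tau>"
      using exists_second_page[OF sw W 3(2) iso] by blast
    then interpret S: second_page sg br sm act sw W q \<pi> \<sigma> \<tau> .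
    obtain h where h: "presents (pointwise sw) (rel_cocycles sg br sw W (Suc j))
        (rel_coboundaries sg br sw W (Suc j)) (HR_coeff sg br sw W p) h"
      using C.presents_HR_nonneg[OF char_2] p by blast
    have n: "nat (p + 1) = Suc j" "nat (p + 2 + 1) = Suc (Suc (Suc j))" "nat (p + 1 + 1) = Suc (Suc j)"
      "nat (p - 1 + 1) = j" "p + q + 2 = int (Suc (Suc j)) + q" "p + q + 1 + 2 = int (Suc (Suc (Suc j))) + q"
      "p + q - 1 + 2 = int (Suc j) + q" "p + q - 1 + 1 = p + q" "p - 1 + 1 = p" "p + 1 + 1 = p + 2"
      "nat (p + 2) = Suc (Suc j)" "nat p = j"
      using p by simp_all
    have Z: "cycles (int 2) p (p + q) = S.ZE (Suc j)"
      unfolding cycles_def Fil_def by (simp only: of_nat_numeral n)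
    have B: "boundaries (int 2) p (p + q) = S.BE (Suc j)"
    proof -
      have "int 2 - 1 = 1" "p - int 2 + 1 = p - 1" by simp_all
      then show ?thesis
        unfolding boundaries_def cycles_def Fil_def
        by (simp only: n mem_Collect_eq conj_assoc diff_Suc_1)
    qed
    have "presents (pointwise sm) (S.ZE (Suc j)) (S.BE (Suc j)) (page 2 p q) (page_coset 2 p (p + q))"
      unfolding Z[symmetric] B[symmetric] by (rule presents_page) simp
    then show ?thesis by (rule S.iso_second_page[OF _ h])
  qed
qed

text \<open>A complement of the coboundaries in the cocycles serves as \<open>W\<close> in both
  comparisons, of the page with \<open>HR_coeff\<close> and of \<open>HR_coeff\<close> with the
  tensor product.\<close>

theorem page_2_iso_tensor:
  assumes fd: "vectorspace.fin_dim class_ring (HR sg br p) \<or>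
    vectorspace.fin_dim class_ring (HL sg br sm act q)"
  shows "iso_vs (page 2 p q) (tensor (HR sg br p) (HL sg br sm act q))"
proof -
  interpret k: trivial_coefficients sg br "(*) :: 'k \<Rightarrow> 'k \<Rightarrow> 'k" UNIV
    by (rule trivial_coefficients_pointwise[OF vector_space_mult])
      (rule module.subspace_UNIV[OF vector_space_mult[folded module_iff_vector_space]])
  obtain h where h: "presents (pointwise sm) {c \<in> CLM q. D c = 0} (D ` CLM (q - 1)) (HL sg br sm act q) h"
    using presents_HL by blast
  have BZ: "D ` CLM (q - 1) \<subseteq> {c \<in> CLM q. D c = 0}" using A.dCL_CL[of _ "q - 1"] dCL_dCL by auto
  obtain W where W: "presents (pointwise sm) W {0} (HL sg br sm act q) h"
    using presents_complement[OF h subspace_D_image[OF A.subspace_CL] BZ] by blast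
  note Wsub = presents_subspace[OF W]
  interpret C: trivial_coefficients sg br "pointwise sm" W
    by (rule trivial_coefficients_pointwise[OF P.vector_space_axioms Wsub])
  show ?thesis
  proof (cases "0 \<le> p \<and> 0 \<le> q")
    case True
    then obtain j where p: "p = int j" using nonneg_int_cases by blast
    have "iso_vs (space_on (pointwise sm) W) (HL sg br sm act q)"
      by (rule iso_vs_presents[OF presents_space_on[OF P.vector_space_axioms Wsub] W, where h = "\<lambda>z. z"])
        auto
    then have "iso_vs (page 2 p q) (HR_coeff sg br (pointwise sm) W p)"
      by (rule page_2_iso_HR_coeff[OF P.vector_space_axioms Wsub])
    moreover have "iso_vs (HR_coeff sg br (pointwise sm) W p) (tensor (HR sg br p) (HL sg br sm act q))"
      using C.HR_coeff_iso_tensor[OF char_2 W] fd unfolding p by blast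
    ultimately show ?thesis by (rule iso_vs_trans)
  next
    case False
    then have pq: "p < 0 \<or> q < 0" by auto
    obtain h' where h': "presents (pointwise (pointwise (*))) {z \<in> k.SR (p + 1). k.\<Delta> z \<in> k.BM (p + 1)}
        {b + k.\<Delta> c | b c. b \<in> k.BM p \<and> c \<in> k.SR (p - 1 + 1)} (HR sg br p) h'"
      using k.presents_HR_coeff[OF char_2, of p] unfolding HR_def by blast
    have P2: "presents (pointwise sm) (cycles (int 2) p (p + q)) (boundaries (int 2) p (p + q)) (page 2 p q)
        (page_coset 2 p (p + q))" by (rule presents_page) simp
    note triv = page_2_trivial[OF pq]
    \<comment> \<open>The page is zero here, so the zero pairing is surjective onto it; injectivity
      holds because one of the two tensor factors is zero.\<close>
    show ?thesis
    proof (rule iso_vs_tensor[OF h' W P2, where \<beta> = "\<lambda>_ _. 0"])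
      show "\<exists>n zs ws. (\<forall>i<n::nat. zs i \<in> {z \<in> k.SR (p + 1). k.\<Delta> z \<in> k.BM (p + 1)} \<and> ws i \<in> W) \<and>
          x - (\<Sum>i<n. 0) \<in> boundaries (int 2) p (p + q)" if "x \<in> cycles (int 2) p (p + q)" for x
        using that triv by (intro exI[of _ 0]) auto
      show "z b \<in> {b + k.\<Delta> c | b c. b \<in> k.BM p \<and> c \<in> k.SR (p - 1 + 1)}"
        if I: "finite I" "I \<subseteq> W" "\<not> P.dependent I"
          "\<And>b. z b \<in> {z \<in> k.SR (p + 1). k.\<Delta> z \<in> k.BM (p + 1)}" "b \<in> I" for I z b
        using pq
      proof
        assume "p < 0"
        have "h' (z b) = \<zero>\<^bsub>HR sg br p\<^esub>"
          using k.HR_coeff_neg(2)[OF char_2 \<open>p < 0\<close>] presents_in[OF h' I(4)[of b]] unfolding HR_def by simp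
        then show ?thesis using presents_zero_iff[OF h' I(4)[of b]] by blast
      next
        assume "q < 0"
        have "carrier (HL sg br sm act q) = {\<zero>\<^bsub>HL sg br sm act q\<^esub>}"
          by (rule presents_carrier_zero[OF h]) (use \<open>q < 0\<close> in \<open>auto simp: A.CL_neg D.zero\<close>)
        then have "b = 0" using presents_zero_iff[OF W, of b] presents_in[OF W, of b] I(2,5) by auto
        then show ?thesis using I(3,5) P.dependent_zero by blast
      qed
      show "0 \<in> cycles (int 2) p (p + q)" by (rule P.subspace_0[OF subspace_cycles])
      show "0 \<in> boundaries (int 2) p (p + q)" by (rule P.subspace_0[OF subspace_boundaries])
    qed simp_all
  qed
qed

end

text \<open>One spectral sequence carries both descriptions of the second page. A copy
  \<open>W\<close> inside the type of cochains always exists, as a complement of the coboundaries in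
  the cocycles, so that the second description also reaches the positions where both factors are
  infinite-dimensional; there finite sums of pure tensors need not exhaust the classes with values
  in \<open>W\<close>.\<close>

theorem theorem5p3:
  fixes sg :: "'k::field \<Rightarrow> 'g::ab_group_add \<Rightarrow> 'g"
    and br :: "'g \<Rightarrow> 'g \<Rightarrow> 'g"
    and sm :: "'k \<Rightarrow> 'm::ab_group_add \<Rightarrow> 'm"
    and act :: "'g \<Rightarrow> 'm \<Rightarrow> 'm"
  assumes "CHAR('k) = 2"
    and "commutative_lie_algebra sg br"
    and "lie_module sg br sm act"
  shows "\<exists>(E :: nat \<Rightarrow> int \<Rightarrow> int \<Rightarrow> ('k, ('g list \<Rightarrow> 'm) set) module) d.
           spectral_sequence E d \<and>
           converges_to E d (H_rel sg br sm act) \<and>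
           (\<forall>p q. vectorspace.fin_dim class_ring (HR sg br p) \<or>
                  vectorspace.fin_dim class_ring (HL sg br sm act q) \<longrightarrow>
                  iso_vs (E 2 p q) (tensor (HR sg br p) (HL sg br sm act q))) \<and>
           (\<forall>p q (W :: ('g list \<Rightarrow> 'm) set). Modules.module.subspace (pointwise sm) W \<longrightarrow>
                  iso_vs (space_on (pointwise sm) W) (HL sg br sm act q) \<longrightarrow>
                  iso_vs (E 2 p q) (HR_coeff sg br (pointwise sm) W p))"
proof -
  interpret lie_module_char_2 sg br sm act
    using assms(1,3) by (simp add: lie_module_char_2_def lie_module_char_2_axioms_def)
  show ?thesis
    using spectral_sequence_page page_converges_to_H_rel page_2_iso_tensor
      page_2_iso_HR_coeff[OF P.vector_space_axioms]
    by (intro exI[of _ page] exI[of _ page_d]) blast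
qed

end
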